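(* Let $X=\{X_t;t\ge 0\}$ be a symmetric stable process of order $\beta$ in $\mathbb{R}^d$ with characteristic exponent $\psi$, where $2d/3<\beta\le d$, and let $\gamma_t$ be its renormalized self-intersection local time. Then $$\limsup_{t\to\infty}\frac{\gamma_t}{t^{2-d/\beta}(\log\log t)^{d/\beta}}=a_\psi^{-d/\beta}\qquad\text{a.s.},$$ where $a_\psi\in(0,\infty)$ is the constant determined by $\lim_{t\to\infty}\frac1t\log P(\gamma_t\ge h t^2)=-h^{\beta/d}a_\psi$ for all $h>0$.
   Context: A symmetric stable process of order (index) $\beta$ in $\mathbb{R}^d$ here means a nondegenerate $d$-dimensional Lévy process $X_t$ (started at $0$) with $E(e^{i\lambda\cdot X_t})=e^{-t\psi(\lambda)}$, where $\psi\ge 0$ is continuous, $\psi(-\lambda)=\psi(\lambda)$, $\psi(r\lambda)=r^\beta\psi(\lambda)$ for all $r\ge0$, and $c|\lambda|^\beta\le\psi(\lambda)\le C|\lambda|^\beta$ for some $0<c<C<\infty$. Spherical symmetry is not assumed. Let $f\in\mathcal S(\mathbb{R}^d)$ (Schwartz class) be a positive, symmetric function with $\int f\,dx=1$, and $f_\varepsilon(x)=\varepsilon^{-d}f(x/\varepsilon)$. Set $$\gamma_{t,\varepsilon}=\int_0^t\int_0^s f_\varepsilon(X_s-X_r)\,dr\,ds-E\Big\{\int_0^t\int_0^s f_\varepsilon(X_s-X_r)\,dr\,ds\Big\}.$$ For $2d/3<\beta\le d$ the limit $\gamma_t=\lim_{\varepsilon\to0}\gamma_{t,\varepsilon}$ exists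 (a.s. and in all $L^p$ spaces), and $\gamma_t$ is almost surely continuous in $t$; it is called the renormalized self-intersection local time of $X$. For $2d/3<\beta\le d$ there is a (necessarily unique) constant $a_\psi\in(0,\infty)$ with $\lim_{t\to\infty}\frac1t\log P(\gamma_t\ge h t^2)=-h^{\beta/d}a_\psi$ for every $h>0$; its existence is part of the setting. *)

theory Defs
  imports "HOL-Probability.Probability"
begin

text \<open>
  Cadlag regularity is required of every path rather than almost every path: this makes the
  time integrals of functions of \<open>X\<close> below random variables without completing \<open>M\<close>.
\<close>

locale levy_process = prob_space M for M :: "'w measure" +
  fixes X :: "real \<Rightarrow> 'w \<Rightarrow> 'a::euclidean_space"
  assumes random_variable_X: "\<And>t. 0 \<le> t \<Longrightarrow> random_variable borel (X t)"
    and start_zero: "AE \<omega> in M. X 0 \<omega> = 0"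
    and independent_increments:
      "\<And>(n::nat) t. 0 \<le> t 0 \<Longrightarrow> (\<And>i. i < n \<Longrightarrow> t i \<le> t (Suc i)) \<Longrightarrow>
         indep_vars (\<lambda>_. borel) (\<lambda>i \<omega>. X (t (Suc i)) \<omega> - X (t i) \<omega>) {..<n}"
    and stationary_increments:
      "\<And>s h. 0 \<le> s \<Longrightarrow> 0 \<le> h \<Longrightarrow>
         distr M borel (\<lambda>\<omega>. X (s + h) \<omega> - X s \<omega>) = distr M borel (X h)"
    and right_continuous:
      "\<And>\<omega> t. \<omega> \<in> space M \<Longrightarrow> 0 \<le> t \<Longrightarrow> continuous (at_right t) (\<lambda>s. X s \<omega>)"
    and left_limits:
      "\<And>\<omega> t. \<omega> \<in> space M \<Longrightarrow> 0 < t \<Longrightarrow> \<exists>l. ((\<lambda>s. X s \<omega>) \<longlongrightarrow> l) (at_left t)"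

text \<open>
  Nondegeneracy is the lower bound in \<open>exponent_bounds\<close>; spherical symmetry is not assumed.
\<close>

locale symmetric_stable_process = levy_process M X
  for M :: "'w measure" and X :: "real \<Rightarrow> 'w \<Rightarrow> 'a::euclidean_space" +
  fixes \<beta> :: real and \<psi> :: "'a \<Rightarrow> real"
  assumes index_pos: "0 < \<beta>"
    and characteristic_exponent:
      "\<And>t u. 0 \<le> t \<Longrightarrow> (CLINT \<omega>|M. iexp (u \<bullet> X t \<omega>)) = complex_of_real (exp (- t * \<psi> u))"
    and exponent_nonneg: "\<And>u. 0 \<le> \<psi> u"
    and exponent_continuous: "continuous_on UNIV \<psi>"
    and exponent_symmetric: "\<And>u. \<psi> (- u) = \<psi> u"
    and exponent_homogeneous: "\<And>r u. 0 \<le> r \<Longrightarrow> \<psi> (r *\<^sub>R u) = r powr \<beta> * \<psi> u"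
    and exponent_bounds:
      "\<exists>c C. 0 < c \<and> c < C \<and>
         (\<forall>u. c * norm u powr \<beta> \<le> \<psi> u \<and> \<psi> u \<le> C * norm u powr \<beta>)"

primrec iterated_partial ::
  "'a list \<Rightarrow> ('a::euclidean_space \<Rightarrow> real) \<Rightarrow> 'a \<Rightarrow> real" where
  "iterated_partial [] f = f"
| "iterated_partial (b # bs) f =
     (\<lambda>x. frechet_derivative (iterated_partial bs f) (at x) b)"

text \<open>
  Since \<open>frechet_derivative\<close> is total, smoothness is imposed separately: every iterated partial
  derivative (in coordinate directions, including order zero) must itself be differentiable.
\<close>

definition schwartz :: "('a::euclidean_space \<Rightarrow> real) \<Rightarrow> bool" where
  "schwartz f \<longleftrightarrow>
     (\<forall>bs. set bs \<subseteq> Basis \<longrightarrow>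
        (\<forall>x. iterated_partial bs f differentiable (at x)) \<and>
        (\<forall>k::nat. bounded (range (\<lambda>x. norm x ^ k * iterated_partial bs f x))))"

definition mollifier :: "('a::euclidean_space \<Rightarrow> real) \<Rightarrow> bool" where
  "mollifier f \<longleftrightarrow>
     schwartz f \<and> (\<forall>x. 0 \<le> f x) \<and> (\<forall>x. f (- x) = f x) \<and> (LBINT x. f x) = 1"

definition rescale :: "('a::euclidean_space \<Rightarrow> real) \<Rightarrow> real \<Rightarrow> 'a \<Rightarrow> real" where
  "rescale f \<epsilon> x = f (x /\<^sub>R \<epsilon>) / \<epsilon> ^ DIM('a)"

definition self_intersection_approx ::
  "(real \<Rightarrow> 'w \<Rightarrow> 'a::euclidean_space) \<Rightarrow> ('a \<Rightarrow> real) \<Rightarrow> real \<Rightarrow> real \<Rightarrow> 'w \<Rightarrow> real" where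
  "self_intersection_approx X f t \<epsilon> \<omega> =
     (LBINT s:{0..t}. (LBINT r:{0..s}. rescale f \<epsilon> (X s \<omega> - X r \<omega>)))"

definition renormalized_approx ::
  "'w measure \<Rightarrow> (real \<Rightarrow> 'w \<Rightarrow> 'a::euclidean_space) \<Rightarrow> ('a \<Rightarrow> real) \<Rightarrow>
     real \<Rightarrow> real \<Rightarrow> 'w \<Rightarrow> real" where
  "renormalized_approx M X f t \<epsilon> \<omega> =
     self_intersection_approx X f t \<epsilon> \<omega> -
     (LINT \<omega>'|M. self_intersection_approx X f t \<epsilon> \<omega>')"

text \<open>
  For each fixed \<open>t\<close> the limit is only determined up to a null set depending on \<open>t\<close>; the almost
  sure continuity in \<open>t\<close> pins the process down up to indistinguishability. The \<open>L\<^sup>p\<close> distance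
  is a nonnegative integral, so its convergence to \<open>0\<close> entails that it is eventually finite.
\<close>

definition renormalized_self_intersection_local_time ::
  "'w measure \<Rightarrow> (real \<Rightarrow> 'w \<Rightarrow> 'a::euclidean_space) \<Rightarrow> ('a \<Rightarrow> real) \<Rightarrow>
     (real \<Rightarrow> 'w \<Rightarrow> real) \<Rightarrow> bool" where
  "renormalized_self_intersection_local_time M X f \<gamma> \<longleftrightarrow>
     (\<forall>t\<ge>0. \<gamma> t \<in> borel_measurable M) \<and>
     (\<forall>t\<ge>0. AE \<omega> in M. ((\<lambda>\<epsilon>. renormalized_approx M X f t \<epsilon> \<omega>) \<longlongrightarrow> \<gamma> t \<omega>) (at_right 0)) \<and>
     (\<forall>t\<ge>0. \<forall>p\<ge>1.
        ((\<lambda>\<epsilon>. \<integral>\<^sup>+\<omega>. ennreal (\<bar>renormalized_approx M X f t \<epsilon> \<omega> - \<gamma> t \<omega>\<bar> powr p) \<partial>M)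
           \<longlongrightarrow> 0) (at_right 0)) \<and>
     (AE \<omega> in M. continuous_on {0..} (\<lambda>t. \<gamma> t \<omega>))"

end

theory Submission
  imports Defs
begin

text \<open>
  Write \<open>\<rho> = d / \<beta>\<close>. The process enters through three facts. First, scaling: \<open>\<gamma> t\<close> has the law of
  \<open>t powr (2 - \<rho>) * \<gamma> 1\<close>, which turns the large deviation limit at \<open>h = 1\<close> into the tail
  \<open>P(\<gamma> 1 \<ge> y) = exp (- (a + o(1)) * y powr (1 / \<rho>))\<close>. Second, superadditivity: the intersections
  of \<open>X\<close> on \<open>[0, t]\<close> with \<open>X\<close> on \<open>[t, T]\<close> are nonnegative and have mean at most
  \<open>K * T powr (2 - \<rho>)\<close>, so \<open>\<gamma> T\<close> is at least \<open>\<gamma> t\<close> plus the local time of the increments after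
  \<open>t\<close>, minus \<open>K * T powr (2 - \<rho>)\<close>. Third, the past and the increments after \<open>t\<close> are independent.

  For the upper bound, superadditivity gives an Ottaviani-type maximal inequality
  \<open>P(sup \<gamma> > y on [0, T]) \<le> 2 * P(\<gamma> T \<ge> y - K' * T powr (2 - \<rho>))\<close>, and Borel--Cantelli along
  \<open>\<theta> ^ n\<close> with \<open>\<theta>\<close> close to \<open>1\<close> suffices. For the lower bound, the local time of the increments
  over \<open>[\<theta> ^ n, \<theta> ^ Suc n]\<close>, with \<open>\<theta>\<close> large, is large infinitely often; tightness of \<open>\<gamma> 1\<close>,
  applied at the last such \<open>n\<close>, controls the past without any lower tail estimate for \<open>\<gamma>\<close>.
\<close>

section \<open>Gaussian smoothing and characteristic functions\<close>

text \<open>Scaling and independence cannot be read off \<open>\<gamma>\<close>, which is given only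
  as an almost sure limit; both are proved for \<open>X\<close> and carried over by measurable
  functionals of the path. Scaling needs that characteristic functions determine laws on Euclidean
  space, which Gaussian smoothing yields. The same Gaussian identity gives a second result: if the
  characteristic function of Z is at most exp(-k |u|^\<beta>), then E f_eps(Z) is at most D
  k^(-\<rho>), with D independent of eps, since a Schwartz function is dominated by a mixture of
  Gaussians. With k proportional to s - r, this explains the role of the cross terms. For \<rho> at
  least 1, (s - r)^(-\<rho>) is not integrable over the triangle r < s < T; over the rectangle r < t
  < s, which touches the diagonal at a corner only, it is integrable as soon as \<rho> < 2. So the
  bounds on the separate means may blow up as eps tends to 0, whereas the mean of [0, T] minus those
  of [0, t] and [t, T] is a cross mean and stays of order at most T^(2 - \<rho>). A loss of that
  order is negligible against the iterated logarithm.\<close>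

abbreviation gauss_kernel :: "'a::euclidean_space \<Rightarrow> real" where
  "gauss_kernel x \<equiv> exp (- (norm x)\<^sup>2 / 2)"

text \<open>Under \<open>gauss_coords\<close> this is a standard Gaussian vector. Keeping the
  product space of coordinates makes Gaussian integrals factor.\<close>

definition of_coords :: "('a::euclidean_space \<Rightarrow> real) \<Rightarrow> 'a" where
  "of_coords z = (\<Sum>b\<in>Basis. z b *\<^sub>R b)"

abbreviation gauss_coords :: "('a::euclidean_space \<Rightarrow> real) measure" where
  "gauss_coords \<equiv> PiM Basis (\<lambda>_. std_normal_distribution)"

lemma of_coords_inner: "of_coords z \<bullet> x = (\<Sum>b\<in>Basis. (b \<bullet> x) * z b)"
  by (simp add: of_coords_def inner_sum_left mult.commute)

lemma of_coords_inner_Basis: "b \<in> Basis \<Longrightarrow> of_coords z \<bullet> b = z b"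
  by (simp add: of_coords_def)

lemma norm_of_coords: "(norm (of_coords z))\<^sup>2 = (\<Sum>b\<in>Basis. (z b)\<^sup>2)"
  by (simp only: power2_norm_eq_inner, subst euclidean_inner) (simp add: of_coords_inner_Basis power2_eq_square)

lemma measurable_of_coords [measurable]:
  "(of_coords :: ('a::euclidean_space \<Rightarrow> real) \<Rightarrow> 'a) \<in> borel_measurable (PiM Basis (\<lambda>_. borel))"
  unfolding of_coords_def by measurable

lemma sets_gauss_coords [measurable_cong]:
  "sets (gauss_coords :: ('a::euclidean_space \<Rightarrow> real) measure) = sets (PiM Basis (\<lambda>_. borel))"
  by (intro sets_PiM_cong) auto

lemma prob_space_gauss_coords: "prob_space (gauss_coords :: ('a::euclidean_space \<Rightarrow> real) measure)"
  by (intro prob_space_PiM) (auto intro: prob_space_normal_density)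

text \<open>The coordinates are independent, so the claim reduces to the one-dimensional normal
  characteristic function. It expresses the kernel as an average of exponentials, the key to
  everything in this section.\<close>

lemma gauss_coords_char:
  "(CLINT z|gauss_coords. iexp (of_coords z \<bullet> x)) = complex_of_real (gauss_kernel x)"
proof -
  interpret N: prob_space std_normal_distribution by (rule prob_space_normal_density) simp
  interpret product_sigma_finite "\<lambda>_::'a. std_normal_distribution" ..
  have "(CLINT z|gauss_coords. iexp (of_coords z \<bullet> x)) =
        (CLINT z|gauss_coords. (\<Prod>b\<in>Basis. iexp ((b \<bullet> x) * z b)))"
    by (simp add: of_coords_inner sum_distrib_left exp_sum)
  also have "\<dots> = (\<Prod>b\<in>Basis. (CLINT t|std_normal_distribution. iexp ((b \<bullet> x) * t)))"
    by (rule product_integral_prod[where f="\<lambda>b t. iexp ((b \<bullet> x) * t)"])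
      (auto intro!: N.integrable_const_bound[where B=1])
  also have "\<dots> = (\<Prod>b\<in>Basis. complex_of_real (exp (- (b \<bullet> x)\<^sup>2 / 2)))"
    using char_std_normal_distribution by (auto simp: char_def fun_eq_iff)
  also have "\<dots> = complex_of_real (exp (\<Sum>b\<in>Basis. - (b \<bullet> x)\<^sup>2 / 2))"
    by (simp only: exp_sum[OF finite_Basis] of_real_prod)
  also have "(\<Sum>b\<in>Basis. - (b \<bullet> x)\<^sup>2 / 2) = - (norm x)\<^sup>2 / 2"
    by (simp only: power2_norm_eq_inner, subst euclidean_inner[of x x]) (simp add: sum_negf sum_divide_distrib power2_eq_square inner_commute)
  finally show ?thesis .
qed

text \<open>A Parseval identity: write the kernel as a Gaussian average of exponentials and exchange
  the two expectations. The right-hand side sees \<open>X\<close> only through its characteristic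
  function.\<close>

lemma (in prob_space) expectation_gauss_kernel:
  fixes X :: "'a \<Rightarrow> 'b::euclidean_space"
  assumes [measurable]: "random_variable borel X"
  shows "complex_of_real (expectation (\<lambda>\<omega>. gauss_kernel (r *\<^sub>R (X \<omega> - x)))) =
    (CLINT z|gauss_coords. iexp (- (r * (of_coords z \<bullet> x))) * (CLINT \<omega>|M. iexp ((r *\<^sub>R of_coords z) \<bullet> X \<omega>)))"
proof -
  interpret G: prob_space "gauss_coords :: ('b \<Rightarrow> real) measure" by (rule prob_space_gauss_coords)
  interpret P: pair_prob_space M "gauss_coords :: ('b \<Rightarrow> real) measure" ..
  have "complex_of_real (expectation (\<lambda>\<omega>. gauss_kernel (r *\<^sub>R (X \<omega> - x)))) =
     (CLINT \<omega>|M. complex_of_real (gauss_kernel (r *\<^sub>R (X \<omega> - x))))"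
    by simp
  also have "\<dots> = (CLINT \<omega>|M. (CLINT z|gauss_coords. iexp (of_coords z \<bullet> (r *\<^sub>R (X \<omega> - x)))))"
    by (simp only: gauss_coords_char)
  also have "\<dots> = (CLINT z|gauss_coords. (CLINT \<omega>|M. iexp (of_coords z \<bullet> (r *\<^sub>R (X \<omega> - x)))))"
    by (intro P.Fubini_integral[symmetric] P.integrable_const_bound[where B=1]) auto
  also have "\<dots> = (CLINT z|gauss_coords. iexp (- (r * (of_coords z \<bullet> x))) * (CLINT \<omega>|M. iexp ((r *\<^sub>R of_coords z) \<bullet> X \<omega>)))"
    by (subst integral_mult_right_zero[symmetric], intro Bochner_Integration.integral_cong refl)
      (simp add: algebra_simps exp_add[symmetric] exp_diff exp_minus divide_inverse)
  finally show ?thesis .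
qed

lemma gauss_kernel_integrable: "integrable lborel (\<lambda>x::'a::euclidean_space. gauss_kernel x)"
  and gauss_kernel_integral_pos: "0 < (LBINT x::'a. gauss_kernel x)"
proof -
  interpret product_sigma_finite "\<lambda>_::'a. lborel :: real measure" ..
  have fin: "(\<integral>\<^sup>+x. ennreal (exp (- x\<^sup>2 / 2)) \<partial>(lborel :: real measure)) < \<infinity>"
  proof -
    have "integrable lborel (\<lambda>x. sqrt (2 * pi) * std_normal_density x)"
      by (intro integrable_mult_right) simp
    then have "integrable lborel (\<lambda>x::real. exp (- x\<^sup>2 / 2))"
      by (simp add: std_normal_density_def)
    then show ?thesis
      by (auto simp: integrable_iff_bounded)
  qed
  have "(\<integral>\<^sup>+x. ennreal (gauss_kernel (x::'a)) \<partial>lborel) =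
     (\<integral>\<^sup>+z. (\<Prod>b\<in>Basis. ennreal (exp (- (z b)\<^sup>2 / 2))) \<partial>PiM Basis (\<lambda>_::'a. lborel))"
    by (subst lborel_eq, subst nn_integral_distr)
      (auto simp: of_coords_def[symmetric] norm_of_coords sum_negf[symmetric]
        sum_divide_distrib exp_sum prod_ennreal simp del: sum_negf)
  also have "\<dots> = (\<Prod>b\<in>(Basis::'a set). \<integral>\<^sup>+x. ennreal (exp (- x\<^sup>2 / 2)) \<partial>lborel)"
    by (rule product_nn_integral_prod) auto
  also have "\<dots> < \<infinity>"
    using fin by (simp add: power_less_top_ennreal)
  finally show *: "integrable lborel (\<lambda>x::'a::euclidean_space. gauss_kernel x)"
    by (auto simp: integrable_iff_bounded)
  show "0 < (LBINT x::'a. gauss_kernel x)"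
    using integral_nonneg_eq_0_iff_AE[OF *] Bochner_Integration.integral_nonneg[of lborel "\<lambda>x::'a. gauss_kernel x"] AE_iff_measurable[of "UNIV :: 'a set" lborel "\<lambda>_. False"]
    by (auto simp: less_le emeasure_lborel_UNIV)
qed

lemma (in prob_space) expectation_gauss_kernel_eq:
  fixes X :: "'a \<Rightarrow> 'b::euclidean_space" and Y :: "'c \<Rightarrow> 'b"
  assumes [measurable]: "random_variable borel X"
    and "prob_space N" and [measurable]: "Y \<in> borel_measurable N"
    and eq: "\<And>u. (CLINT \<omega>|M. iexp (u \<bullet> X \<omega>)) = (CLINT \<omega>|N. iexp (u \<bullet> Y \<omega>))"
  shows "expectation (\<lambda>\<omega>. gauss_kernel (r *\<^sub>R (X \<omega> - x))) =
     (LINT \<omega>|N. gauss_kernel (r *\<^sub>R (Y \<omega> - x)))"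
proof -
  interpret N: prob_space N by fact
  show ?thesis
    using expectation_gauss_kernel[OF assms(1), of r x] N.expectation_gauss_kernel[OF assms(3), of r x]
    unfolding eq of_real_eq_iff[where 'a=complex, symmetric] by (simp only:)
qed

lemma lborel_integral_affine_euclidean:
  fixes f :: "'a::euclidean_space \<Rightarrow> real"
  assumes "c \<noteq> 0" and [measurable]: "f \<in> borel_measurable borel"
  shows "(LBINT x. f x) = \<bar>c\<bar> ^ DIM('a) * (LBINT x. f (t + c *\<^sub>R x))"
  by (subst lborel_affine[OF assms(1), of t])
    (simp add: integral_density integral_distr)

text \<open>Averaging \<open>g\<close> over a Gaussian of width \<open>1 / r\<close> around
  \<open>X\<close> becomes, after an affine substitution and Fubini, an integral against Gaussian
  expectations of \<open>X\<close>, which the characteristic function determines.\<close>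

lemma (in prob_space) expectation_smoothed:
  fixes X :: "'a \<Rightarrow> 'b::euclidean_space" and g :: "'b \<Rightarrow> real"
  assumes [measurable]: "random_variable borel X" "g \<in> borel_measurable borel"
    and B: "\<And>x. \<bar>g x\<bar> \<le> B" and r: "0 < r"
  shows "expectation (\<lambda>\<omega>. LBINT x. g (X \<omega> + (1 / r) *\<^sub>R x) * gauss_kernel x) =
    r ^ DIM('b) * (LBINT x. g x * expectation (\<lambda>\<omega>. gauss_kernel (r *\<^sub>R (X \<omega> - x))))"
proof -
  interpret P: pair_sigma_finite lborel M ..
  let ?K = "\<lambda>x::'b. gauss_kernel x"
  have B0: "0 \<le> B" using B[of 0] by linarith
  have change: "(LBINT x. g (y + (1 / r) *\<^sub>R x) * ?K x) = r ^ DIM('b) * (LBINT x. g x * ?K (r *\<^sub>R (y - x)))" for y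
    using r by (subst lborel_integral_affine_euclidean[of "1/r" "\<lambda>x. g x * ?K (r *\<^sub>R (y - x))" y])
      (auto simp: power_divide)
  have int: "integrable (lborel \<Otimes>\<^sub>M M) (\<lambda>(x, \<omega>). g x * ?K (r *\<^sub>R (X \<omega> - x)))"
  proof (rule integrableI_bounded)
    have kk: "(\<integral>\<^sup>+x. ennreal (?K (r *\<^sub>R (y - x))) \<partial>lborel) = ennreal (1 / r ^ DIM('b)) * (\<integral>\<^sup>+x. ennreal (?K x) \<partial>lborel)" for y
      using r by (subst lborel_affine[of "1/r" y], simp)
        (subst nn_integral_density, auto simp: nn_integral_distr nn_integral_cmult power_divide)
    have "(\<integral>\<^sup>+p. ennreal (norm (case p of (x, \<omega>) \<Rightarrow> g x * ?K (r *\<^sub>R (X \<omega> - x)))) \<partial>(lborel \<Otimes>\<^sub>M M))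
       \<le> (\<integral>\<^sup>+p. ennreal B * ennreal (?K (r *\<^sub>R (X (snd p) - fst p))) \<partial>(lborel \<Otimes>\<^sub>M M))"
      using B B0 by (intro nn_integral_mono) (auto simp: abs_mult split_beta ennreal_mult'[symmetric] intro!: ennreal_leI mult_right_mono)
    also have "\<dots> = (\<integral>\<^sup>+\<omega>. (\<integral>\<^sup>+x. ennreal B * ennreal (?K (r *\<^sub>R (X \<omega> - x))) \<partial>lborel) \<partial>M)"
      by (subst P.nn_integral_snd[symmetric]) (auto simp: split_beta)
    also have "\<dots> = (\<integral>\<^sup>+\<omega>. ennreal B * (ennreal (1 / r ^ DIM('b)) * (\<integral>\<^sup>+x. ennreal (?K x) \<partial>lborel)) \<partial>M)"
      by (intro nn_integral_cong) (subst nn_integral_cmult, simp, simp only: kk)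
    also have "\<dots> < \<infinity>"
      using gauss_kernel_integrable[where 'a='b]
      by (simp add: ennreal_mult_less_top emeasure_space_1 integrable_iff_bounded)
    finally show "(\<integral>\<^sup>+p. ennreal (norm (case p of (x, \<omega>) \<Rightarrow> g x * ?K (r *\<^sub>R (X \<omega> - x)))) \<partial>(lborel \<Otimes>\<^sub>M M)) < \<infinity>" .
  qed simp
  show ?thesis
    using P.Fubini_integral[OF int] unfolding change by (simp del: norm_scaleR)
qed

lemma (in prob_space) expectation_smoothed_tendsto:
  fixes X :: "'a \<Rightarrow> 'b::euclidean_space" and g :: "'b \<Rightarrow> real"
  assumes [measurable]: "random_variable borel X" and g: "continuous_on UNIV g"
    and B: "\<And>x. \<bar>g x\<bar> \<le> B"
  shows "(\<lambda>n. expectation (\<lambda>\<omega>. LBINT x. g (X \<omega> + (1 / real (Suc n)) *\<^sub>R x) * gauss_kernel x))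
    \<longlonglongrightarrow> expectation (\<lambda>\<omega>. g (X \<omega>)) * (LBINT x::'b. gauss_kernel x)"
proof -
  let ?K = "\<lambda>x::'b. gauss_kernel x"
  have [measurable]: "g \<in> borel_measurable borel"
    using g by (rule borel_measurable_continuous_onI)
  have Kint: "integrable lborel (\<lambda>x. B * ?K x)"
    by (intro integrable_mult_right gauss_kernel_integrable)
  have bnd: "\<bar>g (y + c *\<^sub>R x) * ?K x\<bar> \<le> B * ?K x" for y c x
    using B by (simp add: abs_mult mult_right_mono)
  have lim: "(\<lambda>n. LBINT x. g (y + (1 / real (Suc n)) *\<^sub>R x) * ?K x) \<longlonglongrightarrow> (LBINT x. g y * ?K x)" for y
  proof (rule integral_dominated_convergence[OF _ _ Kint])
    show "AE x in lborel. (\<lambda>n. g (y + (1 / real (Suc n)) *\<^sub>R x) * ?K x) \<longlonglongrightarrow> g y * ?K x"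
    proof (intro AE_I2 tendsto_mult tendsto_const)
      fix x
      have "(\<lambda>n. 1 / real (Suc n)) \<longlonglongrightarrow> 0"
        by (rule LIMSEQ_Suc[OF lim_1_over_n])
      then have "(\<lambda>n. y + (1 / real (Suc n)) *\<^sub>R x) \<longlonglongrightarrow> y + 0 *\<^sub>R x"
        by (intro tendsto_intros)
      then show "(\<lambda>n. g (y + (1 / real (Suc n)) *\<^sub>R x)) \<longlonglongrightarrow> g y"
        using continuous_on_tendsto_compose[OF g, of _ y sequentially] by simp
    qed
  qed (use bnd in auto)
  have "(\<lambda>n. expectation (\<lambda>\<omega>. LBINT x. g (X \<omega> + (1 / real (Suc n)) *\<^sub>R x) * ?K x))
    \<longlonglongrightarrow> expectation (\<lambda>\<omega>. LBINT x. g (X \<omega>) * ?K x)"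
  proof (rule integral_dominated_convergence[where w="\<lambda>_. LBINT x. B * ?K x"])
    show "AE \<omega> in M. norm (LBINT x. g (X \<omega> + (1 / real (Suc n)) *\<^sub>R x) * ?K x) \<le> (LBINT x. B * ?K x)" for n
    proof (intro AE_I2)
      fix \<omega>
      have "integrable lborel (\<lambda>x. g (X \<omega> + (1 / real (Suc n)) *\<^sub>R x) * ?K x)"
        by (rule Bochner_Integration.integrable_bound[OF Kint]) (use bnd order_trans[OF bnd abs_ge_self] in auto)
      then show "norm (LBINT x. g (X \<omega> + (1 / real (Suc n)) *\<^sub>R x) * ?K x) \<le> (LBINT x. B * ?K x)"
        using bnd by (intro Bochner_Integration.integral_norm_bound_integral Kint) auto
    qed
  qed (use lim in auto)
  then show ?thesis by simp
qed

text \<open>The smoothed expectations agree for every width \<open>1 / Suc n\<close>; letting the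
  width tend to 0 and dividing by the positive Gaussian mass removes the smoothing.\<close>

lemma (in prob_space) expectation_eq_if_char_eq:
  fixes X :: "'a \<Rightarrow> 'b::euclidean_space" and Y :: "'c \<Rightarrow> 'b" and g :: "'b \<Rightarrow> real"
  assumes X [measurable]: "random_variable borel X"
    and N: "prob_space N" and Y [measurable]: "Y \<in> borel_measurable N"
    and eq: "\<And>u. (CLINT \<omega>|M. iexp (u \<bullet> X \<omega>)) = (CLINT \<omega>|N. iexp (u \<bullet> Y \<omega>))"
    and g: "continuous_on UNIV g" and B: "\<And>x. \<bar>g x\<bar> \<le> B"
  shows "expectation (\<lambda>\<omega>. g (X \<omega>)) = (LINT \<omega>|N. g (Y \<omega>))"
proof -
  interpret N: prob_space N by fact
  have g' [measurable]: "g \<in> borel_measurable borel"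
    using g by (rule borel_measurable_continuous_onI)
  have "(\<lambda>n. expectation (\<lambda>\<omega>. LBINT x. g (X \<omega> + (1 / real (Suc n)) *\<^sub>R x) * gauss_kernel x))
     = (\<lambda>n. LINT \<omega>|N. (LBINT x. g (Y \<omega> + (1 / real (Suc n)) *\<^sub>R x) * gauss_kernel x))"
    by (intro ext) (simp only: expectation_smoothed[OF X g' B] N.expectation_smoothed[OF Y g' B]
        expectation_gauss_kernel_eq[OF X N Y eq] zero_less_divide_1_iff of_nat_0_less_iff zero_less_Suc)
  note eqn = this
  have "expectation (\<lambda>\<omega>. g (X \<omega>)) * (LBINT x::'b. gauss_kernel x) =
     (LINT \<omega>|N. g (Y \<omega>)) * (LBINT x::'b. gauss_kernel x)"
    by (rule LIMSEQ_unique[OF expectation_smoothed_tendsto[OF X g B, unfolded eqn]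
          N.expectation_smoothed_tendsto[OF Y g B]])
  then show ?thesis
    using gauss_kernel_integral_pos[where 'a='b] by simp
qed

text \<open>The tent functions decrease to the indicator of \<open>C\<close>, because off a closed
  set the distance is positive. The empty set is excluded since
  \<open>infdist x {} = 0\<close>.\<close>

lemma (in prob_space) measure_closed_tendsto:
  fixes X :: "'a \<Rightarrow> 'b::euclidean_space"
  assumes [measurable]: "random_variable borel X" and C: "closed C" "C \<noteq> {}"
  shows "(\<lambda>n. expectation (\<lambda>\<omega>. max 0 (1 - real n * infdist (X \<omega>) C))) \<longlonglongrightarrow> measure (distr M borel X) C"
proof -
  have [measurable]: "C \<in> sets borel" using C by auto
  have "(\<lambda>n. expectation (\<lambda>\<omega>. max 0 (1 - real n * infdist (X \<omega>) C))) \<longlonglongrightarrow> expectation (\<lambda>\<omega>. indicator C (X \<omega>))"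
  proof (rule integral_dominated_convergence[where w="\<lambda>_. 1"])
    show "AE \<omega> in M. (\<lambda>n. max 0 (1 - real n * infdist (X \<omega>) C)) \<longlonglongrightarrow> indicator C (X \<omega>)"
    proof (intro AE_I2)
      fix \<omega>
      show "(\<lambda>n. max 0 (1 - real n * infdist (X \<omega>) C)) \<longlonglongrightarrow> indicator C (X \<omega>)"
      proof (cases "X \<omega> \<in> C")
        case False
        then have pos: "0 < infdist (X \<omega>) C"
          using C by (metis in_closed_iff_infdist_zero infdist_nonneg less_eq_real_def)
        have "eventually (\<lambda>n. max 0 (1 - real n * infdist (X \<omega>) C) = 0) sequentially"
        proof -
          obtain N where N: "1 < real N * infdist (X \<omega>) C" using reals_Archimedean3[OF pos] by blast
          have "1 - real n * infdist (X \<omega>) C \<le> 0" if "n \<ge> N" for n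
            using N mult_right_mono[of "real N" "real n" "infdist (X \<omega>) C"] that pos by linarith
          then show ?thesis by (intro eventually_sequentiallyI[of N]) (simp add: max_absorb1)
        qed
        then show ?thesis using False by (simp add: tendsto_eventually)
      qed (use C in \<open>simp add: in_closed_iff_infdist_zero\<close>)
    qed
    show "(\<lambda>\<omega>. max 0 (1 - real n * infdist (X \<omega>) C)) \<in> borel_measurable M" for n
      by (intro borel_measurable_max borel_measurable_diff borel_measurable_times
          measurable_compose[OF assms(1) borel_measurable_continuous_onI]) (auto intro!: continuous_intros)
  qed (auto simp: infdist_nonneg)
  also have "expectation (\<lambda>\<omega>. indicator C (X \<omega>) :: real) = measure (distr M borel X) C"
    by (subst measure_distr) (auto simp: indicator_vimage[symmetric] simp flip: Bochner_Integration.integral_indicator intro!: Bochner_Integration.integral_cong split: split_indicator)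
  finally show ?thesis .
qed

text \<open>Uniqueness of characteristic functions: the laws agree on closed sets, an
  intersection-stable generator of the Borel sets.\<close>

theorem (in prob_space) distr_eqI_char:
  fixes X :: "'a \<Rightarrow> 'b::euclidean_space" and Y :: "'c \<Rightarrow> 'b"
  assumes X [measurable]: "random_variable borel X"
    and N: "prob_space N" and Y [measurable]: "Y \<in> borel_measurable N"
    and eq: "\<And>u. (CLINT \<omega>|M. iexp (u \<bullet> X \<omega>)) = (CLINT \<omega>|N. iexp (u \<bullet> Y \<omega>))"
  shows "distr M borel X = distr N borel Y"
proof -
  interpret N: prob_space N by fact
  interpret DX: prob_space "distr M borel X" by (rule prob_space_distr) fact
  interpret DY: prob_space "distr N borel Y" by (rule N.prob_space_distr) fact
  have closed: "measure (distr M borel X) C = measure (distr N borel Y) C" if C: "closed C" for C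
  proof (cases "C = {}")
    case False
    have "expectation (\<lambda>\<omega>. max 0 (1 - real n * infdist (X \<omega>) C)) =
        (LINT \<omega>|N. max 0 (1 - real n * infdist (Y \<omega>) C))" for n
      by (rule expectation_eq_if_char_eq[OF X N Y eq, where B=1 and g="\<lambda>x. max 0 (1 - real n * infdist x C)"])
        (auto intro!: continuous_intros simp: infdist_nonneg)
    with measure_closed_tendsto[OF X C False] N.measure_closed_tendsto[OF Y C False]
    show ?thesis by (simp add: LIMSEQ_unique)
  qed simp
  show ?thesis
  proof (rule measure_eqI_generator_eq[where E="Collect closed" and \<Omega>=UNIV and A="\<lambda>_. UNIV"])
    show "sets (distr M borel X) = sigma_sets UNIV (Collect closed)"
      "sets (distr N borel Y) = sigma_sets UNIV (Collect closed)"
      by (simp_all add: borel_eq_closed)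
  qed (use closed in \<open>auto simp: Int_stable_def DX.emeasure_eq_measure DY.emeasure_eq_measure\<close>)
qed

section \<open>Densities bounded through the characteristic function\<close>

text \<open>The classical value is 2 Gamma(1 + 1/\<beta>); only finiteness and the sign are
  used.\<close>

definition stretched_exp_int :: "real \<Rightarrow> real" where
  "stretched_exp_int \<beta> = enn2real (\<integral>\<^sup>+x. ennreal (exp (- (\<bar>x\<bar> powr \<beta>))) \<partial>lborel)"

lemma stretched_exp_int_nonneg: "0 \<le> stretched_exp_int \<beta>"
  by (simp add: stretched_exp_int_def)

lemma exp_minus_powr_le:
  fixes x \<beta> :: real
  assumes "0 < \<beta>"
  shows "\<exists>C. \<forall>x. exp (- (\<bar>x\<bar> powr \<beta>)) \<le> C * inverse (1 + x\<^sup>2)"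
proof -
  \<comment> \<open>Chosen so that |x|^(\<beta> m) dominates x^2 for |x| > 1; then e^y >= (y/m)^m
    yields decay at least as fast as the integrable 1/(1 + x^2).\<close>
  define m where "m = nat \<lceil>2 / \<beta>\<rceil>"
  have m: "2 \<le> \<beta> * real m" "0 < m"
  proof -
    have "2 / \<beta> \<le> real m" unfolding m_def by (rule real_nat_ceiling_ge)
    then show "2 \<le> \<beta> * real m" using assms by (simp add: divide_le_eq mult.commute)
    have "0 < 2 / \<beta>" using assms by simp
    then show "0 < m" unfolding m_def by simp
  qed
  have m1: "1 \<le> real m ^ m" using m(2) by (intro one_le_power) simp
  have "exp (- (\<bar>x\<bar> powr \<beta>)) \<le> 2 * real m ^ m * inverse (1 + x\<^sup>2)" for x
  proof (cases "\<bar>x\<bar> \<le> 1")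
    case True
    have "x\<^sup>2 \<le> 1" using True by (simp add: abs_square_le_1)
    then have "1 + x\<^sup>2 \<le> 2 * real m ^ m" using m1 by linarith
    then have "1 \<le> 2 * real m ^ m * inverse (1 + x\<^sup>2)"
      by (simp add: field_simps add_pos_nonneg)
    moreover have "exp (- (\<bar>x\<bar> powr \<beta>)) \<le> 1" by simp
    ultimately show ?thesis by linarith
  next
    case False
    let ?y = "\<bar>x\<bar> powr \<beta>"
    have "?y / real m \<le> exp (?y / real m)"
      using exp_ge_add_one_self[of "?y / real m"] by linarith
    then have "(?y / real m) ^ m \<le> exp (?y / real m) ^ m"
      by (intro power_mono) auto
    also have "\<dots> = exp ?y"
      using m(2) by (simp flip: exp_of_nat_mult)
    finally have 1: "?y ^ m \<le> exp ?y * real m ^ m"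
      using m(2) by (simp add: power_divide field_simps)
    have "x\<^sup>2 = \<bar>x\<bar> powr 2" using False by (simp add: powr_numeral)
    also have "\<dots> \<le> \<bar>x\<bar> powr (\<beta> * real m)"
      using False m(1) by (intro powr_mono) auto
    also have "\<dots> = ?y ^ m"
      using False by (simp add: powr_powr[symmetric] powr_realpow)
    finally have "x\<^sup>2 \<le> ?y ^ m" .
    moreover have "1 \<le> x\<^sup>2" using False one_le_power[of "\<bar>x\<bar>" 2] by simp
    ultimately have "1 + x\<^sup>2 \<le> 2 * (exp ?y * real m ^ m)" using 1 by linarith
    then show ?thesis
      by (simp add: exp_minus field_simps add_pos_nonneg)
  qed
  then show ?thesis by blast
qed

lemma nn_integral_stretched_exp:
  assumes "0 < \<beta>"
  shows "(\<integral>\<^sup>+x. ennreal (exp (- (\<bar>x\<bar> powr \<beta>))) \<partial>lborel) = ennreal (stretched_exp_int \<beta>)"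
proof -
  obtain C where C: "\<And>x. exp (- (\<bar>x\<bar> powr \<beta>)) \<le> C * inverse (1 + x\<^sup>2)"
    using exp_minus_powr_le[OF assms] by blast
  have "integrable lborel (\<lambda>x::real. inverse (1 + x\<^sup>2))"
    using integrable_inverse_1_plus_square by (simp add: set_integrable_def einterval_def)
  then have "integrable lborel (\<lambda>x::real. C * inverse (1 + x\<^sup>2))"
    by (rule integrable_mult_right)
  then have "integrable lborel (\<lambda>x. exp (- (\<bar>x\<bar> powr \<beta>)))"
    by (rule Bochner_Integration.integrable_bound) (auto intro!: AE_I2 order_trans[OF C])
  then show ?thesis
    by (simp add: stretched_exp_int_def integrable_iff_bounded ennreal_enn2real_if)
qed

lemma nn_integral_stretched_exp_scaled:
  assumes "0 < \<beta>" "0 < k"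
  shows "(\<integral>\<^sup>+x. ennreal (exp (- (k * \<bar>x\<bar> powr \<beta>))) \<partial>lborel) =
    ennreal (k powr (- 1 / \<beta>) * stretched_exp_int \<beta>)"
proof -
  let ?c = "k powr (- 1 / \<beta>)"
  have c: "k * \<bar>?c * x\<bar> powr \<beta> = \<bar>x\<bar> powr \<beta>" for x
    using assms by (simp add: abs_mult powr_mult powr_powr powr_minus powr_divide field_simps)
  have "(\<integral>\<^sup>+x. ennreal (exp (- (k * \<bar>x\<bar> powr \<beta>))) \<partial>lborel) =
     ennreal \<bar>?c\<bar> * (\<integral>\<^sup>+x. ennreal (exp (- (k * \<bar>0 + ?c * x\<bar> powr \<beta>))) \<partial>lborel)"
    using assms by (intro nn_integral_real_affine) auto
  then show ?thesis
    using assms c nn_integral_stretched_exp[of \<beta>] by (simp add: ennreal_mult stretched_exp_int_nonneg)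
qed

text \<open>Three losses reduce the integral to a product over coordinates: the norm power is at
  least the average of the coordinate powers (whence \<open>k / DIM('a)\<close>), the integral
  factors, and each normal density is bounded by 1. What matters is the resulting decay
  k^(-d/\<beta>).\<close>

lemma gauss_coords_stretched_exp_le:
  fixes k \<beta> :: real
  assumes "0 < \<beta>" "0 < k"
  shows "(\<integral>\<^sup>+z. ennreal (exp (- (k * norm (of_coords z :: 'a::euclidean_space) powr \<beta>))) \<partial>gauss_coords) \<le>
    ennreal (((k / DIM('a)) powr (- 1 / \<beta>) * stretched_exp_int \<beta>) ^ DIM('a))"
proof -
  interpret N: prob_space std_normal_distribution by (rule prob_space_normal_density) simp
  interpret product_sigma_finite "\<lambda>_::'a. std_normal_distribution" ..
  let ?k = "k / DIM('a)"
  have k: "0 < ?k" using assms by simp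
  have pw: "exp (- (k * norm (of_coords z :: 'a) powr \<beta>)) \<le> (\<Prod>b\<in>(Basis::'a set). exp (- (?k * \<bar>z b\<bar> powr \<beta>)))" for z
  proof -
    have "(\<Sum>b\<in>(Basis::'a set). \<bar>z b\<bar> powr \<beta>) \<le> (\<Sum>b\<in>(Basis::'a set). norm (of_coords z :: 'a) powr \<beta>)"
      using assms Basis_le_norm[of _ "of_coords z :: 'a"]
      by (intro sum_mono powr_mono2) (auto simp: of_coords_inner_Basis)
    then have "?k * (\<Sum>b\<in>(Basis::'a set). \<bar>z b\<bar> powr \<beta>) \<le> k * norm (of_coords z :: 'a) powr \<beta>"
      using assms by (simp add: field_simps)
    then show ?thesis
      by (simp add: exp_sum[symmetric] sum_negf sum_distrib_left)
  qed
  have dens: "(\<integral>\<^sup>+t. ennreal (exp (- (?k * \<bar>t\<bar> powr \<beta>))) \<partial>std_normal_distribution) \<le>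
      ennreal (?k powr (- 1 / \<beta>) * stretched_exp_int \<beta>)"
  proof -
    have "std_normal_density t \<le> 1" for t
    proof -
      have "1 \<le> sqrt (2 * pi)" using pi_gt3 by simp
      then have "1 / sqrt (2 * pi) * exp (- t\<^sup>2 / 2) \<le> 1 * 1"
        by (intro mult_mono) auto
      then show ?thesis by (simp add: std_normal_density_def)
    qed
    then have "(\<integral>\<^sup>+t. ennreal (exp (- (?k * \<bar>t\<bar> powr \<beta>))) \<partial>std_normal_distribution) \<le>
      (\<integral>\<^sup>+t. ennreal (exp (- (?k * \<bar>t\<bar> powr \<beta>))) \<partial>lborel)"
      by (subst nn_integral_density)
        (auto intro!: nn_integral_mono mult_left_le_one_le simp: ennreal_mult[symmetric] simp del: normal_density_def)
    with nn_integral_stretched_exp_scaled[OF assms(1) k] show ?thesis by simp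
  qed
  have "(\<integral>\<^sup>+z. ennreal (exp (- (k * norm (of_coords z :: 'a) powr \<beta>))) \<partial>gauss_coords) \<le>
     (\<integral>\<^sup>+z. (\<Prod>b\<in>(Basis::'a set). ennreal (exp (- (?k * \<bar>z b\<bar> powr \<beta>)))) \<partial>gauss_coords)"
    using pw by (intro nn_integral_mono) (simp add: prod_ennreal ennreal_leI)
  also have "\<dots> = (\<Prod>b\<in>(Basis::'a set). (\<integral>\<^sup>+t. ennreal (exp (- (?k * \<bar>t\<bar> powr \<beta>))) \<partial>std_normal_distribution))"
    by (rule product_nn_integral_prod) auto
  also have "\<dots> \<le> (\<Prod>b\<in>(Basis::'a set). ennreal (?k powr (- 1 / \<beta>) * stretched_exp_int \<beta>))"
    by (intro prod_mono_ennreal dens)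
  also have "\<dots> = ennreal ((?k powr (- 1 / \<beta>) * stretched_exp_int \<beta>) ^ DIM('a))"
    by (simp add: ennreal_power stretched_exp_int_nonneg)
  finally show ?thesis .
qed

text \<open>The part of the preceding bound that does not depend on \<open>k\<close>.\<close>

definition gauss_decay :: "real \<Rightarrow> nat \<Rightarrow> real" where
  "gauss_decay \<beta> d = (real d powr (1 / \<beta>) * stretched_exp_int \<beta>) ^ d"

lemma gauss_decay_nonneg: "0 \<le> gauss_decay \<beta> d"
  by (simp add: gauss_decay_def stretched_exp_int_nonneg)

text \<open>Multiplied by \<open>r ^ DIM('b)\<close>, the left side is, up to a constant, the
  density of \<open>X\<close> at 0 smoothed at scale \<open>1 / r\<close>; the bound k^(-d/\<beta>)
  on it is uniform in that scale. Rescaling the Gaussian by \<open>r\<close> turns \<open>k\<close>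
  into \<open>k * r powr \<beta>\<close>.\<close>

lemma (in prob_space) expectation_gauss_kernel_le:
  fixes X :: "'a \<Rightarrow> 'b::euclidean_space"
  assumes [measurable]: "random_variable borel X" and "0 < \<beta>" "0 < k" "0 < r"
    and char: "\<And>u. cmod (CLINT \<omega>|M. iexp (u \<bullet> X \<omega>)) \<le> exp (- (k * norm u powr \<beta>))"
  shows "expectation (\<lambda>\<omega>. gauss_kernel (r *\<^sub>R X \<omega>)) \<le>
    gauss_decay \<beta> DIM('b) * k powr (- (DIM('b) / \<beta>)) / r ^ DIM('b)"
proof -
  interpret G: prob_space "gauss_coords :: ('b \<Rightarrow> real) measure" by (rule prob_space_gauss_coords)
  let ?E = "expectation (\<lambda>\<omega>. gauss_kernel (r *\<^sub>R X \<omega>))"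
  let ?k = "k * r powr \<beta>"
  have int: "integrable gauss_coords (\<lambda>z. exp (- (?k * norm (of_coords z :: 'b) powr \<beta>)))"
    using assms by (intro G.integrable_const_bound[where B=1]) auto
  have "complex_of_real ?E = (CLINT z|gauss_coords. (CLINT \<omega>|M. iexp ((r *\<^sub>R of_coords z) \<bullet> X \<omega>)))"
    using expectation_gauss_kernel[OF assms(1), of r 0] by simp
  then have "?E \<le> cmod (CLINT z|gauss_coords. (CLINT \<omega>|M. iexp ((r *\<^sub>R of_coords z) \<bullet> X \<omega>)))"
    by (metis Re_complex_of_real complex_Re_le_cmod)
  also have "\<dots> \<le> (LINT z|gauss_coords. exp (- (?k * norm (of_coords z :: 'b) powr \<beta>)))"
  proof -
    have le: "cmod (CLINT \<omega>|M. iexp ((r *\<^sub>R of_coords z) \<bullet> X \<omega>)) \<le> exp (- (?k * norm (of_coords z :: 'b) powr \<beta>))" for z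
      using char[of "r *\<^sub>R of_coords z"] assms by (simp add: powr_mult mult.assoc)
    moreover have "exp (- (?k * norm (of_coords z :: 'b) powr \<beta>)) \<le> 1" for z
      using assms by simp
    ultimately have "cmod (CLINT \<omega>|M. iexp ((r *\<^sub>R of_coords z) \<bullet> X \<omega>)) \<le> 1" for z
      by (rule order_trans)
    then have "integrable gauss_coords (\<lambda>z. CLINT \<omega>|M. iexp ((r *\<^sub>R of_coords z) \<bullet> X \<omega>))"
      by (intro G.integrable_const_bound[where B=1]) auto
    then show ?thesis
      by (intro order_trans[OF integral_norm_bound] integral_mono int le integrable_norm)
  qed
  also have "\<dots> \<le> ((?k / DIM('b)) powr (- 1 / \<beta>) * stretched_exp_int \<beta>) ^ DIM('b)"
  proof -
    have "ennreal (LINT z|gauss_coords. exp (- (?k * norm (of_coords z :: 'b) powr \<beta>))) =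
       (\<integral>\<^sup>+z. ennreal (exp (- (?k * norm (of_coords z :: 'b) powr \<beta>))) \<partial>gauss_coords)"
      by (rule nn_integral_eq_integral[symmetric, OF int]) simp
    also have "\<dots> \<le> ennreal (((?k / DIM('b)) powr (- 1 / \<beta>) * stretched_exp_int \<beta>) ^ DIM('b))"
      using assms by (intro gauss_coords_stretched_exp_le) auto
    finally show ?thesis
      by (subst (asm) ennreal_le_iff) (auto simp: stretched_exp_int_nonneg)
  qed
  also have "(?k / DIM('b)) powr (- 1 / \<beta>) = real DIM('b) powr (1 / \<beta>) * k powr (- 1 / \<beta>) * (1 / r)"
    using assms by (simp add: powr_divide powr_mult powr_powr powr_minus field_simps)
  also have "(real DIM('b) powr (1 / \<beta>) * k powr (- 1 / \<beta>) * (1 / r) * stretched_exp_int \<beta>) ^ DIM('b) =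
     gauss_decay \<beta> DIM('b) * (k powr (- 1 / \<beta>)) ^ DIM('b) / r ^ DIM('b)"
    by (simp add: gauss_decay_def power_mult_distrib power_divide)
  also have "(k powr (- 1 / \<beta>)) ^ DIM('b) = k powr (- (DIM('b) / \<beta>))"
    using assms by (simp add: powr_realpow[symmetric] powr_powr)
  finally show ?thesis .
qed

section \<open>Schwartz kernels dominated by Gaussian mixtures\<close>

lemma schwartz_continuous_on: "schwartz f \<Longrightarrow> continuous_on UNIV f"
  unfolding schwartz_def
  by (metis differentiable_imp_continuous_on differentiable_on_def empty_set empty_subsetI
      iterated_partial.simps(1) differentiable_at_withinI)

lemma schwartz_decay: "schwartz f \<Longrightarrow> \<exists>B. \<forall>x. norm x ^ k * \<bar>f x\<bar> \<le> B"
proof -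
  assume "schwartz f"
  then have "bounded (range (\<lambda>x. norm x ^ k * iterated_partial [] f x))"
    unfolding schwartz_def by (metis empty_set empty_subsetI)
  then obtain B where "\<And>x. \<bar>norm x ^ k * f x\<bar> \<le> B"
    by (auto simp: bounded_iff)
  then show ?thesis by (auto simp: abs_mult)
qed

text \<open>On the dyadic shell at radius about 2^j the Gaussian of width 2^j is bounded below, so
  polynomial decay of \<open>f\<close> suffices. The power d + 1 is chosen because a Gaussian of
  width 2^j later costs a factor 2^(j d), which leaves the summable 2^(-j).\<close>

lemma schwartz_le_gauss_mixture:
  fixes f :: "'a::euclidean_space \<Rightarrow> real"
  assumes "schwartz f"
  shows "\<exists>C\<ge>0. \<forall>x. ennreal (f x) \<le>
    (\<Sum>j. ennreal (C * (1 / 2) ^ (j * Suc DIM('a)) * gauss_kernel ((1 / 2) ^ j *\<^sub>R x)))"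
proof -
  let ?n = "Suc DIM('a)"
  obtain B0 where B0: "\<And>x. norm x ^ 0 * \<bar>f x\<bar> \<le> B0" using schwartz_decay[OF assms] by blast
  obtain B1 where B1: "\<And>x. norm x ^ ?n * \<bar>f x\<bar> \<le> B1" using schwartz_decay[OF assms] by blast
  have "0 \<le> B0" using B0[of 0] by simp
  have "0 \<le> B1" using B1[of 0] by simp
  \<comment> \<open>\<open>B0\<close> serves the unit ball and \<open>B1\<close> the shells with
    \<open>2 ^ i < norm x\<close>, where passing from \<open>i\<close> to \<open>Suc i\<close> costs
    \<open>2 ^ ?n\<close>. The factor \<open>exp (1 / 2)\<close> offsets the least value of the
    Gaussian on the ball of radius \<open>2 ^ j\<close>.\<close>
  define C where "C = exp (1 / 2) * (B0 + 2 ^ ?n * B1)"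
  have C0: "0 \<le> C" using \<open>0 \<le> B0\<close> \<open>0 \<le> B1\<close> by (simp add: C_def)
  have "\<exists>j. f x \<le> C * (1 / 2) ^ (j * ?n) * gauss_kernel ((1 / 2) ^ j *\<^sub>R x)" for x
  proof -
    define j where "j = (LEAST j. norm x \<le> 2 ^ j)"
    have ex: "\<exists>j. norm x \<le> 2 ^ j"
      by (metis less_imp_le one_less_numeral_iff real_arch_pow semiring_norm(76))
    then have j: "norm x \<le> 2 ^ j" unfolding j_def by (rule LeastI_ex)
    have "(norm ((1 / 2) ^ j *\<^sub>R x))\<^sup>2 \<le> 1"
      using j by (simp add: abs_square_le_1 power_divide field_simps)
    then have "exp (- (1 / 2)) \<le> gauss_kernel ((1 / 2) ^ j *\<^sub>R x)" by simp
    moreover have "f x \<le> (B0 + 2 ^ ?n * B1) * (1 / 2) ^ (j * ?n)"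
    proof (cases j)
      case 0
      then show ?thesis using B0[of x] \<open>0 \<le> B1\<close> by (simp add: add_increasing2 abs_le_iff)
    next
      case (Suc i)
      have "\<not> norm x \<le> 2 ^ i" using Suc not_less_Least[of i "\<lambda>j. norm x \<le> 2 ^ j"] by (simp add: j_def)
      then have "(2 ^ i) ^ ?n * \<bar>f x\<bar> \<le> norm x ^ ?n * \<bar>f x\<bar>"
        by (intro mult_right_mono power_mono) auto
      also have "\<dots> \<le> B1" by (rule B1)
      finally have "\<bar>f x\<bar> \<le> B1 / (2 ^ i) ^ ?n" by (simp add: field_simps)
      then have "f x \<le> B1 / (2 ^ i) ^ ?n" by linarith
      also have "\<dots> = 2 ^ ?n * B1 * (1 / 2) ^ (j * ?n)"
        by (simp add: Suc power_mult[symmetric] power_divide power_add[symmetric] field_simps del: power_Suc)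
      also have "\<dots> \<le> (B0 + 2 ^ ?n * B1) * (1 / 2) ^ (j * ?n)"
        using \<open>0 \<le> B0\<close> by (intro mult_right_mono) auto
      finally show ?thesis .
    qed
    moreover have "(B0 + 2 ^ ?n * B1) * (1 / 2) ^ (j * ?n) = C * (1 / 2) ^ (j * ?n) * exp (- (1 / 2))"
      by (simp add: C_def exp_minus)
    ultimately show ?thesis
      using C0 by (intro exI[of _ j]) (smt (verit) mult_left_mono mult_nonneg_nonneg zero_le_power divide_nonneg_nonneg)
  qed
  then have "ennreal (f x) \<le> (\<Sum>j. ennreal (C * (1 / 2) ^ (j * ?n) * gauss_kernel ((1 / 2) ^ j *\<^sub>R x)))" for x
  proof -
    assume "\<And>x. \<exists>j. f x \<le> C * (1 / 2) ^ (j * ?n) * gauss_kernel ((1 / 2) ^ j *\<^sub>R x)"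
    then obtain j where "f x \<le> C * (1 / 2) ^ (j * ?n) * gauss_kernel ((1 / 2) ^ j *\<^sub>R x)" by blast
    then have "ennreal (f x) \<le> (\<Sum>j\<in>{j}. ennreal (C * (1 / 2) ^ (j * ?n) * gauss_kernel ((1 / 2) ^ j *\<^sub>R x)))"
      by (simp add: ennreal_leI)
    also have "\<dots> \<le> (\<Sum>j. ennreal (C * (1 / 2) ^ (j * ?n) * gauss_kernel ((1 / 2) ^ j *\<^sub>R x)))"
      by (intro sum_le_suminf) auto
    finally show ?thesis .
  qed
  with C0 show ?thesis by blast
qed

text \<open>Uniformity in \<epsilon> is the point: the Gaussian at level \<open>j\<close> has
  \<open>r = (1 / 2) ^ j / \<epsilon>\<close>, and its factor 1/r^d cancels the normalization of
  \<open>rescale\<close>.\<close>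

lemma schwartz_kernel_bound:
  fixes f :: "'b::euclidean_space \<Rightarrow> real"
  assumes "schwartz f" "0 < \<beta>"
  obtains D where "0 \<le> D"
    "\<And>(M::'a measure) X k \<epsilon>. prob_space M \<Longrightarrow> X \<in> borel_measurable M \<Longrightarrow> 0 < k \<Longrightarrow> 0 < \<epsilon> \<Longrightarrow>
       (\<And>u. cmod (CLINT \<omega>|M. iexp (u \<bullet> X \<omega>)) \<le> exp (- (k * norm u powr \<beta>))) \<Longrightarrow>
       (\<integral>\<^sup>+\<omega>. ennreal (rescale f \<epsilon> (X \<omega>)) \<partial>M) \<le> ennreal (D * k powr (- (DIM('b) / \<beta>)))"
proof -
  let ?d = "DIM('b)"
  obtain C where C: "0 \<le> C" "\<And>x. ennreal (f x) \<le>
    (\<Sum>j. ennreal (C * (1 / 2) ^ (j * Suc ?d) * gauss_kernel ((1 / 2) ^ j *\<^sub>R x)))"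
    using schwartz_le_gauss_mixture[OF assms(1)] by blast
  \<comment> \<open>The factor 2 is the sum of the geometric series left over from the levels
    \<open>j\<close>.\<close>
  define D where "D = 2 * C * gauss_decay \<beta> ?d"
  have "(\<integral>\<^sup>+\<omega>. ennreal (rescale f \<epsilon> (X \<omega>)) \<partial>M) \<le> ennreal (D * k powr (- (?d / \<beta>)))"
    if "prob_space M" and X [measurable]: "X \<in> borel_measurable M" and k: "0 < k" and \<epsilon>: "0 < \<epsilon>"
      and char: "\<And>u. cmod (CLINT \<omega>|M. iexp (u \<bullet> X \<omega>)) \<le> exp (- (k * norm u powr \<beta>))"
    for M :: "'a measure" and X k \<epsilon>
  proof -
    interpret prob_space M by fact
    let ?K = "\<lambda>j \<omega>. gauss_kernel (((1 / 2) ^ j / \<epsilon>) *\<^sub>R X \<omega>)"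
    let ?c = "\<lambda>j. C * (1 / 2) ^ (j * Suc ?d) / \<epsilon> ^ ?d"
    have pw: "ennreal (rescale f \<epsilon> (X \<omega>)) \<le> (\<Sum>j. ennreal (?c j) * ennreal (?K j \<omega>))" for \<omega>
    proof -
      have "ennreal (rescale f \<epsilon> (X \<omega>)) = ennreal (1 / \<epsilon> ^ ?d) * ennreal (f (X \<omega> /\<^sub>R \<epsilon>))"
        using \<epsilon> by (simp add: rescale_def ennreal_mult'[symmetric])
      also have "\<dots> \<le> ennreal (1 / \<epsilon> ^ ?d) *
          (\<Sum>j. ennreal (C * (1 / 2) ^ (j * Suc ?d) * gauss_kernel ((1 / 2) ^ j *\<^sub>R (X \<omega> /\<^sub>R \<epsilon>))))"
        by (intro mult_left_mono C) simp
      also have "\<dots> = (\<Sum>j. ennreal (?c j) * ennreal (?K j \<omega>))"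
      proof (subst ennreal_suminf_cmult[symmetric], intro suminf_cong)
        fix j
        have eq: "(1 / 2) ^ j *\<^sub>R (X \<omega> /\<^sub>R \<epsilon>) = ((1 / 2) ^ j / \<epsilon>) *\<^sub>R X \<omega>"
          by (simp only: scaleR_scaleR divide_inverse)
        have "0 \<le> ?c j" using C(1) \<epsilon> by simp
        then show "ennreal (1 / \<epsilon> ^ ?d) * ennreal (C * (1 / 2) ^ (j * Suc ?d) *
             gauss_kernel ((1 / 2) ^ j *\<^sub>R (X \<omega> /\<^sub>R \<epsilon>))) = ennreal (?c j) * ennreal (?K j \<omega>)"
          unfolding eq using \<epsilon> C(1) by (simp add: ennreal_mult'[symmetric] del: norm_scaleR mult_Suc_right)
      qed
      finally show ?thesis .
    qed
    have K: "(\<integral>\<^sup>+\<omega>. ennreal (?K j \<omega>) \<partial>M) \<le> ennreal (gauss_decay \<beta> ?d * k powr (- (?d / \<beta>)) / ((1 / 2) ^ j / \<epsilon>) ^ ?d)" for j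
    proof -
      have "(\<integral>\<^sup>+\<omega>. ennreal (?K j \<omega>) \<partial>M) = ennreal (expectation (?K j))"
        by (intro nn_integral_eq_integral integrable_const_bound[where B=1]) auto
      also have "\<dots> \<le> ennreal (gauss_decay \<beta> ?d * k powr (- (?d / \<beta>)) / ((1 / 2) ^ j / \<epsilon>) ^ ?d)"
        using k \<epsilon> assms(2) by (intro ennreal_leI expectation_gauss_kernel_le char) auto
      finally show ?thesis .
    qed
    have "(\<integral>\<^sup>+\<omega>. ennreal (rescale f \<epsilon> (X \<omega>)) \<partial>M) \<le> (\<integral>\<^sup>+\<omega>. (\<Sum>j. ennreal (?c j) * ennreal (?K j \<omega>)) \<partial>M)"
      by (intro nn_integral_mono pw)
    also have "\<dots> = (\<Sum>j. ennreal (?c j) * (\<integral>\<^sup>+\<omega>. ennreal (?K j \<omega>) \<partial>M))"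
      by (subst nn_integral_suminf) (auto intro!: suminf_cong nn_integral_cmult)
    also have "\<dots> \<le> (\<Sum>j. ennreal (?c j) * ennreal (gauss_decay \<beta> ?d * k powr (- (?d / \<beta>)) / ((1 / 2) ^ j / \<epsilon>) ^ ?d))"
      by (intro suminf_le mult_left_mono K) auto
    also have "\<dots> = (\<Sum>j. ennreal (C * gauss_decay \<beta> ?d * k powr (- (?d / \<beta>)) * (1 / 2) ^ j))"
    proof (intro suminf_cong)
      fix j
      have "?c j * (gauss_decay \<beta> ?d * k powr (- (?d / \<beta>)) / ((1 / 2) ^ j / \<epsilon>) ^ ?d) =
          C * gauss_decay \<beta> ?d * k powr (- (?d / \<beta>)) * (1 / 2) ^ j"
        using \<epsilon> by (simp add: power_mult power_divide power_mult_distrib power_add field_simps)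
      moreover have nn: "0 \<le> gauss_decay \<beta> ?d * k powr (- (?d / \<beta>)) / ((1 / 2) ^ j / \<epsilon>) ^ ?d"
        using \<epsilon> by (simp add: gauss_decay_nonneg)
      ultimately show "ennreal (?c j) * ennreal (gauss_decay \<beta> ?d * k powr (- (?d / \<beta>)) / ((1 / 2) ^ j / \<epsilon>) ^ ?d) =
          ennreal (C * gauss_decay \<beta> ?d * k powr (- (?d / \<beta>)) * (1 / 2) ^ j)"
        by (simp only: ennreal_mult''[OF nn, symmetric])
    qed
    also have "\<dots> = ennreal (C * gauss_decay \<beta> ?d * k powr (- (?d / \<beta>)) * 2)"
      using C(1) by (intro suminf_ennreal_eq sums_mult) (auto simp: gauss_decay_nonneg power_divide intro!: geometric_sums[of "1/2::real", simplified])
    finally show ?thesis by (simp add: D_def mult_ac)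
  qed
  moreover have "0 \<le> D" using C(1) by (simp add: D_def gauss_decay_nonneg)
  ultimately show ?thesis using that by blast
qed

section \<open>Path law and independence of increments\<close>

lemma finite_set_enumeration:
  fixes S :: "real set"
  assumes "finite S" "S \<noteq> {}"
  shows "\<exists>(n::nat) u. (\<forall>i j. i < j \<longrightarrow> j \<le> n \<longrightarrow> u i < u j) \<and> u ` {..n} = S"
proof -
  let ?xs = "sorted_list_of_set S"
  have card: "0 < card S" using assms by (simp add: card_gt_0_iff)
  have "?xs ! i < ?xs ! j" if "i < j" "j \<le> card S - 1" for i j
    using that assms card by (intro sorted_wrt_nth_less[of "(<)"]) auto
  moreover have "(!) ?xs ` {..card S - 1} = S"
  proof -
    have "{..card S - 1} = {..<length ?xs}"
      using card by auto
    then show ?thesis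
      using set_conv_nth[of ?xs] assms by auto
  qed
  ultimately show ?thesis by blast
qed

text \<open>
  Freezing the path at its initial value for negative times makes it right continuous on the whole
  line and lets the path space be indexed by all reals.
\<close>

definition traj :: "(real \<Rightarrow> 'w \<Rightarrow> 'a) \<Rightarrow> 'w \<Rightarrow> real \<Rightarrow> 'a" where
  "traj X \<omega> = (\<lambda>s. X (max 0 s) \<omega>)"

abbreviation paths :: "(real \<Rightarrow> 'a::euclidean_space) measure" where
  "paths \<equiv> PiM UNIV (\<lambda>_. borel)"

context levy_process
begin

lemma measurable_path [measurable]: "traj X \<in> M \<rightarrow>\<^sub>M paths"
  unfolding traj_def by (intro measurable_PiM_single') (auto simp: random_variable_X)

lemma measurable_increment [measurable]:
  "0 \<le> r \<Longrightarrow> 0 \<le> s \<Longrightarrow> (\<lambda>\<omega>. X s \<omega> - X r \<omega>) \<in> borel_measurable M"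
  by (intro borel_measurable_diff random_variable_X)

lemma distr_grid_increments:
  assumes "0 \<le> u 0" "0 < n" "\<And>i. i < n \<Longrightarrow> u i \<le> u (Suc i)"
  shows "distr M (PiM {..<n} (\<lambda>_. borel)) (\<lambda>\<omega>. \<lambda>i\<in>{..<n}. X (u (Suc i)) \<omega> - X (u i) \<omega>) =
    PiM {..<n} (\<lambda>i. distr M borel (X (u (Suc i) - u i)))"
proof -
  have u: "0 \<le> u i" if "i \<le> n" for i
    using that
  proof (induction i)
    case (Suc i)
    then show ?case using assms(3)[of i] by simp
  qed (simp add: assms)
  have "indep_vars (\<lambda>_. borel) (\<lambda>i \<omega>. X (u (Suc i)) \<omega> - X (u i) \<omega>) {..<n}"
    using assms by (intro independent_increments) auto
  then have "distr M (PiM {..<n} (\<lambda>_. borel)) (\<lambda>\<omega>. \<lambda>i\<in>{..<n}. X (u (Suc i)) \<omega> - X (u i) \<omega>) =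
      PiM {..<n} (\<lambda>i. distr M borel (\<lambda>\<omega>. X (u (Suc i)) \<omega> - X (u i) \<omega>))"
    using assms(2) u by (subst (asm) indep_vars_iff_distr_eq_PiM') auto
  also have "\<dots> = PiM {..<n} (\<lambda>i. distr M borel (X (u (Suc i) - u i)))"
    using stationary_increments[of "u i" "u (Suc i) - u i" for i] assms(3) u
    by (intro PiM_cong refl) auto
  finally show ?thesis .
qed

text \<open>Since the path starts at 0 almost surely, its values on a grid are partial sums of
  increments, whose joint law is a product of marginals. The right side therefore depends only on
  one-dimensional laws.\<close>

lemma emeasure_path_cylinder:
  assumes u: "u 0 = 0" "0 < n" "\<And>i. i < n \<Longrightarrow> u i \<le> u (Suc i)"
    and J: "finite J" "\<And>s. s \<in> J \<Longrightarrow> k s \<le> n" "\<And>s. s \<in> J \<Longrightarrow> u (k s) = max 0 s"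
    and A: "\<And>s. s \<in> J \<Longrightarrow> A s \<in> sets borel"
  shows "emeasure (distr M paths (traj X)) (prod_emb UNIV (\<lambda>_. borel) J (Pi\<^sub>E J A)) =
    emeasure (PiM {..<n} (\<lambda>i. distr M borel (X (u (Suc i) - u i))))
      {z \<in> space (PiM {..<n} (\<lambda>_. borel)). \<forall>s\<in>J. (\<Sum>j<k s. z j) \<in> A s}" (is "_ = emeasure _ ?Z")
proof -
  have pos: "0 \<le> u i" if "i \<le> n" for i
    using that
  proof (induction i)
    case (Suc i)
    then show ?case using u(3)[of i] by simp
  qed (simp add: u)
  let ?D = "\<lambda>\<omega>. \<lambda>i\<in>{..<n}. X (u (Suc i)) \<omega> - X (u i) \<omega>"
  have D [measurable]: "?D \<in> M \<rightarrow>\<^sub>M PiM {..<n} (\<lambda>_. borel)"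
    by (intro measurable_restrict measurable_increment pos) auto
  have comp: "(\<lambda>z. \<Sum>j<k s. z j) \<in> borel_measurable (PiM {..<n} (\<lambda>_. borel :: 'a measure))" if "s \<in> J" for s
    using J(2)[OF that] by (intro borel_measurable_sum measurable_component_singleton) auto
  have Z: "?Z \<in> sets (PiM {..<n} (\<lambda>_. borel))"
    using J(1) A comp by (intro sets.sets_Collect_finite_All) (auto intro: measurable_sets_Collect)
  have "emeasure (distr M paths (traj X)) (prod_emb UNIV (\<lambda>_. borel) J (Pi\<^sub>E J A)) =
     emeasure M {\<omega> \<in> space M. \<forall>s\<in>J. X (max 0 s) \<omega> \<in> A s}"
  proof (subst emeasure_distr)
    show "prod_emb UNIV (\<lambda>_. borel) J (Pi\<^sub>E J A) \<in> sets paths"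
      using J(1) A by (intro sets_PiM_I) auto
  qed (auto simp: prod_emb_def traj_def intro!: arg_cong[where f="emeasure M"])
  also have "\<dots> = emeasure M (?D -` ?Z \<inter> space M)"
  proof (rule emeasure_eq_AE)
    show "AE \<omega> in M. \<omega> \<in> {\<omega> \<in> space M. \<forall>s\<in>J. X (max 0 s) \<omega> \<in> A s} \<longleftrightarrow> \<omega> \<in> ?D -` ?Z \<inter> space M"
      using start_zero
    proof eventually_elim
      fix \<omega> assume 0: "X 0 \<omega> = 0"
      have "(\<Sum>j<k s. ?D \<omega> j) = X (max 0 s) \<omega>" if "s \<in> J" for s
      proof -
        have "(\<Sum>j<k s. ?D \<omega> j) = (\<Sum>j<k s. X (u (Suc j)) \<omega> - X (u j) \<omega>)"
          using J(2)[OF that] by (intro sum.cong) auto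
        also have "\<dots> = X (u (k s)) \<omega>"
          by (subst sum_lessThan_telescope) (simp add: u 0)
        finally show ?thesis using J(3)[OF that] by simp
      qed
      then show "\<omega> \<in> {\<omega> \<in> space M. \<forall>s\<in>J. X (max 0 s) \<omega> \<in> A s} \<longleftrightarrow> \<omega> \<in> ?D -` ?Z \<inter> space M"
        using measurable_space[OF D, of \<omega>] by auto
    qed
    show "{\<omega> \<in> space M. \<forall>s\<in>J. X (max 0 s) \<omega> \<in> A s} \<in> sets M"
    proof (rule sets.sets_Collect_finite_All[OF _ J(1)])
      fix s assume "s \<in> J"
      then show "{\<omega> \<in> space M. X (max 0 s) \<omega> \<in> A s} \<in> sets M"
        using measurable_sets[OF random_variable_X A, of "max 0 s" s] by (simp add: vimage_def Int_def conj_commute)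
    qed
    show "?D -` ?Z \<inter> space M \<in> sets M"
      using D Z by (rule measurable_sets)
  qed
  also have "\<dots> = emeasure (distr M (PiM {..<n} (\<lambda>_. borel)) ?D) ?Z"
    using D Z by (rule emeasure_distr[symmetric])
  also have "distr M (PiM {..<n} (\<lambda>_. borel)) ?D = PiM {..<n} (\<lambda>i. distr M borel (X (u (Suc i) - u i)))"
    using u by (intro distr_grid_increments) auto
  finally show ?thesis .
qed

end

theorem levy_path_distr_eq:
  fixes X :: "real \<Rightarrow> 'w \<Rightarrow> 'a::euclidean_space" and Y :: "real \<Rightarrow> 'v \<Rightarrow> 'a"
  assumes "levy_process M X" "levy_process N Y"
    and marg: "\<And>h. 0 \<le> h \<Longrightarrow> distr M borel (X h) = distr N borel (Y h)"
  shows "distr M paths (traj X) = distr N paths (traj Y)"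
proof (rule measure_eqI_PiM_infinite)
  interpret X: levy_process M X by fact
  interpret Y: levy_process N Y by fact
  show "finite_measure (distr M paths (traj X))"
    by (intro X.finite_measure_distr) simp
  fix A and J :: "real set" assume J: "finite J" and A: "\<And>i. i \<in> J \<Longrightarrow> A i \<in> sets (borel :: 'a measure)"
  \<comment> \<open>Besides the required times the grid contains 0, the starting point, and 1, which
    guarantees at least one increment even if all required times are nonpositive.\<close>
  obtain n :: nat and u where nu': "\<forall>i j. i < j \<longrightarrow> j \<le> n \<longrightarrow> u i < u j" "u ` {..n} = insert 0 (insert 1 (max 0 ` J))"
    using finite_set_enumeration[of "insert 0 (insert 1 (max 0 ` J))"] J by auto
  note nu = nu'(1)[rule_format] nu'(2)
  have "\<forall>s\<in>J. \<exists>i\<le>n. u i = max 0 s"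
    using nu(2) by (metis (no_types, opaque_lifting) atMost_iff image_eqI image_iff insertCI)
  then obtain k where k: "\<And>s. s \<in> J \<Longrightarrow> k s \<le> n" "\<And>s. s \<in> J \<Longrightarrow> u (k s) = max 0 s"
    by metis
  have nonneg: "0 \<le> u i" if "i \<le> n" for i
  proof -
    have "u i \<in> u ` {..n}" using that by auto
    then show ?thesis unfolding nu(2) by auto
  qed
  have "0 \<in> u ` {..n}" unfolding nu(2) by simp
  then obtain i where i: "i \<le> n" "u i = 0" by auto
  have u0: "u 0 = 0"
    using nu(1)[of 0 i] i nonneg[of 0] by (cases "i = 0") auto
  have n: "0 < n"
  proof (rule ccontr)
    assume "\<not> 0 < n"
    then have "u ` {..n} = {u 0}" by auto
    then have "1 \<in> {u 0}" using nu(2) by blast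
    then show False using u0 by simp
  qed
  have le: "u i \<le> u (Suc i)" if "i < n" for i
    using nu(1)[of i "Suc i"] that by auto
  have "PiM {..<n} (\<lambda>i. distr M borel (X (u (Suc i) - u i))) = PiM {..<n} (\<lambda>i. distr N borel (Y (u (Suc i) - u i)))"
    using le by (intro PiM_cong refl marg) auto
  then show "emeasure (distr M paths (traj X)) (prod_emb UNIV (\<lambda>_. borel) J (Pi\<^sub>E J A)) =
     emeasure (distr N paths (traj Y)) (prod_emb UNIV (\<lambda>_. borel) J (Pi\<^sub>E J A))"
    using X.emeasure_path_cylinder[of u n J k A] Y.emeasure_path_cylinder[of u n J k A]
      u0 n le J k A by simp
qed simp_all

section \<open>Independence of past and future increments\<close>

definition incr_algebra :: "'w measure \<Rightarrow> (real \<Rightarrow> 'w \<Rightarrow> 'a::euclidean_space) \<Rightarrow> real set \<Rightarrow> 'w measure" where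
  "incr_algebra M X I = sigma (space M)
     {(\<lambda>\<omega>. X s \<omega> - X r \<omega>) -` A \<inter> space M | r s A. r \<in> I \<and> s \<in> I \<and> A \<in> sets borel}"

lemma space_incr_algebra [simp]: "space (incr_algebra M X I) = space M"
  unfolding incr_algebra_def by (rule space_measure_of) auto

lemma sets_incr_algebra:
  "sets (incr_algebra M X I) = sigma_sets (space M)
     {(\<lambda>\<omega>. X s \<omega> - X r \<omega>) -` A \<inter> space M | r s A. r \<in> I \<and> s \<in> I \<and> A \<in> sets borel}"
  unfolding incr_algebra_def by (rule sets_measure_of) auto

lemma measurable_incr_algebra:
  assumes "r \<in> I" "s \<in> I"
  shows "(\<lambda>\<omega>. X s \<omega> - X r \<omega>) \<in> borel_measurable (incr_algebra M X I)"
  using assms by (intro measurableI) (auto simp: sets_incr_algebra intro!: sigma_sets.Basic)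

lemma sets_incr_algebra_mono: "I \<subseteq> J \<Longrightarrow> sets (incr_algebra M X I) \<subseteq> sets (incr_algebra M X J)"
  unfolding sets_incr_algebra by (intro sigma_sets_mono') blast

lemma (in levy_process) sets_incr_algebra_subset:
  assumes "I \<subseteq> {0..}"
  shows "sets (incr_algebra M X I) \<subseteq> sets M"
  unfolding sets_incr_algebra
proof (rule sets.sigma_sets_subset, safe)
  fix r s and A :: "'a set" assume "r \<in> I" "s \<in> I" "A \<in> sets borel"
  with assms show "(\<lambda>\<omega>. X s \<omega> - X r \<omega>) -` A \<inter> space M \<in> sets M"
    by (intro measurable_sets[OF measurable_increment]) auto
qed

text \<open>Measuring all increments from one base time \<open>b\<close> makes these sets stable
  under intersection; they still generate, as X_s - X_r is a difference of two increments from
  \<open>b\<close>.\<close>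

definition incr_cylinders ::
  "'w measure \<Rightarrow> (real \<Rightarrow> 'w \<Rightarrow> 'a::euclidean_space) \<Rightarrow> real \<Rightarrow> real set \<Rightarrow> 'w set set" where
  "incr_cylinders M X b I =
     {{\<omega> \<in> space M. \<forall>s\<in>J. X s \<omega> - X b \<omega> \<in> A s} | J A.
        finite J \<and> J \<subseteq> I \<and> (\<forall>s\<in>J. A s \<in> sets borel)}"

lemma Int_stable_incr_cylinders: "Int_stable (incr_cylinders M X b I)"
proof (rule Int_stableI)
  fix E F assume "E \<in> incr_cylinders M X b I" "F \<in> incr_cylinders M X b I"
  then obtain J A K B where E: "E = {\<omega> \<in> space M. \<forall>s\<in>J. X s \<omega> - X b \<omega> \<in> A s}" "finite J" "J \<subseteq> I" "\<forall>s\<in>J. A s \<in> sets borel"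
    and F: "F = {\<omega> \<in> space M. \<forall>s\<in>K. X s \<omega> - X b \<omega> \<in> B s}" "finite K" "K \<subseteq> I" "\<forall>s\<in>K. B s \<in> sets borel"
    unfolding incr_cylinders_def by blast
  let ?C = "\<lambda>s. (if s \<in> J then A s else UNIV) \<inter> (if s \<in> K then B s else UNIV)"
  have "E \<inter> F = {\<omega> \<in> space M. \<forall>s\<in>J \<union> K. X s \<omega> - X b \<omega> \<in> ?C s}"
    unfolding E(1) F(1) by (auto split: if_splits)
  moreover have "finite (J \<union> K)" "J \<union> K \<subseteq> I" "\<forall>s\<in>J \<union> K. ?C s \<in> sets borel"
    using E F by auto
  ultimately show "E \<inter> F \<in> incr_cylinders M X b I"
    unfolding incr_cylinders_def mem_Collect_eq
    by (intro exI[of _ "J \<union> K"] exI[of _ ?C] conjI)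
qed

lemma sets_incr_algebra_subset_cylinders:
  assumes "b \<in> I"
  shows "sets (incr_algebra M X I) \<subseteq> sigma_sets (space M) (incr_cylinders M X b I)"
proof -
  let ?S = "sigma (space M) (incr_cylinders M X b I)"
  have sub: "incr_cylinders M X b I \<subseteq> Pow (space M)" by (auto simp: incr_cylinders_def)
  have inc: "(\<lambda>\<omega>. X s \<omega> - X b \<omega>) \<in> borel_measurable ?S" if "s \<in> I" for s
  proof (rule measurableI)
    fix A :: "'b set" assume "A \<in> sets borel"
    then have "(\<lambda>\<omega>. X s \<omega> - X b \<omega>) -` A \<inter> space M \<in> incr_cylinders M X b I"
      using that unfolding incr_cylinders_def
      by (intro CollectI exI[of _ "{s}"] exI[of _ "\<lambda>_. A"]) auto
    then show "(\<lambda>\<omega>. X s \<omega> - X b \<omega>) -` A \<inter> space ?S \<in> sets ?S"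
      using sub by (simp add: sets_measure_of)
  qed simp
  have "(\<lambda>\<omega>. X s \<omega> - X r \<omega>) -` A \<inter> space M \<in> sets ?S" if "r \<in> I" "s \<in> I" "A \<in> sets borel" for r s A
  proof -
    have "(\<lambda>\<omega>. (X s \<omega> - X b \<omega>) - (X r \<omega> - X b \<omega>)) \<in> borel_measurable ?S"
      by (intro borel_measurable_diff inc that)
    then have "(\<lambda>\<omega>. X s \<omega> - X r \<omega>) \<in> borel_measurable ?S" by simp
    from measurable_sets[OF this that(3)] show ?thesis using sub by simp
  qed
  then have "sets (incr_algebra M X I) \<subseteq> sets ?S"
    unfolding sets_incr_algebra
    by (intro sets.sigma_sets_subset'[of _ ?S, simplified]) (use sub in \<open>auto intro: sigma_sets_top\<close>)
  then show ?thesis using sub by simp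
qed

context levy_process
begin

abbreviation incr :: "real set \<Rightarrow> 'w measure" where "incr \<equiv> incr_algebra M X"

text \<open>All times of both events and \<open>t\<close> itself are placed on one grid. With
  \<open>m\<close> the index of \<open>t\<close>, the past event is a function of the grid
  increments below \<open>m\<close> and the future event of those from \<open>m\<close> on.\<close>

lemma indep_incr_cylinders:
  assumes t: "0 \<le> t"
  shows "indep_set (incr_cylinders M X t {0..t}) (incr_cylinders M X t {t..})"
  unfolding indep_sets2_eq
proof (intro conjI ballI)
  have "incr_cylinders M X t I \<subseteq> events" if I: "I \<subseteq> {0..}" for I
    unfolding incr_cylinders_def
  proof safe
    fix J and A :: "real \<Rightarrow> 'a set" assume J: "finite J" "J \<subseteq> I" "\<forall>s\<in>J. A s \<in> sets borel"
    show "{\<omega> \<in> space M. \<forall>s\<in>J. X s \<omega> - X t \<omega> \<in> A s} \<in> events"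
    proof (rule sets.sets_Collect_finite_All[OF _ J(1)])
      fix s assume "s \<in> J"
      then show "{\<omega> \<in> space M. X s \<omega> - X t \<omega> \<in> A s} \<in> events"
        using measurable_sets[OF measurable_increment, of t s "A s"] J I t
        by (force simp: vimage_def Int_def conj_commute)
    qed
  qed
  then show "incr_cylinders M X t {0..t} \<subseteq> events" "incr_cylinders M X t {t..} \<subseteq> events"
    using t by auto
  fix E F assume "E \<in> incr_cylinders M X t {0..t}" "F \<in> incr_cylinders M X t {t..}"
  then obtain J A K B where E: "E = {\<omega> \<in> space M. \<forall>s\<in>J. X s \<omega> - X t \<omega> \<in> A s}" "finite J" "J \<subseteq> {0..t}" "\<And>s. s\<in>J \<Longrightarrow> A s \<in> sets borel"
    and F: "F = {\<omega> \<in> space M. \<forall>s\<in>K. X s \<omega> - X t \<omega> \<in> B s}" "finite K" "K \<subseteq> {t..}" "\<And>s. s\<in>K \<Longrightarrow> B s \<in> sets borel"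
    unfolding incr_cylinders_def by blast
  obtain n :: nat and u where nu': "\<forall>i j. i < j \<longrightarrow> j \<le> n \<longrightarrow> u i < u j" "u ` {..n} = insert t (J \<union> K)"
    using finite_set_enumeration[of "insert t (J \<union> K)"] E(2) F(2) by auto
  note nu = nu'(1)[rule_format] nu'(2)
  have nonneg: "0 \<le> u i" if "i \<le> n" for i
  proof -
    have "u i \<in> u ` {..n}" using that by auto
    then show ?thesis unfolding nu(2) using t E(3) F(3) by auto
  qed
  have le: "u i \<le> u (Suc i)" if "i < n" for i
    using nu(1)[of i "Suc i"] that by auto
  have "t \<in> u ` {..n}" unfolding nu(2) by simp
  then obtain m where m: "m \<le> n" "u m = t" by auto
  have "\<forall>s\<in>J. \<exists>i\<le>n. u i = s" "\<forall>s\<in>K. \<exists>i\<le>n. u i = s"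
    using nu(2) by (metis UnI1 UnI2 atMost_iff image_iff insertCI)+
  then obtain k l where k: "\<And>s. s \<in> J \<Longrightarrow> k s \<le> n" "\<And>s. s \<in> J \<Longrightarrow> u (k s) = s"
    and l: "\<And>s. s \<in> K \<Longrightarrow> l s \<le> n" "\<And>s. s \<in> K \<Longrightarrow> u (l s) = s"
    by metis
  have km: "k s \<le> m" if "s \<in> J" for s
    using nu(1)[of m "k s"] k[OF that] m E(3) that by (force simp: not_le[symmetric])
  have lm: "m \<le> l s" if "s \<in> K" for s
    using nu(1)[of "l s" m] l[OF that] m F(3) that by (force simp: not_le[symmetric])
  let ?D = "\<lambda>i \<omega>. X (u (Suc i)) \<omega> - X (u i) \<omega>"
  define Q where "Q b = (if b then {m..<n} else {..<m})" for b
  let ?V = "\<lambda>b \<omega>. \<lambda>i\<in>Q b. ?D i \<omega>"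
  have "indep_vars (\<lambda>_. borel) ?D {..<n}"
    using nonneg le by (intro independent_increments) auto
  then have ind: "indep_vars (\<lambda>b. PiM (Q b) (\<lambda>_. borel)) ?V UNIV"
    by (rule indep_vars_restrict) (use m(1) in \<open>auto simp: Q_def disjoint_family_on_def\<close>)
  \<comment> \<open>The past is read backwards from \<open>t\<close>: for \<open>s \<le> t\<close>
    the difference X_s - X_t is minus the sum of the grid increments in between.\<close>
  define C where "C b = (if b then {z \<in> space (PiM {m..<n} (\<lambda>_. borel)). \<forall>s\<in>K. (\<Sum>j\<in>{m..<l s}. z j) \<in> B s}
     else {z \<in> space (PiM {..<m} (\<lambda>_. borel)). \<forall>s\<in>J. - (\<Sum>j\<in>{k s..<m}. z j) \<in> A s})" for b
  have C: "C b \<in> sets (PiM (Q b) (\<lambda>_. borel))" for b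
  proof -
    have "(\<lambda>z. \<Sum>j\<in>{m..<l s}. z j) \<in> borel_measurable (PiM {m..<n} (\<lambda>_. borel :: 'a measure))" if "s \<in> K" for s
      using l(1)[OF that] by (intro borel_measurable_sum measurable_component_singleton) auto
    moreover have "(\<lambda>z. - (\<Sum>j\<in>{k s..<m}. z j)) \<in> borel_measurable (PiM {..<m} (\<lambda>_. borel :: 'a measure))" if "s \<in> J" for s
      by (intro borel_measurable_uminus borel_measurable_sum measurable_component_singleton) auto
    ultimately show ?thesis
      using E(2,4) F(2,4) unfolding C_def Q_def
      by (auto intro!: sets.sets_Collect_finite_All intro: measurable_sets_Collect)
  qed
  have EC: "E = ?V False -` C False \<inter> space M"
  proof -
    have "- (\<Sum>j\<in>{k s..<m}. ?V False \<omega> j) = X s \<omega> - X t \<omega>" if "s \<in> J" for s \<omega>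
    proof -
      have "(\<Sum>j\<in>{k s..<m}. ?V False \<omega> j) = (\<Sum>j\<in>{k s..<m}. ?D j \<omega>)"
        by (intro sum.cong) (auto simp: Q_def)
      also have "\<dots> = X t \<omega> - X s \<omega>"
        using km[OF that] by (subst sum_Suc_diff') (simp_all add: k that m)
      finally show ?thesis by simp
    qed
    then show ?thesis
      unfolding E(1) C_def by (auto simp: space_PiM Q_def)
  qed
  have FC: "F = ?V True -` C True \<inter> space M"
  proof -
    have "(\<Sum>j\<in>{m..<l s}. ?V True \<omega> j) = X s \<omega> - X t \<omega>" if "s \<in> K" for s \<omega>
    proof -
      have "(\<Sum>j\<in>{m..<l s}. ?V True \<omega> j) = (\<Sum>j\<in>{m..<l s}. ?D j \<omega>)"
        using l(1)[OF that] by (intro sum.cong) (auto simp: Q_def)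
      also have "\<dots> = X s \<omega> - X t \<omega>"
        using lm[OF that] by (subst sum_Suc_diff') (simp_all add: l that m)
      finally show ?thesis .
    qed
    then show ?thesis
      unfolding F(1) C_def by (auto simp: space_PiM Q_def)
  qed
  have "prob (\<Inter>b\<in>UNIV. ?V b -` C b \<inter> space M) = (\<Prod>b\<in>UNIV. prob (?V b -` C b \<inter> space M))"
    by (rule indep_varsD[OF ind]) (use C in auto)
  then show "prob (E \<inter> F) = prob E * prob F"
    unfolding EC FC by (simp add: UNIV_bool Int_commute mult.commute)
qed

text \<open>Independence extends from the intersection-stable cylinders to the generated algebras.
  Algebras of increments are used because the positions after \<open>t\<close> would carry the value
  X_t and so depend on the past.\<close>

theorem prob_past_future:
  assumes t: "0 \<le> t" and E: "E \<in> sets (incr {0..t})" and F: "F \<in> sets (incr {t..})"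
  shows "prob (E \<inter> F) = prob E * prob F"
proof -
  have "indep_set (sigma_sets (space M) (incr_cylinders M X t {0..t}))
      (sigma_sets (space M) (incr_cylinders M X t {t..}))"
    by (intro indep_set_sigma_sets indep_incr_cylinders Int_stable_incr_cylinders t)
  then show ?thesis
    using E F sets_incr_algebra_subset_cylinders[of t "{0..t}" M X] sets_incr_algebra_subset_cylinders[of t "{t..}" M X] t
    by (auto elim!: indep_setD)
qed

text \<open>One statement for both later uses: \<open>c = k = 1\<close> restarts the process at time
  \<open>t\<close>, and \<open>t = 0\<close> with a suitable \<open>k\<close> rescales it.\<close>

lemma levy_process_affine:
  assumes t: "0 \<le> t" and c: "0 < c"
  shows "levy_process M (\<lambda>s \<omega>. k *\<^sub>R (X (t + c * s) \<omega> - X t \<omega>))"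
proof
  have diff: "k *\<^sub>R (x - z) - k *\<^sub>R (y - z) = k *\<^sub>R (x - y)" for x y z :: 'a
    by (simp add: algebra_simps)
  show "(\<lambda>\<omega>. k *\<^sub>R (X (t + c * s) \<omega> - X t \<omega>)) \<in> borel_measurable M" if "0 \<le> s" for s
    using that t c by (intro borel_measurable_scaleR borel_measurable_const measurable_increment) auto
  show "AE \<omega> in M. k *\<^sub>R (X (t + c * 0) \<omega> - X t \<omega>) = 0" by simp
  show "indep_vars (\<lambda>_. borel) (\<lambda>i \<omega>. k *\<^sub>R (X (t + c * u (Suc i)) \<omega> - X t \<omega>) - k *\<^sub>R (X (t + c * u i) \<omega> - X t \<omega>)) {..<n}"
    if "0 \<le> u 0" "\<And>i. i < n \<Longrightarrow> u i \<le> u (Suc i)" for n :: nat and u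
    unfolding diff
    using indep_vars_compose2[OF independent_increments[of "\<lambda>i. t + c * u i" n], of "\<lambda>_ x. k *\<^sub>R x" "\<lambda>_. borel"] that t c
    by simp
  show "distr M borel (\<lambda>\<omega>. k *\<^sub>R (X (t + c * (s + h)) \<omega> - X t \<omega>) - k *\<^sub>R (X (t + c * s) \<omega> - X t \<omega>)) =
      distr M borel (\<lambda>\<omega>. k *\<^sub>R (X (t + c * h) \<omega> - X t \<omega>))" if "0 \<le> s" "0 \<le> h" for s h
  proof -
    have "distr M borel (\<lambda>\<omega>. k *\<^sub>R (X (r + c * h) \<omega> - X r \<omega>)) = distr (distr M borel (X (c * h))) borel (\<lambda>x. k *\<^sub>R x)"
      if "0 \<le> r" for r
      using stationary_increments[of r "c * h", symmetric] that \<open>0 \<le> h\<close> c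
      by (simp add: distr_distr comp_def measurable_increment)
    from this[of "t + c * s"] this[of t] show ?thesis
      using that t c by (simp add: diff algebra_simps)
  qed
  have lim: "((\<lambda>s. k *\<^sub>R (X (t + c * s) \<omega> - X t \<omega>)) \<longlongrightarrow> k *\<^sub>R (l - X t \<omega>)) G"
    if "((\<lambda>s. X s \<omega>) \<longlongrightarrow> l) H" "filterlim (\<lambda>s. t + c * s) H G" for \<omega> l G H
    by (intro tendsto_scaleR tendsto_diff tendsto_const filterlim_compose[OF that])
  show "continuous (at_right s) (\<lambda>s. k *\<^sub>R (X (t + c * s) \<omega> - X t \<omega>))" if "\<omega> \<in> space M" "0 \<le> s" for \<omega> s
    unfolding continuous_within
  proof (rule lim)
    show "((\<lambda>s. X s \<omega>) \<longlongrightarrow> X (t + c * s) \<omega>) (at_right (t + c * s))"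
      using right_continuous[of \<omega> "t + c * s"] that t c by (simp add: continuous_within)
    show "filterlim (\<lambda>s. t + c * s) (at_right (t + c * s)) (at_right s)"
      using c by (auto simp: filterlim_at eventually_at_filter intro!: tendsto_intros)
  qed
  show "\<exists>l. ((\<lambda>s. k *\<^sub>R (X (t + c * s) \<omega> - X t \<omega>)) \<longlongrightarrow> l) (at_left s)" if w: "\<omega> \<in> space M" "0 < s" for \<omega> s
  proof -
    have "0 < t + c * s" using w t c by (simp add: add_nonneg_pos)
    then obtain l where l: "((\<lambda>s. X s \<omega>) \<longlongrightarrow> l) (at_left (t + c * s))"
      using left_limits[OF w(1)] by blast
    have "filterlim (\<lambda>s. t + c * s) (at_left (t + c * s)) (at_left s)"
      using c by (auto simp: filterlim_at eventually_at_filter intro!: tendsto_intros)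
    from lim[OF l this] show ?thesis by blast
  qed
qed

lemma levy_process_shift: "0 \<le> t \<Longrightarrow> levy_process M (\<lambda>s \<omega>. X (t + s) \<omega> - X t \<omega>)"
  using levy_process_affine[of t 1 1] by simp

lemma path_shift_distr:
  assumes "0 \<le> t"
  shows "distr M paths (traj (\<lambda>s \<omega>. X (t + s) \<omega> - X t \<omega>)) = distr M paths (traj X)"
  using assms stationary_increments[of t]
  by (intro levy_path_distr_eq levy_process_shift levy_process_axioms) auto

end

text \<open>Homogeneity gives \<open>\<psi> (k v) = \<psi> v / c\<close> for the space factor k =
  c^(-1/\<beta>), which cancels the time factor \<open>c\<close>. The marginals then agree, and
  these determine the law of the path.\<close>

lemma (in symmetric_stable_process) path_scale_distr:
  assumes c: "0 < c"
  shows "distr M paths (traj (\<lambda>s \<omega>. (c powr (- 1 / \<beta>)) *\<^sub>R (X (c * s) \<omega> - X 0 \<omega>))) = distr M paths (traj X)"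
proof (rule levy_path_distr_eq)
  show "levy_process M X" by (rule levy_process_axioms)
  show "levy_process M (\<lambda>s \<omega>. (c powr (- 1 / \<beta>)) *\<^sub>R (X (c * s) \<omega> - X 0 \<omega>))"
    using levy_process_affine[of 0 c "c powr (- 1 / \<beta>)"] c by simp
  fix h :: real assume h: "0 \<le> h"
  let ?k = "c powr (- 1 / \<beta>)"
  have "distr M borel (\<lambda>\<omega>. ?k *\<^sub>R (X (c * h) \<omega> - X 0 \<omega>)) = distr M borel (\<lambda>\<omega>. ?k *\<^sub>R X (c * h) \<omega>)"
  proof (rule distr_cong_AE)
    show "AE \<omega> in M. ?k *\<^sub>R (X (c * h) \<omega> - X 0 \<omega>) = ?k *\<^sub>R X (c * h) \<omega>"
      using start_zero by eventually_elim simp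
    have ch: "0 \<le> c * h" using h c by simp
    show "(\<lambda>\<omega>. ?k *\<^sub>R X (c * h) \<omega>) \<in> borel_measurable M"
      by (intro borel_measurable_scaleR borel_measurable_const random_variable_X ch)
    show "(\<lambda>\<omega>. ?k *\<^sub>R (X (c * h) \<omega> - X 0 \<omega>)) \<in> borel_measurable M"
      by (intro borel_measurable_scaleR borel_measurable_const measurable_increment ch order_refl)
  qed (rule refl)+
  also have "\<dots> = distr M borel (X h)"
  proof (rule distr_eqI_char)
    show "random_variable borel (X h)" using h by (rule random_variable_X)
    show "random_variable borel (\<lambda>\<omega>. ?k *\<^sub>R X (c * h) \<omega>)"
      using h c by (intro borel_measurable_scaleR borel_measurable_const random_variable_X) auto
    fix v
    have "(CLINT \<omega>|M. iexp (v \<bullet> (?k *\<^sub>R X (c * h) \<omega>))) = (CLINT \<omega>|M. iexp ((?k *\<^sub>R v) \<bullet> X (c * h) \<omega>))"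
      by simp
    also have "\<dots> = complex_of_real (exp (- (c * h) * \<psi> (?k *\<^sub>R v)))"
      using h c by (intro characteristic_exponent) auto
    also have "\<psi> (?k *\<^sub>R v) = ?k powr \<beta> * \<psi> v"
      by (rule exponent_homogeneous) simp
    also have "?k powr \<beta> = 1 / c"
      using c index_pos powr_powr[of c "- 1 / \<beta>" \<beta>] by (simp add: powr_minus_divide[of c 1])
    also have "- (c * h) * (1 / c * \<psi> v) = - h * \<psi> v" using c by simp
    also have "complex_of_real (exp (- h * \<psi> v)) = (CLINT \<omega>|M. iexp (v \<bullet> X h \<omega>))"
      by (rule characteristic_exponent[OF h, symmetric])
    finally show "(CLINT \<omega>|M. iexp (v \<bullet> (?k *\<^sub>R X (c * h) \<omega>))) = (CLINT \<omega>|M. iexp (v \<bullet> X h \<omega>))" .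
  qed (rule prob_space_axioms)
  finally show "distr M borel (\<lambda>\<omega>. ?k *\<^sub>R (X (c * h) \<omega> - X 0 \<omega>)) = distr M borel (X h)" .
qed

section \<open>The self-intersection functional\<close>

text \<open>
  The grid point strictly to the right of \<open>s\<close>, so that right continuity of the paths is enough for
  discretization.
\<close>

definition right_grid :: "nat \<Rightarrow> real \<Rightarrow> real" where
  "right_grid n s = (real_of_int \<lfloor>real (Suc n) * s\<rfloor> + 1) / real (Suc n)"

lemma step_gt: "s < right_grid n s"
proof -
  have "real (Suc n) * s < real_of_int \<lfloor>real (Suc n) * s\<rfloor> + 1" by (rule real_of_int_floor_add_one_gt)
  then show ?thesis by (simp add: right_grid_def field_simps)
qed

lemma step_le: "right_grid n s \<le> s + 1 / real (Suc n)"
proof -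
  have "real_of_int \<lfloor>real (Suc n) * s\<rfloor> \<le> real (Suc n) * s" by (rule of_int_floor_le)
  then have "right_grid n s \<le> (real (Suc n) * s + 1) / real (Suc n)"
    unfolding right_grid_def by (intro divide_right_mono) auto
  also have "\<dots> = s + 1 / real (Suc n)" by (simp add: add_divide_distrib)
  finally show ?thesis .
qed

lemma filterlim_step: "filterlim (\<lambda>n. right_grid n s) (at_right s) sequentially"
  unfolding filterlim_at
proof
  show "\<forall>\<^sub>F n in sequentially. right_grid n s \<in> {s<..} \<and> right_grid n s \<noteq> s"
    using step_gt[of s] by (simp add: less_imp_neq[symmetric])
  have "(\<lambda>n. s + 1 / real (Suc n)) \<longlonglongrightarrow> s + 0"
    by (intro tendsto_intros LIMSEQ_Suc[OF lim_1_over_n])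
  then show "(\<lambda>n. right_grid n s) \<longlonglongrightarrow> s"
    by (intro tendsto_sandwich[of "\<lambda>_. s" "\<lambda>n. right_grid n s" _ "\<lambda>n. s + 1 / real (Suc n)"])
      (use step_gt step_le in \<open>auto intro!: always_eventually less_imp_le\<close>)
qed

lemma right_continuous_step_tendsto:
  "continuous (at_right s) x \<Longrightarrow> (\<lambda>n. x (right_grid n s)) \<longlonglongrightarrow> x s"
  unfolding continuous_within by (rule filterlim_compose[OF _ filterlim_step])

text \<open>For fixed \<open>n\<close> the grid time takes countably many values, so joint
  measurability reduces to measurability at each fixed time.\<close>

lemma measurable_step:
  fixes Z :: "real \<Rightarrow> 'w \<Rightarrow> 'a::euclidean_space"
  assumes [measurable]: "\<And>s. Z s \<in> borel_measurable N"
  shows "(\<lambda>(\<omega>, s). Z (right_grid n s) \<omega>) \<in> borel_measurable (N \<Otimes>\<^sub>M borel)"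
proof -
  have "(\<lambda>p. (\<lambda>k p. Z ((real_of_int k + 1) / real (Suc n)) (fst p)) \<lfloor>real (Suc n) * snd p\<rfloor> p) \<in>
      borel_measurable (N \<Otimes>\<^sub>M borel)"
    by (rule measurable_compose_countable) measurable
  then show ?thesis by (simp add: right_grid_def split_beta')
qed

lemma measurable_right_continuous:
  fixes Z :: "real \<Rightarrow> 'w \<Rightarrow> 'a::euclidean_space"
  assumes "\<And>s. Z s \<in> borel_measurable N"
    and "\<And>\<omega> s. \<omega> \<in> space N \<Longrightarrow> continuous (at_right s) (\<lambda>s. Z s \<omega>)"
  shows "(\<lambda>(\<omega>, s). Z s \<omega>) \<in> borel_measurable (N \<Otimes>\<^sub>M borel)"
  by (rule borel_measurable_LIMSEQ_metric[OF measurable_step[OF assms(1)]])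
    (auto simp: space_pair_measure intro!: right_continuous_step_tendsto assms(2))

lemma right_continuous_borel_measurable:
  fixes x :: "real \<Rightarrow> 'a::euclidean_space"
  assumes "\<And>s. continuous (at_right s) x"
  shows "x \<in> borel_measurable borel"
proof -
  \<comment> \<open>A one-point sample space turns joint measurability into measurability in
    time.\<close>
  have "(\<lambda>(\<omega>, s). x s) \<in> borel_measurable (count_space (UNIV :: unit set) \<Otimes>\<^sub>M borel)"
    by (intro measurable_right_continuous assms) auto
  from measurable_compose[OF measurable_Pair1' this, of "()"] show ?thesis by simp
qed

text \<open>A function of a single deterministic path, so that it can be applied to shifted,
  rescaled, stopped and discretized paths alike.\<close>

definition self_occ :: "('a::euclidean_space \<Rightarrow> real) \<Rightarrow> (real \<Rightarrow> 'a) \<Rightarrow> real \<Rightarrow> real" where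
  "self_occ F x t = (LBINT s:{0..t}. (LBINT r:{0..s}. F (x s - x r)))"

definition cross_occ :: "('a::euclidean_space \<Rightarrow> real) \<Rightarrow> (real \<Rightarrow> 'a) \<Rightarrow> real \<Rightarrow> real \<Rightarrow> real" where
  "cross_occ F x t T = (LBINT s:{t..T}. (LBINT r:{0..t}. F (x s - x r)))"

text \<open>Continuity and boundedness serve dominated convergence along the grids; nonnegativity
  gives the cross terms their sign.\<close>

definition kernel :: "('a::euclidean_space \<Rightarrow> real) \<Rightarrow> bool" where
  "kernel F \<longleftrightarrow> continuous_on UNIV F \<and> (\<forall>x. 0 \<le> F x) \<and> bounded (range F)"

lemma kernel_measurable: "kernel F \<Longrightarrow> F \<in> borel_measurable borel"
  by (simp add: kernel_def borel_measurable_continuous_onI)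

lemma kernel_bound:
  fixes F :: "'a::euclidean_space \<Rightarrow> real"
  assumes "kernel F"
  shows "\<exists>B\<ge>0. \<forall>x. 0 \<le> F x \<and> F x \<le> B"
proof -
  obtain B where B: "\<forall>y\<in>range F. norm y \<le> B"
    using assms unfolding kernel_def bounded_iff by blast
  then have "F x \<le> B" for x using abs_le_D1[of "F x" B] by simp
  moreover have "0 \<le> F x" for x using assms by (simp add: kernel_def)
  moreover from this have "0 \<le> B" using \<open>F 0 \<le> B\<close> order_trans by blast
  ultimately show ?thesis by blast
qed

lemma occ_cong:
  assumes "\<And>s r. 0 \<le> r \<Longrightarrow> r \<le> s \<Longrightarrow> s \<le> t \<Longrightarrow> F (x s - x r) = G (y s - y r)"
  shows "self_occ F x t = self_occ G y t"
  unfolding self_occ_def using assms by (intro set_lebesgue_integral_cong allI impI) auto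

lemma measurable_occ:
  fixes Z :: "real \<Rightarrow> 'w \<Rightarrow> 'a::euclidean_space" and F :: "'a \<Rightarrow> real"
  assumes [measurable]: "(\<lambda>(\<omega>, s). Z s \<omega>) \<in> borel_measurable (N \<Otimes>\<^sub>M borel)" "F \<in> borel_measurable borel"
  shows "(\<lambda>\<omega>. self_occ F (\<lambda>s. Z s \<omega>) t) \<in> borel_measurable N"
proof -
  have eq: "indicator {0..s} r = (if 0 \<le> r \<and> r \<le> s then 1 else 0 :: real)" for r s :: real
    by (simp add: indicator_def)
  show ?thesis
    unfolding self_occ_def set_lebesgue_integral_def eq by measurable
qed

lemma set_integrable_bounded:
  fixes h :: "real \<Rightarrow> real"
  assumes [measurable]: "h \<in> borel_measurable borel" and B: "\<And>s. s \<in> {a..b} \<Longrightarrow> \<bar>h s\<bar> \<le> B"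
  shows "set_integrable lborel {a..b} h"
  unfolding set_integrable_def
proof (rule Bochner_Integration.integrable_bound)
  show "integrable lborel (\<lambda>s. indicator {a..b} s * B)"
    by (intro integrable_mult_left integrable_real_indicator) (auto simp: emeasure_lborel_Icc_eq)
qed (use B in \<open>auto simp: indicator_def intro!: AE_I2 order_trans[OF B]\<close>)

lemma set_integral_bounded:
  fixes h :: "real \<Rightarrow> real"
  assumes "h \<in> borel_measurable borel" and B: "\<And>s. s \<in> {a..b} \<Longrightarrow> 0 \<le> h s \<and> h s \<le> B" and "a \<le> b"
  shows "0 \<le> (LBINT s:{a..b}. h s)" "(LBINT s:{a..b}. h s) \<le> B * (b - a)"
proof -
  show "0 \<le> (LBINT s:{a..b}. h s)"
    unfolding set_lebesgue_integral_def using B by (intro Bochner_Integration.integral_nonneg) (auto simp: indicator_def)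
  have "(LBINT s:{a..b}. h s) \<le> (LBINT s:{a..b}. B)"
    using B by (intro set_integral_mono set_integrable_bounded[where B="B"] assms) (auto simp: abs_le_iff intro: order_trans)
  then show "(LBINT s:{a..b}. h s) \<le> B * (b - a)"
    using \<open>a \<le> b\<close> by (simp add: set_integral_const mult.commute)
qed

lemma measurable_inner:
  fixes x :: "real \<Rightarrow> 'a::euclidean_space" and F :: "'a \<Rightarrow> real" and a b :: real
  assumes [measurable]: "x \<in> borel_measurable borel" "F \<in> borel_measurable borel"
  shows "(\<lambda>s. LBINT r:{a..s}. F (x s - x r)) \<in> borel_measurable borel"
    "(\<lambda>s. LBINT r:{a..b}. F (x s - x r)) \<in> borel_measurable borel"
    "(\<lambda>r. F (x s - x r)) \<in> borel_measurable borel"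
proof -
  have eq: "indicator {a..s} r = (if a \<le> r \<and> r \<le> s then 1 else 0 :: real)" for r s :: real
    by (simp add: indicator_def)
  show "(\<lambda>s. LBINT r:{a..s}. F (x s - x r)) \<in> borel_measurable borel"
    unfolding set_lebesgue_integral_def eq by measurable
  show "(\<lambda>s. LBINT r:{a..b}. F (x s - x r)) \<in> borel_measurable borel"
    unfolding set_lebesgue_integral_def by measurable
qed measurable

lemma inner_bounds:
  fixes x :: "real \<Rightarrow> 'a::euclidean_space" and F :: "'a \<Rightarrow> real"
  assumes x: "x \<in> borel_measurable borel" and F: "F \<in> borel_measurable borel"
    and B: "\<And>x. 0 \<le> F x" "\<And>x. F x \<le> B" and s: "s \<in> {0..t}"
  shows "0 \<le> (LBINT r:{0..s}. F (x s - x r)) \<and> (LBINT r:{0..s}. F (x s - x r)) \<le> B * t"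
proof -
  have "0 \<le> B" using B[of 0] by linarith
  then have "B * (s - 0) \<le> B * t" using s by (simp add: mult_left_mono)
  then show ?thesis
    using set_integral_bounded[OF measurable_inner(3)[OF x F], of 0 s s B] B s by auto
qed

lemma occ_bounds:
  fixes x :: "real \<Rightarrow> 'a::euclidean_space" and F :: "'a \<Rightarrow> real"
  assumes x: "x \<in> borel_measurable borel" and F: "F \<in> borel_measurable borel"
    and B: "\<And>x. 0 \<le> F x" "\<And>x. F x \<le> B" and t: "0 \<le> t"
  shows "0 \<le> self_occ F x t" "self_occ F x t \<le> B * t\<^sup>2"
proof -
  show "0 \<le> self_occ F x t" "self_occ F x t \<le> B * t\<^sup>2"
    using set_integral_bounded[OF measurable_inner(1)[OF x F] inner_bounds[OF x F B] t]
    by (auto simp: self_occ_def power2_eq_square mult.assoc)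
qed

lemma cross_nonneg:
  fixes x :: "real \<Rightarrow> 'a::euclidean_space" and F :: "'a \<Rightarrow> real"
  assumes B: "\<And>x. 0 \<le> F x"
  shows "0 \<le> cross_occ F x t T"
  unfolding cross_occ_def set_lebesgue_integral_def
  using B by (intro Bochner_Integration.integral_nonneg) (auto simp: indicator_def)

lemma set_integral_shift:
  fixes h :: "real \<Rightarrow> real"
  shows "(LBINT s:{a..b}. h s) = (LBINT s:{a - t..b - t}. h (t + s))"
proof -
  have "indicator {a..b} (t + s) = (indicator {a - t..b - t} s :: real)" for s
    by (auto simp: indicator_def)
  then show ?thesis
    unfolding set_lebesgue_integral_def by (subst lborel_integral_real_affine[of 1 _ t]) auto
qed

lemma set_integral_dilate:
  fixes h :: "real \<Rightarrow> real"
  assumes "0 < c"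
  shows "(LBINT s:{0..c * t}. h s) = c * (LBINT s:{0..t}. h (c * s))"
proof -
  have "indicator {0..c * t} (c * s) = (indicator {0..t} s :: real)" for s
    using assms by (auto simp: indicator_def zero_le_mult_iff)
  then show ?thesis
    using assms unfolding set_lebesgue_integral_def by (subst lborel_integral_real_affine[of c _ 0]) auto
qed

lemma set_integral_split:
  fixes h :: "real \<Rightarrow> real"
  assumes "set_integrable lborel {a..b} h" "a \<le> t" "t \<le> b"
  shows "(LBINT s:{a..b}. h s) = (LBINT s:{a..t}. h s) + (LBINT s:{t..b}. h s)"
proof -
  have "{a..b} = {a..t} \<union> {t..b}" using assms by auto
  moreover have "(LBINT s:{a..t} \<union> {t..b}. h s) = (LBINT s:{a..t}. h s) + (LBINT s:{t..b}. h s)"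
  proof (rule set_integral_Un_AE)
    show "AE x in lborel. \<not> (x \<in> {a..t} \<and> x \<in> {t..b})"
      using AE_lborel_singleton[of t] by eventually_elim auto
  qed (use assms in \<open>auto intro: set_integrable_subset\<close>)
  ultimately show ?thesis by simp
qed

text \<open>The triangle 0 <= r <= s <= T is cut at \<open>t\<close> into two smaller triangles and
  the rectangle r <= t <= s.\<close>

lemma occ_split:
  fixes x :: "real \<Rightarrow> 'a::euclidean_space" and F :: "'a \<Rightarrow> real"
  assumes x: "x \<in> borel_measurable borel" and F: "kernel F" and t: "0 \<le> t" "t \<le> T"
  shows "self_occ F x T = self_occ F x t + self_occ F (\<lambda>s. x (t + s)) (T - t) + cross_occ F x t T"
proof -
  obtain B where B': "0 \<le> B" "\<forall>x. 0 \<le> F x \<and> F x \<le> B" using kernel_bound[OF F] by blast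
  then have B: "0 \<le> B" "\<And>x. 0 \<le> F x" "\<And>x. F x \<le> B" by blast+
  note Fm = kernel_measurable[OF F]
  note m = measurable_inner[OF x Fm]
  let ?h = "\<lambda>s. LBINT r:{0..s}. F (x s - x r)"
  have in1: "\<bar>LBINT r:{a..s}. F (x s - x r)\<bar> \<le> B * (s - a)" if "a \<le> s" for a s
    using set_integral_bounded[OF m(3), of a s s B] B that by auto
  have in2: "\<bar>LBINT r:{0..t}. F (x s - x r)\<bar> \<le> B * t" for s
    using set_integral_bounded[OF m(3), of 0 t s B] B t by auto
  have "set_integrable lborel {0..T} ?h"
    using B by (intro set_integrable_bounded[where B="B * T"] m) (auto intro!: order_trans[OF in1] mult_left_mono)
  from set_integral_split[OF this t]
  have "self_occ F x T = self_occ F x t + (LBINT s:{t..T}. ?h s)"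
    unfolding self_occ_def .
  also have "(LBINT s:{t..T}. ?h s) = (LBINT s:{t..T}. (LBINT r:{0..t}. F (x s - x r)) + (LBINT r:{t..s}. F (x s - x r)))"
    using t B by (intro set_lebesgue_integral_cong allI impI set_integral_split set_integrable_bounded[where B=B] m)
      (auto simp: abs_le_iff intro: order_trans)
  also have "\<dots> = cross_occ F x t T + (LBINT s:{t..T}. (LBINT r:{t..s}. F (x s - x r)))"
    unfolding cross_occ_def
  proof (rule set_integral_add)
    show "set_integrable lborel {t..T} (\<lambda>s. LBINT r:{0..t}. F (x s - x r))"
      using in2 by (intro set_integrable_bounded m)
    show "set_integrable lborel {t..T} (\<lambda>s. LBINT r:{t..s}. F (x s - x r))"
      using B t by (intro set_integrable_bounded[where B="B * (T - t)"] m) (auto intro!: order_trans[OF in1] mult_left_mono)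
  qed
  also have "(LBINT s:{t..T}. (LBINT r:{t..s}. F (x s - x r))) = self_occ F (\<lambda>s. x (t + s)) (T - t)"
    unfolding self_occ_def by (subst set_integral_shift[of _ _ _ t], subst (2) set_integral_shift[of _ _ _ t]) simp
  finally show ?thesis by simp
qed

lemma occ_dilate:
  assumes "0 < c"
  shows "self_occ F x (c * t) = c\<^sup>2 * self_occ F (\<lambda>s. x (c * s)) t"
  unfolding self_occ_def using assms
  by (subst set_integral_dilate, simp, subst set_integral_dilate, simp)
    (simp add: power2_eq_square)

lemma occ_step_tendsto:
  fixes x :: "real \<Rightarrow> 'a::euclidean_space" and F :: "'a \<Rightarrow> real"
  assumes x: "\<And>s. continuous (at_right s) x" and F: "kernel F" and t: "0 \<le> t"
  shows "(\<lambda>n. self_occ F (\<lambda>s. x (right_grid n s)) t) \<longlonglongrightarrow> self_occ F x t"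
proof -
  let ?x = "\<lambda>n s. x (right_grid n s)"
  let ?d = "\<lambda>n s r. F (?x n s - ?x n r)"
  obtain B where B': "0 \<le> B" "\<forall>x. 0 \<le> F x \<and> F x \<le> B" using kernel_bound[OF F] by blast
  then have B: "0 \<le> B" "\<And>x. 0 \<le> F x" "\<And>x. F x \<le> B" by blast+
  have Fm [measurable]: "F \<in> borel_measurable borel" by (rule kernel_measurable[OF F])
  have xm: "x \<in> borel_measurable borel" by (rule right_continuous_borel_measurable[OF x])
  have "(\<lambda>(\<omega>, s). ?x n s) \<in> borel_measurable (count_space (UNIV :: unit set) \<Otimes>\<^sub>M borel)" for n
    by (rule measurable_step) simp
  from measurable_compose[OF measurable_Pair1' this, of "()"]
  have xn: "(\<lambda>s. ?x n s) \<in> borel_measurable borel" for n by simp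
  note m = measurable_inner[OF xm Fm] and mn = measurable_inner[OF xn Fm]
  have conv: "(\<lambda>n. ?d n s r) \<longlonglongrightarrow> F (x s - x r)" for s r
  proof -
    have "(\<lambda>n. ?x n s - ?x n r) \<longlonglongrightarrow> x s - x r"
      by (intro tendsto_diff right_continuous_step_tendsto x)
    then show ?thesis
      using F continuous_on_tendsto_compose[of UNIV F _ "x s - x r" sequentially] by (simp add: kernel_def)
  qed
  have inner: "(\<lambda>n. LBINT r:{0..s}. ?d n s r) \<longlonglongrightarrow> (LBINT r:{0..s}. F (x s - x r))" for s
    unfolding set_lebesgue_integral_def
  proof (rule integral_dominated_convergence[where w="\<lambda>r. indicator {0..s} r * B"])
    show "integrable lborel (\<lambda>r. indicator {0..s} r * B)"
      by (intro integrable_mult_left integrable_real_indicator) (auto simp: emeasure_lborel_Icc_eq)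
    show "AE r in lborel. (\<lambda>n. indicator {0..s} r *\<^sub>R ?d n s r) \<longlonglongrightarrow> indicator {0..s} r *\<^sub>R F (x s - x r)"
      by (intro AE_I2 tendsto_scaleR tendsto_const conv)
  qed (use B m mn in \<open>auto simp: indicator_def\<close>)
  note bnd = inner_bounds[OF xn Fm B(2,3), of _ t]
  show ?thesis
    unfolding self_occ_def set_lebesgue_integral_def[of lborel "{0..t}"]
  proof (rule integral_dominated_convergence[where w="\<lambda>r. indicator {0..t} r * (B * t)"])
    show "integrable lborel (\<lambda>r. indicator {0..t} r * (B * t))"
      by (intro integrable_mult_left integrable_real_indicator) (auto simp: emeasure_lborel_Icc_eq)
    show "AE s in lborel. (\<lambda>n. indicator {0..t} s *\<^sub>R (LBINT r:{0..s}. ?d n s r)) \<longlonglongrightarrow> indicator {0..t} s *\<^sub>R (LBINT r:{0..s}. F (x s - x r))"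
      by (intro AE_I2 tendsto_scaleR tendsto_const inner)
    show "AE s in lborel. norm (indicator {0..t} s *\<^sub>R (LBINT r:{0..s}. ?d n s r)) \<le> indicator {0..t} s * (B * t)" for n
      using bnd[of _ n] by (intro AE_I2) (auto simp: indicator_def)
    show "(\<lambda>s. indicator {0..t} s *\<^sub>R (LBINT r:{0..s}. ?d n s r)) \<in> borel_measurable lborel" for n
      using mn(1)[of 0 n] by (intro borel_measurable_scaleR) auto
    show "(\<lambda>s. indicator {0..t} s *\<^sub>R (LBINT r:{0..s}. F (x s - x r))) \<in> borel_measurable lborel"
      using m(1)[of 0] by (intro borel_measurable_scaleR) auto
  qed
qed

text \<open>Evaluation (x, s) |-> x s is not jointly measurable for the product algebra on all
  paths. The discretized path depends on countably many coordinates, so this limit is measurable,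
  and it equals \<open>self_occ\<close> on right continuous paths.\<close>

definition path_occ :: "('a::euclidean_space \<Rightarrow> real) \<Rightarrow> real \<Rightarrow> (real \<Rightarrow> 'a) \<Rightarrow> real" where
  "path_occ F t x = lim (\<lambda>n. self_occ F (\<lambda>s. x (right_grid n s)) t)"

lemma measurable_path_occ:
  assumes "F \<in> borel_measurable borel"
  shows "path_occ F t \<in> borel_measurable paths"
proof -
  have "(\<lambda>(x, s). x (right_grid n s)) \<in> borel_measurable ((paths :: (real \<Rightarrow> 'a) measure) \<Otimes>\<^sub>M borel)" for n
    by (rule measurable_step[of "\<lambda>s x. x s"]) simp
  then show ?thesis
    unfolding path_occ_def[abs_def] using assms
    by (intro borel_measurable_lim_metric measurable_occ)
qed

lemma path_occ_eq:
  assumes "\<And>s. continuous (at_right s) x" "kernel F" "0 \<le> t"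
  shows "path_occ F t x = self_occ F x t"
  unfolding path_occ_def by (rule limI[OF occ_step_tendsto[OF assms]])

section \<open>Renormalization\<close>

text \<open>Stopping a path keeps it right continuous; this serves to show that the local time of an
  interval depends only on increments inside it.\<close>

lemma continuous_at_right_min:
  fixes x :: "real \<Rightarrow> 'a::topological_space"
  assumes x: "\<And>s. continuous (at_right s) x"
  shows "continuous (at_right s) (\<lambda>u. x (min c u))"
  unfolding continuous_within
proof (cases "s < c")
  case True
  have "\<forall>\<^sub>F u in at_right s. x u = x (min c u)"
    by (rule eventually_at_rightI[of s c]) (use True in auto)
  moreover have "(x \<longlongrightarrow> x (min c s)) (at_right s)"
    using x[of s] True by (simp add: continuous_within)
  ultimately show "((\<lambda>u. x (min c u)) \<longlongrightarrow> x (min c s)) (at_right s)"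
    by (rule Lim_transform_eventually[rotated])
next
  case False
  have "\<forall>\<^sub>F u in at_right s. x (min c s) = x (min c u)"
    using False by (auto intro!: eventually_at_rightI[of s "s + 1"] simp: min_def)
  then show "((\<lambda>u. x (min c u)) \<longlongrightarrow> x (min c s)) (at_right s)"
    by (rule Lim_transform_eventually[OF tendsto_const])
qed

context levy_process
begin

lemma path_right_continuous:
  assumes "\<omega> \<in> space M"
  shows "continuous (at_right s) (traj X \<omega>)"
  unfolding continuous_within
proof (cases "0 \<le> s")
  case True
  have "((\<lambda>u. X u \<omega>) \<longlongrightarrow> X s \<omega>) (at_right s)"
    using right_continuous[OF assms True] by (simp add: continuous_within)
  moreover have "\<forall>\<^sub>F u in at_right s. X u \<omega> = traj X \<omega> u"
    using True by (auto intro!: eventually_at_rightI[of s "s + 1"] simp: traj_def)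
  ultimately show "(traj X \<omega> \<longlongrightarrow> traj X \<omega> s) (at_right s)"
    using True by (auto simp: traj_def intro: Lim_transform_eventually)
next
  case False
  have "\<forall>\<^sub>F u in at_right s. traj X \<omega> s = traj X \<omega> u"
    using False by (auto intro!: eventually_at_rightI[of s 0] simp: traj_def)
  then show "(traj X \<omega> \<longlongrightarrow> traj X \<omega> s) (at_right s)"
    by (rule Lim_transform_eventually[OF tendsto_const])
qed

lemma measurable_path_pair: "(\<lambda>(\<omega>, s). traj X \<omega> s) \<in> borel_measurable (M \<Otimes>\<^sub>M borel)"
  unfolding traj_def
  by (rule measurable_right_continuous)
    (use path_right_continuous in \<open>auto simp: traj_def[abs_def] random_variable_X\<close>)

lemma path_borel_measurable: "\<omega> \<in> space M \<Longrightarrow> traj X \<omega> \<in> borel_measurable borel"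
  by (intro right_continuous_borel_measurable path_right_continuous)

lemma path_occ_path: "\<omega> \<in> space M \<Longrightarrow> kernel F \<Longrightarrow> 0 \<le> t \<Longrightarrow> path_occ F t (traj X \<omega>) = self_occ F (traj X \<omega>) t"
  by (intro path_occ_eq path_right_continuous)

lemma measurable_occ_path: "kernel F \<Longrightarrow> (\<lambda>\<omega>. self_occ F (traj X \<omega>) t) \<in> borel_measurable M"
  by (intro measurable_occ measurable_path_pair kernel_measurable)

lemma integrable_occ_path:
  assumes "kernel F" "0 \<le> t"
  shows "integrable M (\<lambda>\<omega>. self_occ F (traj X \<omega>) t)"
proof -
  obtain B where B: "\<forall>x. 0 \<le> F x \<and> F x \<le> B" using kernel_bound[OF assms(1)] by blast
  show ?thesis
  proof (rule integrable_const_bound[where B="B * t\<^sup>2"])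
    show "AE \<omega> in M. norm (self_occ F (traj X \<omega>) t) \<le> B * t\<^sup>2"
    proof (intro AE_I2)
      fix \<omega> assume "\<omega> \<in> space M"
      with occ_bounds[OF path_borel_measurable kernel_measurable[OF assms(1)], of \<omega> B t] B assms(2)
      show "norm (self_occ F (traj X \<omega>) t) \<le> B * t\<^sup>2" by simp
    qed
  qed (rule measurable_occ_path[OF assms(1)])
qed

end

lemma expectation_occ_cong_law:
  fixes X :: "real \<Rightarrow> 'w \<Rightarrow> 'a::euclidean_space" and Y :: "real \<Rightarrow> 'v \<Rightarrow> 'a"
  assumes "levy_process M X" "levy_process N Y"
    and eq: "distr M paths (traj X) = distr N paths (traj Y)" and F: "kernel F" and t: "0 \<le> t"
  shows "(LINT \<omega>|M. self_occ F (traj X \<omega>) t) = (LINT \<omega>|N. self_occ F (traj Y \<omega>) t)"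
proof -
  interpret X: levy_process M X by fact
  interpret Y: levy_process N Y by fact
  note [measurable] = measurable_path_occ[OF kernel_measurable[OF F], of t]
  have "(LINT \<omega>|M. self_occ F (traj X \<omega>) t) = (LINT \<omega>|M. path_occ F t (traj X \<omega>))"
    using X.path_occ_path[OF _ F t] by (intro Bochner_Integration.integral_cong) auto
  also have "\<dots> = (LINT x|distr M paths (traj X). path_occ F t x)"
    by (subst integral_distr) auto
  also have "\<dots> = (LINT \<omega>|N. path_occ F t (traj Y \<omega>))"
    unfolding eq by (subst integral_distr) auto
  also have "\<dots> = (LINT \<omega>|N. self_occ F (traj Y \<omega>) t)"
    using Y.path_occ_path[OF _ F t] by (intro Bochner_Integration.integral_cong) auto
  finally show ?thesis .
qed

lemma kernel_rescale:
  fixes f :: "'a::euclidean_space \<Rightarrow> real"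
  assumes f: "mollifier f" and \<epsilon>: "0 < \<epsilon>"
  shows "kernel (rescale f \<epsilon>)"
proof -
  have s: "schwartz f" and f0: "\<And>x. 0 \<le> f x" using f by (auto simp: mollifier_def)
  obtain B where B: "\<And>x. norm x ^ 0 * \<bar>f x\<bar> \<le> B" using schwartz_decay[OF s] by blast
  have "continuous_on UNIV (\<lambda>x. f (x /\<^sub>R \<epsilon>))"
    by (rule continuous_on_compose2[OF schwartz_continuous_on[OF s]]) (auto intro!: continuous_intros)
  then have "continuous_on UNIV (rescale f \<epsilon>)"
    unfolding rescale_def using \<epsilon> by (intro continuous_on_divide continuous_on_const) auto
  moreover have "bounded (range (rescale f \<epsilon>))"
    unfolding bounded_iff
    by (rule exI[of _ "B / \<epsilon> ^ DIM('a)"]) (use B \<epsilon> in \<open>auto simp: rescale_def divide_right_mono\<close>)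
  ultimately show ?thesis
    using f0 \<epsilon> by (auto simp: kernel_def rescale_def)
qed

lemma self_intersection_approx_eq_occ:
  "self_intersection_approx X f t \<epsilon> \<omega> = self_occ (rescale f \<epsilon>) (traj X \<omega>) t"
  unfolding self_intersection_approx_def self_occ_def
  by (intro set_lebesgue_integral_cong allI impI) (auto simp: traj_def)

lemma nn_integral_powr_Icc:
  assumes "-1 < a" "0 \<le> L"
  shows "(\<integral>\<^sup>+p. ennreal (p powr a) * indicator {0..L} p \<partial>lborel) = ennreal (L powr (a + 1) / (a + 1))"
  by (rule nn_integral_has_integral_lebesgue'[OF _ has_integral_powr_from_0[OF assms]]) simp

text \<open>In this form the integrals can be exchanged with the expectation without any
  integrability check.\<close>

lemma cross_nn_integral:
  fixes x :: "real \<Rightarrow> 'a::euclidean_space"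
  assumes x: "x \<in> borel_measurable borel" and F: "kernel F" and t: "0 \<le> t" "t \<le> T"
  shows "ennreal (cross_occ F x t T) =
    (\<integral>\<^sup>+s. (\<integral>\<^sup>+r. ennreal (F (x s - x r)) * indicator {0..t} r \<partial>lborel) * indicator {t..T} s \<partial>lborel)"
proof -
  let ?I = "\<lambda>s. LBINT r:{0..t}. F (x s - x r)"
  obtain B where B: "\<And>x. 0 \<le> F x" "\<And>x. F x \<le> B" using kernel_bound[OF F] by blast
  note m = measurable_inner[OF x kernel_measurable[OF F]]
  have inner: "ennreal (?I s) = (\<integral>\<^sup>+r. ennreal (F (x s - x r)) * indicator {0..t} r \<partial>lborel)" for s
  proof -
    have "set_integrable lborel {0..t} (\<lambda>r. F (x s - x r))"
      using B by (intro set_integrable_bounded[where B=B] m) (auto simp: abs_le_iff intro: order_trans[of _ 0])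
    then have "(\<integral>\<^sup>+r. ennreal (indicator {0..t} r *\<^sub>R F (x s - x r)) \<partial>lborel) = ennreal (?I s)"
      unfolding set_lebesgue_integral_def set_integrable_def
      using B by (intro nn_integral_eq_integral) (auto simp: indicator_def)
    moreover have "ennreal (indicator {0..t} r *\<^sub>R F (x s - x r)) = ennreal (F (x s - x r)) * indicator {0..t} r" for r
      by (simp split: split_indicator)
    ultimately show ?thesis by simp
  qed
  have bnd: "0 \<le> (?I s)" "(?I s) \<le> B * t" for s
    using set_integral_bounded[OF m(3), of 0 t s B] B t by auto
  have "set_integrable lborel {t..T} (\<lambda>s. ?I s)"
    using bnd by (intro set_integrable_bounded[where B="B * t"] m) auto
  then have "(\<integral>\<^sup>+s. ennreal (indicator {t..T} s *\<^sub>R (?I s)) \<partial>lborel) = ennreal (cross_occ F x t T)"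
    unfolding cross_occ_def set_lebesgue_integral_def[of lborel "{t..T}"] set_integrable_def
    using bnd by (intro nn_integral_eq_integral) (auto simp: indicator_def)
  moreover have "ennreal (indicator {t..T} s *\<^sub>R (?I s)) =
      (\<integral>\<^sup>+r. ennreal (F (x s - x r)) * indicator {0..t} r \<partial>lborel) * indicator {t..T} s" for s
    unfolding inner[symmetric] by (simp split: split_indicator)
  ultimately show ?thesis by simp
qed

text \<open>The condition \<open>dim\<close> says \<open>\<rho> < 2\<close>: the scaling exponent
  \<open>2 - \<rho>\<close> is positive and the mean of the cross term stays bounded.\<close>

locale renormalized_stable = symmetric_stable_process M X \<beta> \<psi>
  for M :: "'w measure" and X :: "real \<Rightarrow> 'w \<Rightarrow> 'a::euclidean_space" and \<beta> \<psi> +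
  fixes f :: "'a \<Rightarrow> real" and \<gamma> :: "real \<Rightarrow> 'w \<Rightarrow> real"
  assumes f: "mollifier f"
    and dim: "real DIM('a) < 2 * \<beta>"
    and local_time: "renormalized_self_intersection_local_time M X f \<gamma>"
begin

definition \<rho> :: real where "\<rho> = real DIM('a) / \<beta>"

lemma \<rho>_bounds: "0 < \<rho>" "\<rho> < 2"
  using index_pos dim by (auto simp: \<rho>_def field_simps)

lemma measurable_\<gamma> [measurable]: "0 \<le> t \<Longrightarrow> \<gamma> t \<in> borel_measurable M"
  using local_time by (simp add: renormalized_self_intersection_local_time_def)

definition mean :: "real \<Rightarrow> real \<Rightarrow> real" where
  "mean \<epsilon> t = expectation (\<lambda>\<omega>. self_occ (rescale f \<epsilon>) (traj X \<omega>) t)"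

lemma approx_tendsto:
  assumes "0 \<le> t" and e: "filterlim e (at_right 0) sequentially"
  shows "AE \<omega> in M. (\<lambda>k. self_occ (rescale f (e k)) (traj X \<omega>) t - mean (e k) t) \<longlonglongrightarrow> \<gamma> t \<omega>"
proof -
  have "AE \<omega> in M. ((\<lambda>\<epsilon>. renormalized_approx M X f t \<epsilon> \<omega>) \<longlongrightarrow> \<gamma> t \<omega>) (at_right 0)"
    using local_time assms(1) by (simp add: renormalized_self_intersection_local_time_def)
  then show ?thesis
    by eventually_elim
      (use filterlim_compose[OF _ e] in \<open>auto simp: renormalized_approx_def self_intersection_approx_eq_occ mean_def\<close>)
qed

text \<open>A sequence instead of a continuous parameter, so that the limit in \<open>renorm\<close>
  is a measurable function on path space.\<close>

definition eps :: "nat \<Rightarrow> real" where "eps k = 1 / real (Suc k)"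

lemma eps_pos: "0 < eps k"
  by (simp add: eps_def)

text \<open>The multiple \<open>c\<close> is there because spatial scaling replaces \<epsilon> by a
  constant times \<epsilon>.\<close>

lemma filterlim_eps: "0 < c \<Longrightarrow> filterlim (\<lambda>k. c * eps k) (at_right 0) sequentially"
  unfolding filterlim_at
proof
  assume c: "0 < c"
  show "\<forall>\<^sub>F k in sequentially. c * eps k \<in> {0<..} \<and> c * eps k \<noteq> 0"
    using eps_pos c by (simp add: less_imp_neq[symmetric])
  show "(\<lambda>k. c * eps k) \<longlonglongrightarrow> 0"
    unfolding eps_def using tendsto_mult_right_zero[OF LIMSEQ_Suc[OF lim_1_over_n[where 'a=real]]] .
qed

abbreviation molli :: "nat \<Rightarrow> 'a \<Rightarrow> real" where "molli k \<equiv> rescale f (eps k)"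

abbreviation approx :: "nat \<Rightarrow> real \<Rightarrow> (real \<Rightarrow> 'a) \<Rightarrow> real" where
  "approx k t x \<equiv> path_occ (molli k) t x - mean (eps k) t"

lemma kernel_eps: "kernel (molli k)"
  by (rule kernel_rescale[OF f eps_pos])

text \<open>
  A version of \<open>\<gamma> t\<close> as a functional on path space, so that it can also be evaluated at the
  increments of \<open>X\<close> after a later time.
\<close>

definition renorm :: "real \<Rightarrow> (real \<Rightarrow> 'a) \<Rightarrow> real" where
  "renorm t x = lim (\<lambda>k. approx k t x)"

lemma measurable_renorm_approx [measurable]:
  "approx k t \<in> borel_measurable paths"
  by (intro borel_measurable_diff measurable_path_occ kernel_measurable kernel_eps borel_measurable_const)

lemma measurable_renorm [measurable]: "renorm t \<in> borel_measurable paths"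
  unfolding renorm_def[abs_def] by (intro borel_measurable_lim_metric measurable_renorm_approx)

lemma renorm_path_tendsto:
  assumes "0 \<le> t"
  shows "AE \<omega> in M. (\<lambda>k. approx k t (traj X \<omega>)) \<longlonglongrightarrow> \<gamma> t \<omega>"
  using approx_tendsto[OF assms filterlim_eps[of 1, simplified]] AE_space
  by eventually_elim (simp add: path_occ_path kernel_eps assms)

lemma renorm_path_eq:
  assumes "0 \<le> t"
  shows "AE \<omega> in M. renorm t (traj X \<omega>) = \<gamma> t \<omega>"
  using renorm_path_tendsto[OF assms] by eventually_elim (auto simp: renorm_def intro: limI)

abbreviation shift :: "real \<Rightarrow> 'w \<Rightarrow> real \<Rightarrow> 'a" where
  "shift t \<equiv> traj (\<lambda>s \<omega>. X (t + s) \<omega> - X t \<omega>)"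

lemma measurable_shift: "0 \<le> t \<Longrightarrow> shift t \<in> M \<rightarrow>\<^sub>M paths"
  using levy_process_shift by (rule levy_process.measurable_path)

lemma distr_renorm_shift:
  assumes "0 \<le> s" "0 \<le> t"
  shows "distr M borel (\<lambda>\<omega>. renorm t (shift s \<omega>)) = distr M borel (\<gamma> t)"
proof -
  have "distr M borel (\<lambda>\<omega>. renorm t (shift s \<omega>)) = distr (distr M paths (shift s)) borel (renorm t)"
    using measurable_shift[OF assms(1)] by (simp add: distr_distr comp_def)
  also have "\<dots> = distr (distr M paths (traj X)) borel (renorm t)"
    using path_shift_distr[OF assms(1)] by simp
  also have "\<dots> = distr M borel (\<lambda>\<omega>. renorm t (traj X \<omega>))"
    by (simp add: distr_distr comp_def)
  also have "\<dots> = distr M borel (\<gamma> t)"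
    using renorm_path_eq[OF assms(2)] assms(2) by (intro distr_cong_AE) auto
  finally show ?thesis .
qed

text \<open>Convergence is given for \<open>X\<close> only. The set of paths along which the
  approximations converge is measurable and has full measure under the law of \<open>X\<close>,
  which is also the law of the shifted path.\<close>

lemma renorm_shift_tendsto:
  assumes "0 \<le> s" "0 \<le> t"
  shows "AE \<omega> in M. (\<lambda>k. approx k t (shift s \<omega>)) \<longlonglongrightarrow> renorm t (shift s \<omega>)"
proof -
  have set: "{x \<in> space paths. convergent (\<lambda>k. approx k t x)} \<in> sets paths"
    unfolding Cauchy_convergent_iff[symmetric] by (intro sets_Collect_Cauchy measurable_renorm_approx)
  have "AE \<omega> in M. convergent (\<lambda>k. approx k t (traj X \<omega>))"
    using renorm_path_tendsto[OF assms(2)] by eventually_elim (auto simp: convergent_def)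
  then have "AE x in distr M paths (traj X). convergent (\<lambda>k. approx k t x)"
    by (subst AE_distr_iff[OF measurable_path set])
  then have "AE x in distr M paths (shift s). convergent (\<lambda>k. approx k t x)"
    by (simp only: path_shift_distr[OF assms(1)])
  then have "AE \<omega> in M. convergent (\<lambda>k. approx k t (shift s \<omega>))"
    by (subst (asm) AE_distr_iff[OF measurable_shift[OF assms(1)] set])
  then show ?thesis
    by eventually_elim (simp add: renorm_def convergent_LIMSEQ_iff)
qed

text \<open>Membership holds exactly, not just up to null sets: every path is right continuous,
  \<open>lim\<close> is total, and stopping the shifted path at \<open>t - s\<close> changes nothing
  before that time. Hence independence applies without completing the algebras.\<close>

lemma measurable_renorm_shift:
  assumes s: "0 \<le> s" "s \<le> t"
  shows "(\<lambda>\<omega>. renorm (t - s) (shift s \<omega>)) \<in> borel_measurable (incr {s..t})"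
proof -
  let ?N = "incr {s..t}"
  interpret S: levy_process M "\<lambda>u \<omega>. X (s + u) \<omega> - X s \<omega>" by (rule levy_process_shift[OF s(1)])
  let ?Z = "\<lambda>u \<omega>. shift s \<omega> (min (t - s) u)"
  have "?Z u \<in> borel_measurable ?N" for u
    unfolding traj_def using s by (intro measurable_incr_algebra) auto
  then have "(\<lambda>(\<omega>, u). ?Z u \<omega>) \<in> borel_measurable (?N \<Otimes>\<^sub>M borel)"
    by (rule measurable_right_continuous) (intro continuous_at_right_min S.path_right_continuous, simp)
  then have "(\<lambda>\<omega>. self_occ (molli k) (\<lambda>u. ?Z u \<omega>) (t - s)) \<in> borel_measurable ?N" for k
    by (intro measurable_occ kernel_measurable kernel_eps)
  then have m: "(\<lambda>\<omega>. lim (\<lambda>k. self_occ (molli k) (\<lambda>u. ?Z u \<omega>) (t - s) - mean (eps k) (t - s))) \<in> borel_measurable ?N"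
    by (intro borel_measurable_lim_metric borel_measurable_diff borel_measurable_const)
  have "renorm (t - s) (shift s \<omega>) = lim (\<lambda>k. self_occ (molli k) (\<lambda>u. ?Z u \<omega>) (t - s) - mean (eps k) (t - s))"
    if "\<omega> \<in> space M" for \<omega>
  proof -
    have "path_occ (molli k) (t - s) (shift s \<omega>) = self_occ (molli k) (\<lambda>u. ?Z u \<omega>) (t - s)" for k
      using S.path_occ_path[OF that kernel_eps, of "t - s" k] s
      by (simp only: diff_ge_0_iff_ge) (intro occ_cong, auto simp: min_def)
    then show ?thesis by (simp add: renorm_def)
  qed
  then show ?thesis
    using m by (subst measurable_cong) auto
qed

text \<open>The increment has characteristic function exp(-(s - r) \<psi>(u)), so the lower bound on
  \<psi> permits the previous kernel estimate with \<open>k = c * (s - r)\<close>.\<close>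

lemma kernel_expectation_bound:
  "\<exists>D\<ge>0. \<forall>r s \<epsilon>. 0 \<le> r \<longrightarrow> r < s \<longrightarrow> 0 < \<epsilon> \<longrightarrow>
     (\<integral>\<^sup>+\<omega>. ennreal (rescale f \<epsilon> (X s \<omega> - X r \<omega>)) \<partial>M) \<le> ennreal (D * (s - r) powr (- \<rho>))"
proof -
  obtain c C where c: "0 < c" "\<And>u. c * norm u powr \<beta> \<le> \<psi> u" using exponent_bounds by blast
  have "schwartz f" using f by (simp add: mollifier_def)
  then obtain D where D: "0 \<le> D"
    "\<And>(M::'w measure) X k \<epsilon>. prob_space M \<Longrightarrow> X \<in> borel_measurable M \<Longrightarrow> 0 < k \<Longrightarrow> 0 < \<epsilon> \<Longrightarrow>
       (\<And>u. cmod (CLINT \<omega>|M. iexp (u \<bullet> X \<omega>)) \<le> exp (- (k * norm u powr \<beta>))) \<Longrightarrow>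
       (\<integral>\<^sup>+\<omega>. ennreal (rescale f \<epsilon> (X \<omega>)) \<partial>M) \<le> ennreal (D * k powr (- (DIM('a) / \<beta>)))"
    using index_pos by (rule schwartz_kernel_bound) blast
  have "(\<integral>\<^sup>+\<omega>. ennreal (rescale f \<epsilon> (X s \<omega> - X r \<omega>)) \<partial>M) \<le> ennreal (D * c powr (- \<rho>) * (s - r) powr (- \<rho>))"
    if rs: "0 \<le> r" "r < s" and \<epsilon>: "0 < \<epsilon>" for r s \<epsilon>
  proof -
    have "(\<integral>\<^sup>+\<omega>. ennreal (rescale f \<epsilon> (X s \<omega> - X r \<omega>)) \<partial>M) \<le> ennreal (D * (c * (s - r)) powr (- (DIM('a) / \<beta>)))"
    proof (rule D(2))
      show "prob_space M" by (rule prob_space_axioms)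
      show "(\<lambda>\<omega>. X s \<omega> - X r \<omega>) \<in> borel_measurable M" using rs by (intro measurable_increment) auto
      fix u
      have "(CLINT \<omega>|M. iexp (u \<bullet> (X s \<omega> - X r \<omega>))) = (CLINT x|distr M borel (\<lambda>\<omega>. X (r + (s - r)) \<omega> - X r \<omega>). iexp (u \<bullet> x))"
        using rs by (subst integral_distr) (auto intro!: measurable_increment)
      also have "\<dots> = (CLINT x|distr M borel (X (s - r)). iexp (u \<bullet> x))"
        using rs by (subst stationary_increments) auto
      also have "\<dots> = (CLINT \<omega>|M. iexp (u \<bullet> X (s - r) \<omega>))"
        using rs by (subst integral_distr) (auto intro!: random_variable_X)
      also have "\<dots> = complex_of_real (exp (- (s - r) * \<psi> u))"
        using rs by (intro characteristic_exponent) auto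
      finally have "cmod (CLINT \<omega>|M. iexp (u \<bullet> (X s \<omega> - X r \<omega>))) = exp (- (s - r) * \<psi> u)"
        by (simp del: exp_of_real of_real_exp)
      also have "(s - r) * (c * norm u powr \<beta>) \<le> (s - r) * \<psi> u"
        using rs c by (intro mult_left_mono) auto
      then have "exp (- (s - r) * \<psi> u) \<le> exp (- (c * (s - r) * norm u powr \<beta>))"
        by (simp add: algebra_simps)
      finally show "cmod (CLINT \<omega>|M. iexp (u \<bullet> (X s \<omega> - X r \<omega>))) \<le> exp (- (c * (s - r) * norm u powr \<beta>))" .
    qed (use rs c \<epsilon> in auto)
    then show ?thesis
      using rs c by (simp add: \<rho>_def powr_mult mult.assoc)
  qed
  then show ?thesis
    using D(1) by (intro exI[of _ "D * c powr (- \<rho>)"]) auto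
qed

text \<open>For r < t < s the gap s - r exceeds both s - t and t - r, so its power
  \<open>- \<rho>\<close> is at most the product of their powers \<open>- \<rho> / 2\<close>. The
  double integral then separates, and each factor converges because
  \<open>\<rho> / 2 < 1\<close>.\<close>

lemma cross_expectation_bound:
  "\<exists>K\<ge>0. \<forall>t T \<epsilon>. 0 \<le> t \<longrightarrow> t \<le> T \<longrightarrow> 0 < \<epsilon> \<longrightarrow>
     (\<integral>\<^sup>+\<omega>. ennreal (cross_occ (rescale f \<epsilon>) (traj X \<omega>) t T) \<partial>M) \<le> ennreal (K * T powr (2 - \<rho>))"
proof -
  obtain D where D: "0 \<le> D" "\<And>r s \<epsilon>. 0 \<le> r \<Longrightarrow> r < s \<Longrightarrow> 0 < \<epsilon> \<Longrightarrow>
     (\<integral>\<^sup>+\<omega>. ennreal (rescale f \<epsilon> (X s \<omega> - X r \<omega>)) \<partial>M) \<le> ennreal (D * (s - r) powr (- \<rho>))"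
    using kernel_expectation_bound by blast
  let ?e = "1 - \<rho> / 2" and ?p = "- \<rho> / 2"
  have e: "0 < ?e" using \<rho>_bounds by simp
  have sep: "(s - r) powr (- \<rho>) \<le> (s - t) powr ?p * (t - r) powr ?p" if "r < t" "t < s" for r s t
  proof -
    have "(s - r) powr (- \<rho>) = (s - r) powr ?p * (s - r) powr ?p"
      by (simp flip: powr_add)
    also have "\<dots> \<le> (s - t) powr ?p * (t - r) powr ?p"
      using that \<rho>_bounds by (intro mult_mono powr_mono2') auto
    finally show ?thesis .
  qed
  have "(\<integral>\<^sup>+\<omega>. ennreal (cross_occ (rescale f \<epsilon>) (traj X \<omega>) t T) \<partial>M) \<le> ennreal (D / ?e\<^sup>2 * T powr (2 - \<rho>))"
    if t: "0 \<le> t" "t \<le> T" and \<epsilon>: "0 < \<epsilon>" for t T \<epsilon>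
  proof -
    let ?F = "rescale f \<epsilon>"
    let ?G = "\<lambda>\<omega> s r. ennreal (?F (traj X \<omega> s - traj X \<omega> r))"
    have F: "kernel ?F" by (rule kernel_rescale[OF f \<epsilon>])
    note [measurable] = kernel_measurable[OF F] measurable_path_pair
    interpret L: pair_sigma_finite "lborel :: real measure" M ..
    let ?J = "\<lambda>s r. ennreal D * ennreal ((s - t) powr ?p) * (ennreal ((t - r) powr ?p) * indicator {0..t} r)"
    let ?H = "\<lambda>s r. (\<integral>\<^sup>+\<omega>. ?G \<omega> s r \<partial>M) * indicator {0..t} r"
    have A: "(\<integral>\<^sup>+\<omega>. ?G \<omega> s r \<partial>M) \<le>
        ennreal D * ennreal ((s - t) powr ?p) * ennreal ((t - r) powr ?p)"
      if "0 \<le> r" "r < t" "t < s" for r s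
    proof -
      have "(\<integral>\<^sup>+\<omega>. ?G \<omega> s r \<partial>M) \<le> ennreal (D * (s - r) powr (- \<rho>))"
        using D(2)[of r s \<epsilon>] that \<epsilon> by (simp add: traj_def)
      also have "\<dots> \<le> ennreal (D * ((s - t) powr ?p * (t - r) powr ?p))"
        using that D(1) by (intro ennreal_leI mult_left_mono sep) auto
      finally show ?thesis using D(1) by (simp add: ennreal_mult mult.assoc)
    qed
    have "(\<integral>\<^sup>+\<omega>. ennreal (cross_occ ?F (traj X \<omega>) t T) \<partial>M) =
      (\<integral>\<^sup>+\<omega>. (\<integral>\<^sup>+s. (\<integral>\<^sup>+r. ?G \<omega> s r * indicator {0..t} r \<partial>lborel) * indicator {t..T} s \<partial>lborel) \<partial>M)"
      by (intro nn_integral_cong cross_nn_integral path_borel_measurable F t)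
    also have "\<dots> = (\<integral>\<^sup>+s. (\<integral>\<^sup>+\<omega>. (\<integral>\<^sup>+r. ?G \<omega> s r * indicator {0..t} r \<partial>lborel) * indicator {t..T} s \<partial>M) \<partial>lborel)"
      by (rule L.Fubini') measurable
    also have "\<dots> = (\<integral>\<^sup>+s. (\<integral>\<^sup>+\<omega>. (\<integral>\<^sup>+r. ?G \<omega> s r * indicator {0..t} r \<partial>lborel) \<partial>M) * indicator {t..T} s \<partial>lborel)"
      by (intro nn_integral_cong nn_integral_multc) measurable
    also have "\<dots> = (\<integral>\<^sup>+s. (\<integral>\<^sup>+r. (\<integral>\<^sup>+\<omega>. ?G \<omega> s r * indicator {0..t} r \<partial>M) \<partial>lborel) * indicator {t..T} s \<partial>lborel)"
      by (intro nn_integral_cong arg_cong2[where f="(*)"] refl L.Fubini') measurable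
    also have "\<dots> = (\<integral>\<^sup>+s. (\<integral>\<^sup>+r. ?H s r \<partial>lborel) * indicator {t..T} s \<partial>lborel)"
      by (intro nn_integral_cong arg_cong2[where f="(*)"] refl nn_integral_multc) measurable
    also have "\<dots> \<le> (\<integral>\<^sup>+s. (\<integral>\<^sup>+r. ?J s r \<partial>lborel) * indicator {t..T} s \<partial>lborel)"
    proof (rule nn_integral_mono_AE)
      show "AE s in lborel. (\<integral>\<^sup>+r. ?H s r \<partial>lborel) * indicator {t..T} s
        \<le> (\<integral>\<^sup>+r. ?J s r \<partial>lborel) * indicator {t..T} s"
        \<comment> \<open>Because \<open>0 powr p = 0\<close>, the majorant vanishes at s = t and at
          r = t; these null sets must be removed.\<close>
        using AE_lborel_singleton[of t]
      proof eventually_elim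
        fix s assume "s \<noteq> t"
        have "(\<integral>\<^sup>+r. ?H s r \<partial>lborel)
          \<le> (\<integral>\<^sup>+r. ?J s r \<partial>lborel)"
          if "t < s"
        proof (rule nn_integral_mono_AE)
          show "AE r in lborel. ?H s r
              \<le> ?J s r"
            using AE_lborel_singleton[of t] by eventually_elim (use A that in \<open>auto simp: indicator_def\<close>)
        qed
        then show "(\<integral>\<^sup>+r. ?H s r \<partial>lborel) * indicator {t..T} s
        \<le> (\<integral>\<^sup>+r. ?J s r \<partial>lborel) * indicator {t..T} s"
          using \<open>s \<noteq> t\<close> by (auto simp: indicator_def)
      qed
    qed
    also have "\<dots> = ennreal D * (\<integral>\<^sup>+r. ennreal ((t - r) powr ?p) * indicator {0..t} r \<partial>lborel) *
        (\<integral>\<^sup>+s. ennreal ((s - t) powr ?p) * indicator {t..T} s \<partial>lborel)"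
    proof -
      define I where "I = (\<integral>\<^sup>+r. ennreal ((t - r) powr ?p) * indicator {0..t} r \<partial>lborel)"
      have "(\<integral>\<^sup>+r. ?J s r \<partial>lborel) * indicator {t..T} s
          = ennreal D * I * (ennreal ((s - t) powr ?p) * indicator {t..T} s)" for s
        unfolding I_def by (subst nn_integral_cmult) (auto simp: mult_ac)
      then show ?thesis
        unfolding I_def[symmetric] by (simp add: nn_integral_cmult)
    qed
    also have "(\<integral>\<^sup>+r. ennreal ((t - r) powr ?p) * indicator {0..t} r \<partial>lborel) = ennreal (t powr ?e / ?e)"
    proof -
      have "(\<integral>\<^sup>+r. ennreal ((t - r) powr ?p) * indicator {0..t} r \<partial>lborel) =
        (\<integral>\<^sup>+r. ennreal (r powr ?p) * indicator {0..t} (t - r) \<partial>lborel)"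
        by (subst nn_integral_real_affine[of _ "-1" t]) auto
      also have "\<dots> = (\<integral>\<^sup>+r. ennreal (r powr ?p) * indicator {0..t} r \<partial>lborel)"
        by (intro nn_integral_cong) (auto simp: indicator_def)
      finally show ?thesis using nn_integral_powr_Icc[of ?p t] e t by simp
    qed
    also have "(\<integral>\<^sup>+s. ennreal ((s - t) powr ?p) * indicator {t..T} s \<partial>lborel) = ennreal ((T - t) powr ?e / ?e)"
    proof -
      have "(\<integral>\<^sup>+s. ennreal ((s - t) powr ?p) * indicator {t..T} s \<partial>lborel) =
        (\<integral>\<^sup>+s. ennreal (s powr ?p) * indicator {t..T} (t + s) \<partial>lborel)"
        by (subst nn_integral_real_affine[of _ "1" t]) auto
      also have "\<dots> = (\<integral>\<^sup>+s. ennreal (s powr ?p) * indicator {0..T - t} s \<partial>lborel)"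
        by (intro nn_integral_cong) (auto simp: indicator_def)
      finally show ?thesis using nn_integral_powr_Icc[of ?p "T - t"] e t by simp
    qed
    also have "ennreal D * ennreal (t powr ?e / ?e) * ennreal ((T - t) powr ?e / ?e) = ennreal (D * (t powr ?e / ?e) * ((T - t) powr ?e / ?e))"
    proof -
      have "0 \<le> t powr ?e / ?e" "0 \<le> (T - t) powr ?e / ?e" using e by simp_all
      with D(1) show ?thesis by (simp only: ennreal_mult mult_nonneg_nonneg)
    qed
    also have "\<dots> \<le> ennreal (D * (T powr ?e / ?e) * (T powr ?e / ?e))"
      using D(1) e t by (intro ennreal_leI mult_mono mult_left_mono divide_right_mono powr_mono2) auto
    also have "D * (T powr ?e / ?e) * (T powr ?e / ?e) = D / ?e\<^sup>2 * T powr (2 - \<rho>)"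
    proof -
      have "T powr ?e * T powr ?e = T powr (2 - \<rho>)" by (simp flip: powr_add)
      then show ?thesis by (simp add: power2_eq_square)
    qed
    finally show ?thesis .
  qed
  then show ?thesis
    using D(1) by (intro exI[of _ "D / ?e\<^sup>2"]) auto
qed

text \<open>After centering, \<open>occ_split\<close> leaves the cross term minus its mean. The
  cross term is dropped by its sign and the mean is bounded uniformly in \<epsilon>, so the
  inequality survives the limit although the individual means need not converge.\<close>

theorem superadditive:
  "\<exists>K\<ge>0. \<forall>t T. 0 \<le> t \<longrightarrow> t \<le> T \<longrightarrow>
     (AE \<omega> in M. \<gamma> t \<omega> + renorm (T - t) (shift t \<omega>) - K * T powr (2 - \<rho>) \<le> \<gamma> T \<omega>)"
proof -
  obtain K where K: "0 \<le> K" "\<And>t T \<epsilon>. 0 \<le> t \<Longrightarrow> t \<le> T \<Longrightarrow> 0 < \<epsilon> \<Longrightarrow>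
     (\<integral>\<^sup>+\<omega>. ennreal (cross_occ (rescale f \<epsilon>) (traj X \<omega>) t T) \<partial>M) \<le> ennreal (K * T powr (2 - \<rho>))"
    using cross_expectation_bound by blast
  have "AE \<omega> in M. \<gamma> t \<omega> + renorm (T - t) (shift t \<omega>) - K * T powr (2 - \<rho>) \<le> \<gamma> T \<omega>"
    if t: "0 \<le> t" "t \<le> T" for t T
  proof -
    interpret S: levy_process M "\<lambda>u \<omega>. X (t + u) \<omega> - X t \<omega>" by (rule levy_process_shift[OF t(1)])
    have split: "self_occ (molli k) (traj X \<omega>) T = self_occ (molli k) (traj X \<omega>) t + self_occ (molli k) (shift t \<omega>) (T - t) + cross_occ (molli k) (traj X \<omega>) t T"
      if "\<omega> \<in> space M" for k \<omega>
    proof -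
      have "self_occ (molli k) (\<lambda>s. traj X \<omega> (t + s)) (T - t) = self_occ (molli k) (shift t \<omega>) (T - t)"
        using t by (intro occ_cong) (auto simp: traj_def)
      then show ?thesis
        using occ_split[OF path_borel_measurable[OF that] kernel_eps t] by simp
    qed
    \<comment> \<open>The shifted path has the law of \<open>X\<close>, so the centering built into
      \<open>renorm\<close> is the right one for it.\<close>
    have mean_shift: "expectation (\<lambda>\<omega>. self_occ (molli k) (shift t \<omega>) (T - t)) = mean (eps k) (T - t)" for k
      unfolding mean_def using t path_shift_distr[OF t(1)]
      by (intro expectation_occ_cong_law S.levy_process_axioms levy_process_axioms kernel_eps) auto
    have int_cross: "integrable M (\<lambda>\<omega>. cross_occ (molli k) (traj X \<omega>) t T)" for k
    proof -
      have "integrable M (\<lambda>\<omega>. self_occ (molli k) (traj X \<omega>) T - self_occ (molli k) (traj X \<omega>) t - self_occ (molli k) (shift t \<omega>) (T - t))"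
        using t by (intro Bochner_Integration.integrable_diff integrable_occ_path S.integrable_occ_path kernel_eps) auto
      then show ?thesis
        by (rule Bochner_Integration.integrable_cong[THEN iffD1, rotated -1]) (auto simp: split)
    qed
    have means: "mean (eps k) T \<le> mean (eps k) t + mean (eps k) (T - t) + K * T powr (2 - \<rho>)" for k
    proof -
      have "mean (eps k) T = expectation (\<lambda>\<omega>. self_occ (molli k) (traj X \<omega>) t + self_occ (molli k) (shift t \<omega>) (T - t) + cross_occ (molli k) (traj X \<omega>) t T)"
        unfolding mean_def by (intro Bochner_Integration.integral_cong) (auto simp: split)
      also have "\<dots> = mean (eps k) t + mean (eps k) (T - t) + expectation (\<lambda>\<omega>. cross_occ (molli k) (traj X \<omega>) t T)"
        using t by (simp add: int_cross integrable_occ_path S.integrable_occ_path kernel_eps mean_shift)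
          (simp add: mean_def)
      also have "expectation (\<lambda>\<omega>. cross_occ (molli k) (traj X \<omega>) t T) \<le> K * T powr (2 - \<rho>)"
      proof -
        have nn: "AE \<omega> in M. 0 \<le> cross_occ (molli k) (traj X \<omega>) t T"
          using kernel_eps[of k] by (intro AE_I2 cross_nonneg) (auto simp: kernel_def)
        have "ennreal (expectation (\<lambda>\<omega>. cross_occ (molli k) (traj X \<omega>) t T)) \<le> ennreal (K * T powr (2 - \<rho>))"
          using K(2)[OF t eps_pos, of k] by (simp only: nn_integral_eq_integral[OF int_cross nn])
        then show ?thesis using K(1) by (simp add: ennreal_le_iff)
      qed
      finally show ?thesis by simp
    qed
    have T: "0 \<le> T" "0 \<le> T - t" using t by auto
    show ?thesis
      using renorm_path_tendsto[OF t(1)] renorm_path_tendsto[OF T(1)] renorm_shift_tendsto[OF t(1) T(2)] AE_space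
    proof eventually_elim
      fix \<omega> assume lims: "(\<lambda>k. approx k t (traj X \<omega>)) \<longlonglongrightarrow> \<gamma> t \<omega>"
        "(\<lambda>k. approx k T (traj X \<omega>)) \<longlonglongrightarrow> \<gamma> T \<omega>"
        "(\<lambda>k. approx k (T - t) (shift t \<omega>)) \<longlonglongrightarrow> renorm (T - t) (shift t \<omega>)"
        and \<omega>: "\<omega> \<in> space M"
      show "\<gamma> t \<omega> + renorm (T - t) (shift t \<omega>) - K * T powr (2 - \<rho>) \<le> \<gamma> T \<omega>"
      proof (rule LIMSEQ_le[OF tendsto_diff[OF tendsto_add[OF lims(1,3)] tendsto_const] lims(2)], intro exI allI impI)
        fix k :: nat
        have "0 \<le> cross_occ (molli k) (traj X \<omega>) t T"
          using kernel_eps[of k] by (intro cross_nonneg) (auto simp: kernel_def)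
        then show "approx k t (traj X \<omega>) + approx k (T - t) (shift t \<omega>) - K * T powr (2 - \<rho>)
          \<le> approx k T (traj X \<omega>)"
          using split[OF \<omega>, of k] means[of k] path_occ_path[OF \<omega> kernel_eps] S.path_occ_path[OF \<omega> kernel_eps] t T by simp
      qed
    qed
  qed
  then show ?thesis using K(1) by blast
qed

text \<open>The rescaled process \<open>Y\<close> has the law of \<open>X\<close>. Its kernel values
  contribute t^\<rho> and the two time integrals t^(-2), while \<epsilon> becomes
  \<open>t powr (1 / \<beta>) * \<epsilon>\<close>, which has the same limit. The centering
  transforms alike, since it depends on the path law only.\<close>

theorem distr_scaling:
  assumes t: "0 < t"
  shows "distr M borel (\<gamma> t) = distr M borel (\<lambda>\<omega>. t powr (2 - \<rho>) * \<gamma> 1 \<omega>)"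
proof -
  let ?k = "t powr (- 1 / \<beta>)" and ?c = "t powr (1 / \<beta>)"
  define Y where "Y = (\<lambda>s \<omega>. ?k *\<^sub>R (X (t * s) \<omega> - X 0 \<omega>))"
  interpret Y: levy_process M Y
    unfolding Y_def using levy_process_affine[of 0 t ?k] t by simp
  have law: "distr M paths (traj Y) = distr M paths (traj X)"
    unfolding Y_def by (rule path_scale_distr[OF t])
  have c: "0 < ?c" "?k = 1 / ?c" using t by (auto simp: powr_minus_divide)
  have cd: "?c ^ DIM('a) = t powr \<rho>"
    using t by (simp add: powr_realpow[symmetric] powr_powr \<rho>_def)
  have F: "rescale f \<epsilon> (?k *\<^sub>R x) = t powr \<rho> * rescale f (?c * \<epsilon>) x" if "0 < \<epsilon>" for \<epsilon> x
  proof -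
    have "(?k *\<^sub>R x) /\<^sub>R \<epsilon> = x /\<^sub>R (?c * \<epsilon>)" unfolding c(2) by (simp add: divide_inverse mult.commute)
    then have "f ((?k *\<^sub>R x) /\<^sub>R \<epsilon>) = f (x /\<^sub>R (?c * \<epsilon>))" by (rule arg_cong)
    then show ?thesis
      unfolding rescale_def cd[symmetric] using c by (simp only: power_mult_distrib) simp
  qed
  have occY: "self_occ (rescale f \<epsilon>) (traj Y \<omega>) 1 = t powr (\<rho> - 2) * self_occ (rescale f (?c * \<epsilon>)) (traj X \<omega>) t"
    if "0 < \<epsilon>" for \<epsilon> \<omega>
  proof -
    have "self_occ (rescale f \<epsilon>) (traj Y \<omega>) 1 = self_occ (\<lambda>x. t powr \<rho> * rescale f (?c * \<epsilon>) x) (\<lambda>s. traj X \<omega> (t * s)) 1"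
      using t that by (intro occ_cong) (simp add: traj_def Y_def scaleR_diff_right[symmetric] F[simplified])
    also have "\<dots> = t powr \<rho> * self_occ (rescale f (?c * \<epsilon>)) (\<lambda>s. traj X \<omega> (t * s)) 1"
      by (simp add: self_occ_def)
    also have "self_occ (rescale f (?c * \<epsilon>)) (\<lambda>s. traj X \<omega> (t * s)) 1 = self_occ (rescale f (?c * \<epsilon>)) (traj X \<omega>) t / t\<^sup>2"
      using occ_dilate[OF t, of "rescale f (?c * \<epsilon>)" "traj X \<omega>" 1] t by simp
    finally show ?thesis using t by (simp add: powr_diff powr_numeral)
  qed
  have meanY: "mean \<epsilon> 1 = t powr (\<rho> - 2) * mean (?c * \<epsilon>) t" if "0 < \<epsilon>" for \<epsilon>
  proof -
    have "mean \<epsilon> 1 = expectation (\<lambda>\<omega>. self_occ (rescale f \<epsilon>) (traj Y \<omega>) 1)"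
      unfolding mean_def using law
      by (intro expectation_occ_cong_law Y.levy_process_axioms levy_process_axioms kernel_rescale f that) auto
    then show ?thesis using that by (simp add: occY mean_def)
  qed
  have ae: "AE \<omega> in M. renorm 1 (traj Y \<omega>) = t powr (\<rho> - 2) * \<gamma> t \<omega>"
    using approx_tendsto[OF less_imp_le[OF t] filterlim_eps[OF c(1)]] AE_space
  proof eventually_elim
    fix \<omega> assume lim: "(\<lambda>k. self_occ (rescale f (?c * eps k)) (traj X \<omega>) t - mean (?c * eps k) t) \<longlonglongrightarrow> \<gamma> t \<omega>"
      and \<omega>: "\<omega> \<in> space M"
    have "(\<lambda>k. approx k 1 (traj Y \<omega>)) =
      (\<lambda>k. t powr (\<rho> - 2) * (self_occ (rescale f (?c * eps k)) (traj X \<omega>) t - mean (?c * eps k) t))"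
      using Y.path_occ_path[OF \<omega> kernel_eps] by (simp add: occY meanY eps_pos right_diff_distrib)
    then show "renorm 1 (traj Y \<omega>) = t powr (\<rho> - 2) * \<gamma> t \<omega>"
      unfolding renorm_def using tendsto_mult_left[OF lim] by (simp add: limI)
  qed
  have "distr M borel (\<gamma> 1) = distr (distr M paths (traj X)) borel (renorm 1)"
    using renorm_path_eq[of 1] by (simp add: distr_distr comp_def) (intro distr_cong_AE, auto)
  also have "\<dots> = distr M borel (\<lambda>\<omega>. renorm 1 (traj Y \<omega>))"
    unfolding law[symmetric] by (simp add: distr_distr comp_def)
  also have "\<dots> = distr M borel (\<lambda>\<omega>. t powr (\<rho> - 2) * \<gamma> t \<omega>)"
    using ae t by (intro distr_cong_AE) auto
  finally have *: "distr M borel (\<gamma> 1) = distr M borel (\<lambda>\<omega>. t powr (\<rho> - 2) * \<gamma> t \<omega>)" .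
  have "distr M borel (\<lambda>\<omega>. t powr (2 - \<rho>) * \<gamma> 1 \<omega>) = distr (distr M borel (\<gamma> 1)) borel ((*) (t powr (2 - \<rho>)))"
    by (simp add: distr_distr comp_def)
  also have "\<dots> = distr M borel (\<lambda>\<omega>. t powr (2 - \<rho>) * (t powr (\<rho> - 2) * \<gamma> t \<omega>))"
    unfolding * using t by (simp add: distr_distr comp_def)
  also have "\<dots> = distr M borel (\<gamma> t)"
    using t by (simp add: mult.assoc[symmetric] powr_add[symmetric])
  finally show ?thesis by simp
qed

end

section \<open>Maximal inequality\<close>

lemma (in levy_process) prob_past_future_interval:
  assumes "0 \<le> t" "E \<in> sets (incr I)" "F \<in> sets (incr J)" "I \<subseteq> {0..t}" "J \<subseteq> {t..}"
  shows "prob (E \<inter> F) = prob E * prob F"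
  using assms sets_incr_algebra_mono[of I "{0..t}" M X] sets_incr_algebra_mono[of J "{t..}" M X]
  by (intro prob_past_future[of t]) auto

lemma (in prob_space) lower_tail_tight:
  fixes Y :: "'a \<Rightarrow> real"
  assumes [measurable]: "random_variable borel Y" and "0 < \<delta>"
  shows "\<exists>k\<ge>0. 1 - \<delta> \<le> \<P>(\<omega> in M. - k \<le> Y \<omega>)"
proof -
  have "(\<lambda>n. \<P>(\<omega> in M. - real n \<le> Y \<omega>)) \<longlonglongrightarrow> prob (\<Union>n. {\<omega> \<in> space M. - real n \<le> Y \<omega>})"
    by (intro finite_Lim_measure_incseq) (auto simp: incseq_def)
  also have "(\<Union>n. {\<omega> \<in> space M. - real n \<le> Y \<omega>}) = space M"
  proof safe
    fix \<omega> assume "\<omega> \<in> space M"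
    moreover obtain n :: nat where "- Y \<omega> \<le> real n" using real_arch_simple by blast
    then have "- real n \<le> Y \<omega>" by simp
    ultimately show "\<omega> \<in> (\<Union>n. {\<omega> \<in> space M. - real n \<le> Y \<omega>})" by blast
  qed
  finally have "(\<lambda>n. \<P>(\<omega> in M. - real n \<le> Y \<omega>)) \<longlonglongrightarrow> 1" by (simp add: prob_space)
  then have "\<forall>\<^sub>F n in sequentially. 1 - \<delta> < \<P>(\<omega> in M. - real n \<le> Y \<omega>)"
    using assms(2) by (intro order_tendstoD) auto
  then obtain n where "1 - \<delta> < \<P>(\<omega> in M. - real n \<le> Y \<omega>)"
    by (auto simp: eventually_sequentially)
  then show ?thesis by (intro exI[of _ "real n"]) auto
qed

lemma measure_ge_eq_if_distr_eq:
  fixes Y :: "'a \<Rightarrow> real" and Z :: "'b \<Rightarrow> real"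
  assumes "distr M borel Y = distr N borel Z" "Y \<in> borel_measurable M" "Z \<in> borel_measurable N"
  shows "measure M {\<omega> \<in> space M. y \<le> Y \<omega>} = measure N {\<omega> \<in> space N. y \<le> Z \<omega>}"
proof -
  have "measure M {\<omega> \<in> space M. y \<le> Y \<omega>} = measure (distr M borel Y) {y..}"
    using assms by (subst measure_distr) (auto intro!: arg_cong[where f="measure M"])
  also have "\<dots> = measure N {\<omega> \<in> space N. y \<le> Z \<omega>}"
    unfolding assms(1) using assms by (subst measure_distr) (auto intro!: arg_cong[where f="measure N"])
  finally show ?thesis .
qed

context renormalized_stable
begin

lemma prob_scaling:
  assumes "0 < t"
  shows "\<P>(\<omega> in M. y * t powr (2 - \<rho>) \<le> \<gamma> t \<omega>) = \<P>(\<omega> in M. y \<le> \<gamma> 1 \<omega>)"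
proof -
  have "\<P>(\<omega> in M. y * t powr (2 - \<rho>) \<le> \<gamma> t \<omega>) = \<P>(\<omega> in M. y * t powr (2 - \<rho>) \<le> t powr (2 - \<rho>) * \<gamma> 1 \<omega>)"
    using assms by (intro measure_ge_eq_if_distr_eq distr_scaling) auto
  also have "\<dots> = \<P>(\<omega> in M. y \<le> \<gamma> 1 \<omega>)"
    using assms by (simp add: mult.commute[of y])
  finally show ?thesis .
qed

lemma random_variable_renorm_shift: "0 \<le> s \<Longrightarrow> (\<lambda>\<omega>. renorm t (shift s \<omega>)) \<in> borel_measurable M"
  by (rule measurable_compose[OF measurable_shift measurable_renorm])

lemma prob_renorm_shift:
  assumes "0 \<le> s" "0 \<le> t"
  shows "\<P>(\<omega> in M. y \<le> renorm t (shift s \<omega>)) = \<P>(\<omega> in M. y \<le> \<gamma> t \<omega>)"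
  using assms by (intro measure_ge_eq_if_distr_eq distr_renorm_shift random_variable_renorm_shift) auto

text \<open>Replaces \<open>\<gamma> t\<close>, only known to be measurable for \<open>M\<close>, by
  a version lying in \<open>incr {0..t}\<close>, as independence requires.\<close>

lemma renorm_shift_0:
  assumes "0 \<le> t"
  shows "AE \<omega> in M. renorm t (shift 0 \<omega>) = \<gamma> t \<omega>"
  using renorm_path_eq[OF assms] start_zero
  by eventually_elim (simp add: traj_def)

text \<open>Covers the last grid time in the maximal inequality, where no time remains and
  \<open>prob_scaling\<close> does not apply.\<close>

lemma \<gamma>_0: "AE \<omega> in M. \<gamma> 0 \<omega> = 0"
proof -
  have "path_occ F 0 x = 0" for F and x :: "real \<Rightarrow> 'a"
  proof -
    have "self_occ F y 0 = 0" for y :: "real \<Rightarrow> 'a"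
    proof -
      have "(LBINT s:{0}. (LBINT r:{0..s}. F (y s - y r))) = 0"
        unfolding set_lebesgue_integral_def by (intro integral_eq_zero_AE) (use AE_lborel_singleton[of 0] in eventually_elim, simp)
      then show ?thesis by (simp add: self_occ_def)
    qed
    then show ?thesis by (simp add: path_occ_def)
  qed
  moreover have "mean (eps k) 0 = 0" for k
  proof -
    have "mean (eps k) 0 = expectation (\<lambda>\<omega>. path_occ (rescale f (eps k)) 0 (traj X \<omega>))"
      unfolding mean_def by (intro Bochner_Integration.integral_cong) (auto simp: path_occ_path kernel_eps)
    with calculation show ?thesis by simp
  qed
  ultimately have "AE \<omega> in M. (\<lambda>k. 0) \<longlonglongrightarrow> \<gamma> 0 \<omega>"
    using renorm_path_tendsto[of 0] by simp
  then show ?thesis by eventually_elim (simp add: LIMSEQ_const_iff)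
qed

lemma renorm_shift_event:
  assumes "0 \<le> s" "s \<le> t"
  shows "{\<omega> \<in> space M. y \<le> renorm (t - s) (shift s \<omega>)} \<in> sets (incr {s..t})"
    "{\<omega> \<in> space M. y < renorm (t - s) (shift s \<omega>)} \<in> sets (incr {s..t})"
  using measurable_sets[OF measurable_renorm_shift[OF assms], of "{y..}"]
    measurable_sets[OF measurable_renorm_shift[OF assms], of "{y<..}"]
  by (simp_all add: vimage_def Int_def conj_commute)

text \<open>
  Ottaviani's argument: at the first grid time at which \<open>\<gamma>\<close> exceeds \<open>y\<close>, the increment up to
  \<open>T\<close> is independent of the past and not too negative with probability at least one half.
\<close>

lemma maximal_inequality_grid:
  "\<exists>K\<ge>0. \<forall>T>0. \<forall>y. \<forall>m>0.
     \<P>(\<omega> in M. \<exists>i\<le>m. y < \<gamma> (T * real i / real m) \<omega>) \<le>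
     2 * \<P>(\<omega> in M. y - K * T powr (2 - \<rho>) \<le> \<gamma> T \<omega>)"
proof -
  obtain K where K: "0 \<le> K" "\<And>t T. 0 \<le> t \<Longrightarrow> t \<le> T \<Longrightarrow>
     AE \<omega> in M. \<gamma> t \<omega> + renorm (T - t) (shift t \<omega>) - K * T powr (2 - \<rho>) \<le> \<gamma> T \<omega>"
    using superadditive by blast
  obtain k where k: "0 \<le> k" "1 - 1 / 2 \<le> \<P>(\<omega> in M. - k \<le> \<gamma> 1 \<omega>)"
    using lower_tail_tight[of "\<gamma> 1" "1 / 2"] by auto
  \<comment> \<open>The final constant combines the loss \<open>K\<close> from superadditivity with
    the drop \<open>k\<close> that the remaining increment is allowed.\<close>
  have "\<P>(\<omega> in M. \<exists>i\<le>m. y < \<gamma> (T * real i / real m) \<omega>) \<le>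
     2 * \<P>(\<omega> in M. y - (K + k) * T powr (2 - \<rho>) \<le> \<gamma> T \<omega>)"
    if T: "0 < T" and m: "0 < m" for T y :: real and m :: nat
  proof -
    define u where "u i = T * real i / real m" for i
    let ?S = "T powr (2 - \<rho>)" and ?inc = "\<lambda>i \<omega>. renorm (T - u i) (shift (u i) \<omega>)"
    let ?W = "{\<omega> \<in> space M. y - (K + k) * ?S \<le> \<gamma> T \<omega>}"
    have u: "0 \<le> u i" for i using T by (simp add: u_def)
    have uT: "u i \<le> T" if "i \<le> m" for i
      using that T m by (simp add: u_def divide_le_eq mult_left_mono)
    have umono: "u i \<le> u j" if "i \<le> j" for i j
      using that T by (simp add: u_def divide_right_mono mult_left_mono)
    define Y where "Y i \<omega> = renorm (u i) (shift 0 \<omega>)" for i \<omega>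
    define E where "E i = {\<omega> \<in> space M. y < Y i \<omega> \<and> (\<forall>j<i. \<not> y < Y j \<omega>)}" for i
    define H where "H i = {\<omega> \<in> space M. - k * ?S \<le> ?inc i \<omega>}" for i
    have Ym [measurable]: "Y i \<in> borel_measurable M" for i
      unfolding Y_def[abs_def] by (rule random_variable_renorm_shift) simp
    have Yae: "AE \<omega> in M. \<forall>i\<le>m. Y i \<omega> = \<gamma> (u i) \<omega>"
      using renorm_shift_0[OF u] by (simp add: AE_all_countable Y_def AE_conjI)
    have Ei: "E i \<in> sets (incr {0..u i})" for i
    proof -
      have "{\<omega> \<in> space M. y < Y j \<omega>} \<in> sets (incr {0..u i})" if "j \<le> i" for j
        using renorm_shift_event(2)[of 0 "u j" y] u[of j] sets_incr_algebra_mono[of "{0..u j}" "{0..u i}" M X] umono[OF that]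
        by (auto simp: Y_def)
      then have "{\<omega> \<in> space M. y < Y i \<omega>} - (\<Union>j<i. {\<omega> \<in> space M. y < Y j \<omega>}) \<in> sets (incr {0..u i})"
        by (intro sets.Diff sets.finite_UN) auto
      also have "{\<omega> \<in> space M. y < Y i \<omega>} - (\<Union>j<i. {\<omega> \<in> space M. y < Y j \<omega>}) = E i"
        by (auto simp: E_def)
      finally show ?thesis .
    qed
    have Em: "E i \<in> sets M" for i
      unfolding E_def by measurable
    have Hi: "H i \<in> sets (incr {u i..T})" if "i \<le> m" for i
      unfolding H_def using u uT[OF that] by (intro renorm_shift_event) auto
    have Hm: "H i \<in> sets M" for i
      unfolding H_def using random_variable_renorm_shift[OF u] by measurable
    have Hp: "1 / 2 \<le> prob (H i)" if "i \<le> m" for i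
    proof (cases "u i = T")
      case True
      have "AE \<omega> in M. - k * ?S \<le> \<gamma> 0 \<omega>"
        using \<gamma>_0 by eventually_elim (simp add: k(1))
      then have "\<P>(\<omega> in M. - k * ?S \<le> \<gamma> 0 \<omega>) = 1"
        by (subst prob_Collect_eq_1) auto
      moreover have "prob (H i) = \<P>(\<omega> in M. - k * ?S \<le> \<gamma> 0 \<omega>)"
        unfolding H_def True using T by (subst prob_renorm_shift[symmetric, of T 0]) auto
      ultimately show ?thesis by simp
    next
      case False
      then have lt: "0 < T - u i" using uT[OF that] by simp
      have "1 / 2 \<le> \<P>(\<omega> in M. - k \<le> \<gamma> 1 \<omega>)" using k by simp
      \<comment> \<open>Scaling moves the one-half bound from time 1 to the remaining time, and
        enlarging \<open>T - u i\<close> to \<open>T\<close> only weakens the threshold.\<close>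
      also have "\<dots> = \<P>(\<omega> in M. - k * (T - u i) powr (2 - \<rho>) \<le> \<gamma> (T - u i) \<omega>)"
        using prob_scaling[OF lt, of "- k"] by simp
      also have "\<dots> \<le> \<P>(\<omega> in M. - k * ?S \<le> \<gamma> (T - u i) \<omega>)"
      proof (intro finite_measure_mono)
        have "k * (T - u i) powr (2 - \<rho>) \<le> k * ?S"
          using k lt u[of i] \<rho>_bounds by (intro mult_left_mono powr_mono2) auto
        then show "{\<omega> \<in> space M. - k * (T - u i) powr (2 - \<rho>) \<le> \<gamma> (T - u i) \<omega>} \<subseteq> {\<omega> \<in> space M. - k * ?S \<le> \<gamma> (T - u i) \<omega>}"
          by auto
        have [measurable]: "\<gamma> (T - u i) \<in> borel_measurable M" using lt by (intro measurable_\<gamma>) simp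
        show "{\<omega> \<in> space M. - k * ?S \<le> \<gamma> (T - u i) \<omega>} \<in> sets M" by measurable
      qed
      also have "\<dots> = prob (H i)"
        unfolding H_def using lt u by (subst prob_renorm_shift) auto
      finally show ?thesis .
    qed
    have disj: "disjoint_family_on E {..m}"
      unfolding disjoint_family_on_def E_def by (auto, metis linorder_neqE_nat)
    have union: "(\<Union>i\<le>m. E i) = {\<omega> \<in> space M. \<exists>i\<le>m. y < Y i \<omega>}"
    proof (intro equalityI subsetI)
      fix \<omega> assume "\<omega> \<in> {\<omega> \<in> space M. \<exists>i\<le>m. y < Y i \<omega>}"
      then obtain i where i: "\<omega> \<in> space M" "i \<le> m" "y < Y i \<omega>" by blast
      define j where "j = (LEAST j. y < Y j \<omega>)"
      have "y < Y j \<omega>" "j \<le> i" "\<forall>l<j. \<not> y < Y l \<omega>"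
        unfolding j_def using i(3) by (auto intro: LeastI Least_le dest: not_less_Least)
      then show "\<omega> \<in> (\<Union>i\<le>m. E i)" using i by (auto simp: E_def)
    qed (auto simp: E_def)
    have "\<P>(\<omega> in M. \<exists>i\<le>m. y < \<gamma> (u i) \<omega>) = prob (\<Union>i\<le>m. E i)"
      unfolding union using u by (intro measure_eq_AE) (use Yae in eventually_elim, auto)
    also have "\<dots> = (\<Sum>i\<le>m. prob (E i))"
      using disj Em by (intro finite_measure_finite_Union) auto
    also have "\<dots> \<le> (\<Sum>i\<le>m. 2 * prob (E i \<inter> H i))"
    proof (intro sum_mono)
      fix i assume i: "i \<in> {..m}"
      have "prob (E i \<inter> H i) = prob (E i) * prob (H i)"
        using Ei Hi i u[of i] by (intro prob_past_future_interval[of "u i"]) auto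
      moreover have "prob (E i) * (1 / 2) \<le> prob (E i) * prob (H i)"
        using Hp i by (intro mult_left_mono) auto
      ultimately show "prob (E i) \<le> 2 * prob (E i \<inter> H i)" by simp
    qed
    also have "\<dots> = 2 * prob (\<Union>i\<le>m. E i \<inter> H i)"
      using disj Em Hm by (subst finite_measure_finite_Union)
        (auto simp: sum_distrib_left disjoint_family_on_def)
    also have "prob (\<Union>i\<le>m. E i \<inter> H i) \<le> \<P>(\<omega> in M. y - (K + k) * ?S \<le> \<gamma> T \<omega>)"
    proof (intro finite_measure_mono_AE)
      have "AE \<omega> in M. \<forall>i\<in>{..m}. \<gamma> (u i) \<omega> + ?inc i \<omega> - K * ?S \<le> \<gamma> T \<omega>"
        using K(2) u uT by (intro AE_finite_allI) auto
      with Yae show "AE \<omega> in M. \<omega> \<in> (\<Union>i\<le>m. E i \<inter> H i) \<longrightarrow> \<omega> \<in> ?W"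
      proof eventually_elim
        fix \<omega> assume *: "\<forall>i\<le>m. Y i \<omega> = \<gamma> (u i) \<omega>"
          "\<forall>i\<in>{..m}. \<gamma> (u i) \<omega> + ?inc i \<omega> - K * ?S \<le> \<gamma> T \<omega>"
        show "\<omega> \<in> (\<Union>i\<le>m. E i \<inter> H i) \<longrightarrow> \<omega> \<in> ?W"
        proof
          assume "\<omega> \<in> (\<Union>i\<le>m. E i \<inter> H i)"
          then obtain i where i: "i \<le> m" "\<omega> \<in> E i" "\<omega> \<in> H i" by blast
          have "y < \<gamma> (u i) \<omega>" "- k * ?S \<le> ?inc i \<omega>" "\<omega> \<in> space M"
            using i *(1) by (auto simp: E_def H_def)
          moreover have "\<gamma> (u i) \<omega> + ?inc i \<omega> - K * ?S \<le> \<gamma> T \<omega>"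
            using i *(2) by auto
          ultimately show "\<omega> \<in> ?W"
            by (simp add: distrib_right)
        qed
      qed
    qed (use T in auto)
    finally show ?thesis by (simp add: u_def)
  qed
  then show ?thesis using K(1) k(1) by (intro exI[of _ "K + k"]) auto
qed

text \<open>Stands for the event that the supremum of \<open>\<gamma>\<close> over [0, T] exceeds
  \<open>y\<close>. Paths of \<open>\<gamma>\<close> are continuous only almost surely, and the
  union over dyadic grids is measurable regardless.\<close>

definition exceed :: "real \<Rightarrow> real \<Rightarrow> 'w set" where
  "exceed T y = (\<Union>k. {\<omega> \<in> space M. \<exists>i\<le>2 ^ k. y < \<gamma> (T * real i / real (2 ^ k)) \<omega>})"

lemma exceed_level_measurable:
  "0 < T \<Longrightarrow> {\<omega> \<in> space M. \<exists>i\<le>2 ^ k. y < \<gamma> (T * real i / real (2 ^ k)) \<omega>} \<in> sets M"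
  by measurable auto

lemma exceed_measurable: "0 < T \<Longrightarrow> exceed T y \<in> sets M"
  unfolding exceed_def by (intro sets.countable_UN) (auto simp: exceed_level_measurable simp del: of_nat_power)

text \<open>The grid bound does not depend on the mesh, and dyadic grids are nested, so it passes to
  the increasing union.\<close>

lemma maximal_inequality:
  "\<exists>K\<ge>0. \<forall>T>0. \<forall>y. prob (exceed T y) \<le> 2 * \<P>(\<omega> in M. y - K * T powr (2 - \<rho>) \<le> \<gamma> T \<omega>)"
proof -
  obtain K where K: "0 \<le> K" "\<And>T y m. 0 < T \<Longrightarrow> 0 < m \<Longrightarrow>
     \<P>(\<omega> in M. \<exists>i\<le>m. y < \<gamma> (T * real i / real m) \<omega>) \<le>
     2 * \<P>(\<omega> in M. y - K * T powr (2 - \<rho>) \<le> \<gamma> T \<omega>)"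
    using maximal_inequality_grid by blast
  have "prob (exceed T y) \<le> 2 * \<P>(\<omega> in M. y - K * T powr (2 - \<rho>) \<le> \<gamma> T \<omega>)" if T: "0 < T" for T y
  proof -
    let ?S = "\<lambda>k. {\<omega> \<in> space M. \<exists>i\<le>2 ^ k. y < \<gamma> (T * real i / real (2 ^ k)) \<omega>}"
    have "incseq ?S"
    proof (rule incseq_SucI, safe)
      fix k \<omega> i assume "\<omega> \<in> space M" "i \<le> 2 ^ k" "y < \<gamma> (T * real i / real (2 ^ k)) \<omega>"
      then show "\<exists>j\<le>2 ^ Suc k. y < \<gamma> (T * real j / real (2 ^ Suc k)) \<omega>"
        by (intro exI[of _ "2 * i"]) simp
    qed
    then have "(\<lambda>k. prob (?S k)) \<longlonglongrightarrow> prob (exceed T y)"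
      unfolding exceed_def by (rule finite_Lim_measure_incseq[rotated]) (use exceed_level_measurable[OF T] in blast)
    moreover have "prob (?S k) \<le> 2 * \<P>(\<omega> in M. y - K * T powr (2 - \<rho>) \<le> \<gamma> T \<omega>)" for k
      by (rule K(2)[OF T]) simp
    ultimately show ?thesis
      by (intro LIMSEQ_le_const2) blast+
  qed
  with K(1) show ?thesis by blast
qed

lemma dyadic_approx:
  fixes t T :: real
  assumes "0 \<le> t" "t \<le> T" "0 < T"
  shows "(\<lambda>k. T * real (nat \<lfloor>2 ^ k * t / T\<rfloor>) / real (2 ^ k)) \<longlonglongrightarrow> t" "nat \<lfloor>2 ^ k * t / T\<rfloor> \<le> 2 ^ k"
proof -
  let ?N = "\<lambda>k::nat. real (nat \<lfloor>2 ^ k * t / T\<rfloor>)"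
  have nn: "0 \<le> 2 ^ k * t / T" for k :: nat using assms by simp
  have fl: "?N k = real_of_int \<lfloor>2 ^ k * t / T\<rfloor>" for k :: nat
    using nn[of k] by simp
  have "2 ^ k * t / T \<le> 2 ^ k" using assms by (simp add: divide_le_eq mult_left_mono)
  then have "?N k \<le> 2 ^ k"
    unfolding fl by linarith
  then have "?N k \<le> real (2 ^ k)" by simp
  then show "nat \<lfloor>2 ^ k * t / T\<rfloor> \<le> 2 ^ k" by (simp only: of_nat_le_iff)
  have up: "T * ?N k / real (2 ^ k) \<le> t" for k :: nat
  proof -
    have "T * ?N k \<le> T * (2 ^ k * t / T)"
      unfolding fl using assms by (intro mult_left_mono of_int_floor_le) auto
    then show ?thesis using assms by (simp add: divide_le_eq mult.commute)
  qed
  have low: "t - T / 2 ^ k \<le> T * ?N k / real (2 ^ k)" for k :: nat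
  proof -
    have "T * (2 ^ k * t / T - 1) \<le> T * ?N k"
      unfolding fl using assms by (intro mult_left_mono) linarith+
    then have "2 ^ k * t - T \<le> T * ?N k"
      using assms by (simp add: right_diff_distrib)
    then have "(2 ^ k * t - T) / 2 ^ k \<le> T * ?N k / 2 ^ k"
      by (rule divide_right_mono) simp
    then show ?thesis by (simp add: diff_divide_distrib)
  qed
  show "(\<lambda>k. T * ?N k / real (2 ^ k)) \<longlonglongrightarrow> t"
  proof (rule tendsto_sandwich)
    show "\<forall>\<^sub>F k in sequentially. t - T / 2 ^ k \<le> T * ?N k / real (2 ^ k)"
      by (intro always_eventually allI low)
    show "\<forall>\<^sub>F k in sequentially. T * ?N k / real (2 ^ k) \<le> t"
      by (intro always_eventually allI up)
    have "(\<lambda>k. t - T / 2 ^ k) \<longlonglongrightarrow> t - 0"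
      by (intro tendsto_intros LIMSEQ_divide_realpow_zero) simp
    then show "(\<lambda>k. t - T / 2 ^ k) \<longlonglongrightarrow> t" by simp
  qed (rule tendsto_const)
qed

text \<open>The exceptional null set comes from continuity alone, hence one null set serves all
  \<open>T\<close> and \<open>y\<close>; dyadic times approximate every \<open>t\<close>.\<close>

lemma not_exceed:
  "AE \<omega> in M. \<forall>T>0. \<forall>y. \<omega> \<notin> exceed T y \<longrightarrow> (\<forall>t\<in>{0..T}. \<gamma> t \<omega> \<le> y)"
proof -
  have "AE \<omega> in M. continuous_on {0..} (\<lambda>t. \<gamma> t \<omega>)"
    using local_time by (simp add: renormalized_self_intersection_local_time_def)
  with AE_space show ?thesis
  proof eventually_elim
    fix \<omega> assume \<omega>: "\<omega> \<in> space M" and cont: "continuous_on {0..} (\<lambda>t. \<gamma> t \<omega>)"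
    show "\<forall>T>0. \<forall>y. \<omega> \<notin> exceed T y \<longrightarrow> (\<forall>t\<in>{0..T}. \<gamma> t \<omega> \<le> y)"
    proof (intro allI impI ballI)
      fix T y t :: real assume T: "0 < T" and ne: "\<omega> \<notin> exceed T y" and t: "t \<in> {0..T}"
      let ?u = "\<lambda>k. T * real (nat \<lfloor>2 ^ k * t / T\<rfloor>) / real (2 ^ k)"
      have "(\<lambda>k. \<gamma> (?u k) \<omega>) \<longlonglongrightarrow> \<gamma> t \<omega>"
        using t T dyadic_approx(1)[of t T] by (intro continuous_on_tendsto_compose[OF cont]) auto
      moreover have "\<gamma> (?u k) \<omega> \<le> y" for k
      proof -
        have "\<forall>k i. i \<le> 2 ^ k \<longrightarrow> \<gamma> (T * real i / real (2 ^ k)) \<omega> \<le> y"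
          using ne \<omega> unfolding exceed_def by (auto simp del: of_nat_power simp: not_less)
        then show ?thesis using dyadic_approx(2)[of t T k] t T by (metis atLeastAtMost_iff)
      qed
      ultimately show "\<gamma> t \<omega> \<le> y" by (intro LIMSEQ_le_const2) auto
    qed
  qed
qed

end

section \<open>The law of the iterated logarithm\<close>

text \<open>
  The union of the \<open>A n \<inter> B n\<close> is decomposed according to the last \<open>n\<close> at which \<open>B n\<close> occurs:
  that event is determined by the increments after \<open>T n\<close>, hence independent of \<open>A n\<close>.
\<close>

lemma (in levy_process) borel_cantelli_past_future:
  assumes T: "\<And>n. 0 \<le> T n" "\<And>n. T n \<le> T (Suc n)"
    and A: "\<And>n. A n \<in> sets (incr {0..T n})" "\<And>n. 1 - \<delta> \<le> prob (A n)"
    and B: "\<And>n. B n \<in> sets (incr {T n..T (Suc n)})" "\<not> summable (\<lambda>n. prob (B n))"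
    and \<delta>: "\<delta> \<le> 1"
  shows "1 - \<delta> \<le> prob (\<Union>n\<in>{m..}. A n \<inter> B n)"
proof -
  have inc: "sets (incr I) \<subseteq> sets M" if "I \<subseteq> {0..}" for I
    using that by (rule sets_incr_algebra_subset)
  have Tmono: "T i \<le> T j" if "i \<le> j" for i j
    by (rule lift_Suc_mono_le[of T, OF T(2) that])
  have Am: "A n \<in> sets M" for n using A(1) inc[of "{0..T n}"] by auto
  have Bm: "B n \<in> sets M" for n using B(1)[of n] inc[of "{T n..T (Suc n)}"] T(1)[of n] by auto
  define C where "C i d = (\<Union>n\<in>{i..<i + d}. B n)" for i d
  define V where "V i d = (\<Union>n\<in>{i..<i + d}. A n \<inter> B n)" for i d
  have C_Suc: "C i (Suc d) = B i \<union> C (Suc i) d" and V_Suc: "V i (Suc d) = (A i \<inter> B i) \<union> V (Suc i) d" for i d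
  proof -
    have "{i..<i + Suc d} = insert i {Suc i..<Suc i + d}" by auto
    then show "C i (Suc d) = B i \<union> C (Suc i) d" "V i (Suc d) = (A i \<inter> B i) \<union> V (Suc i) d"
      by (auto simp: C_def V_def)
  qed
  have CT: "C i d \<in> sets (incr {T i..})" for i d
  proof -
    have "B n \<in> sets (incr {T i..})" if "i \<le> n" for n
      using B(1)[of n] sets_incr_algebra_mono[of "{T n..T (Suc n)}" "{T i..}" M X] Tmono[OF that] by auto
    then show ?thesis unfolding C_def by (intro sets.finite_UN) auto
  qed
  have Cm: "C i d \<in> sets M" and Vm: "V i d \<in> sets M" for i d
    using Am Bm by (auto simp: C_def V_def)
  have V_C: "(1 - \<delta>) * prob (C i d) \<le> prob (V i d)" for i d
  proof (induction d arbitrary: i)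
    case 0
    then show ?case by (simp add: C_def V_def)
  next
    case (Suc d)
    \<comment> \<open>\<open>B i\<close> occurs and nothing later in the finite window does. Peeling
      off the earliest index keeps this event after \<open>T i\<close>, and makes it disjoint from
      \<open>V (Suc i) d\<close>, so the probabilities add.\<close>
    let ?R = "B i - C (Suc i) d"
    have "B i \<in> sets (incr {T i..})"
      using B(1)[of i] sets_incr_algebra_mono[of "{T i..T (Suc i)}" "{T i..}" M X] by auto
    moreover have "C (Suc i) d \<in> sets (incr {T i..})"
      using CT[of "Suc i" d] sets_incr_algebra_mono[of "{T (Suc i)..}" "{T i..}" M X] T(2)[of i] by auto
    ultimately have "?R \<in> sets (incr {T i..})" by (rule sets.Diff)
    then have "prob (A i \<inter> ?R) = prob (A i) * prob ?R"
      using A(1) T(1) by (intro prob_past_future)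
    then have R: "(1 - \<delta>) * prob ?R \<le> prob (A i \<inter> ?R)"
      using A(2) by (simp add: mult_right_mono)
    have "prob (C i (Suc d)) = prob (C (Suc i) d) + prob ?R"
      unfolding C_Suc by (subst Un_commute, rule finite_measure_Union'[OF Cm Bm])
    then have "(1 - \<delta>) * prob (C i (Suc d)) \<le> prob (V (Suc i) d) + prob (A i \<inter> ?R)"
      using Suc.IH[of "Suc i"] R by (simp add: distrib_left)
    also have "\<dots> = prob (V (Suc i) d \<union> (A i \<inter> ?R))"
      using Vm Am Bm Cm by (intro finite_measure_Union[symmetric]) (auto simp: C_def V_def)
    also have "\<dots> \<le> prob (V i (Suc d))"
      by (intro finite_measure_mono Vm) (auto simp: V_Suc)
    finally show ?case .
  qed
  \<comment> \<open>The second Borel-Cantelli argument: the events come from consecutive intervals,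
    so the complements multiply, and 1 - x <= e^(-x).\<close>
  have nC: "prob (space M - C i d) \<le> exp (- (\<Sum>n\<in>{i..<i + d}. prob (B n)))" for i d
  proof (induction d arbitrary: i)
    case 0
    then show ?case by (simp add: C_def)
  next
    case (Suc d)
    have "space M - C i (Suc d) = (space M - B i) \<inter> (space M - C (Suc i) d)"
      by (auto simp: C_Suc)
    moreover have "space M - B i \<in> sets (incr {T i..T (Suc i)})"
      using sets.compl_sets[OF B(1)[of i]] by simp
    moreover have "space M - C (Suc i) d \<in> sets (incr {T (Suc i)..})"
      using sets.compl_sets[OF CT[of "Suc i" d]] by simp
    ultimately have "prob (space M - C i (Suc d)) = prob (space M - B i) * prob (space M - C (Suc i) d)"
      using T(1)[of i] T(1)[of "Suc i"] by (simp add: prob_past_future_interval[of "T (Suc i)" _ "{T i..T (Suc i)}" _ "{T (Suc i)..}"])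
    also have "\<dots> \<le> exp (- prob (B i)) * exp (- (\<Sum>n\<in>{Suc i..<Suc i + d}. prob (B n)))"
      using exp_ge_add_one_self[of "- prob (B i)"] Bm by (intro mult_mono Suc.IH) (auto simp: prob_compl)
    also have "\<dots> = exp (- (\<Sum>n\<in>{i..<i + Suc d}. prob (B n)))"
    proof -
      have "{i..<i + Suc d} = insert i {Suc i..<Suc i + d}" by auto
      then have "(\<Sum>n\<in>{i..<i + Suc d}. prob (B n)) = prob (B i) + (\<Sum>n\<in>{Suc i..<Suc i + d}. prob (B n))" by simp
      then show ?thesis by (simp add: exp_add[symmetric])
    qed
    finally show ?case .
  qed
  let ?U = "\<Union>n\<in>{m..}. A n \<inter> B n"
  have le: "(1 - \<delta>) * (1 - exp (- (\<Sum>n<d. prob (B (n + m))))) \<le> prob ?U" for d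
  proof -
    have "(\<Sum>n<d. prob (B (n + m))) = (\<Sum>n\<in>{m..<m + d}. prob (B n))"
      by (rule sum.reindex_bij_witness[of _ "\<lambda>n. n - m" "\<lambda>n. n + m"]) auto
    then have "1 - exp (- (\<Sum>n<d. prob (B (n + m)))) \<le> prob (C m d)"
      using nC[of m d] prob_compl[OF Cm[of m d]] by simp
    then have "(1 - \<delta>) * (1 - exp (- (\<Sum>n<d. prob (B (n + m))))) \<le> (1 - \<delta>) * prob (C m d)"
      using \<delta> by (intro mult_left_mono) auto
    also have "\<dots> \<le> prob (V m d)" by (rule V_C)
    also have "\<dots> \<le> prob ?U"
      using Am Bm by (intro finite_measure_mono) (auto simp: V_def)
    finally show ?thesis .
  qed
  have "\<not> summable (\<lambda>n. prob (B (n + m)))"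
    using B(2) summable_iff_shift[of "\<lambda>n. prob (B n)" m] by simp
  then have "filterlim (\<lambda>d. \<Sum>n<d. prob (B (n + m))) at_top sequentially"
  proof -
    assume ns: "\<not> summable (\<lambda>n. prob (B (n + m)))"
    show ?thesis
      unfolding filterlim_at_top
    proof
      fix Z
      have "\<exists>d. Z \<le> (\<Sum>n<d. prob (B (n + m)))"
      proof (rule ccontr)
        assume "\<not> ?thesis"
        then have lt: "(\<Sum>n<d. prob (B (n + m))) < Z" for d by (simp add: not_le)
        have "summable (\<lambda>n. prob (B (n + m)))"
        proof (rule bounded_imp_summable[where B=Z])
          show "(\<Sum>k\<le>n. prob (B (k + m))) \<le> Z" for n
            using lt[of "Suc n"] by (simp only: lessThan_Suc_atMost less_imp_le)
        qed simp
        with ns show False by simp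
      qed
      then obtain d where "Z \<le> (\<Sum>n<d. prob (B (n + m)))" ..
      moreover have "(\<Sum>n<d. prob (B (n + m))) \<le> (\<Sum>n<e. prob (B (n + m)))" if "d \<le> e" for e
        using that by (intro sum_mono2) auto
      ultimately show "\<forall>\<^sub>F d in sequentially. Z \<le> (\<Sum>n<d. prob (B (n + m)))"
        by (intro eventually_sequentiallyI[of d]) (meson order_trans)
    qed
  qed
  then have "(\<lambda>d. exp (- (\<Sum>n<d. prob (B (n + m))))) \<longlonglongrightarrow> 0"
    by (intro filterlim_compose[OF exp_at_bot] filterlim_compose[OF filterlim_uminus_at_bot_at_top])
  then have "(\<lambda>d. (1 - \<delta>) * (1 - exp (- (\<Sum>n<d. prob (B (n + m)))))) \<longlonglongrightarrow> (1 - \<delta>) * (1 - 0)"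
    by (intro tendsto_mult tendsto_diff tendsto_const)
  then have "(1 - \<delta>) * (1 - 0) \<le> prob ?U"
    by (rule LIMSEQ_le_const2) (use le in blast)
  then show ?thesis by simp
qed

lemma powr_less_iff_base:
  fixes p q r :: real
  assumes "0 \<le> p" "0 \<le> q" "0 < r"
  shows "p powr r < q powr r \<longleftrightarrow> p < q"
  using assms powr_less_mono2[of r p q] powr_less_mono2[of r q p]
  by (cases p q rule: linorder_cases) auto

lemma filterlim_power_at_top:
  fixes x :: real
  assumes "1 < x"
  shows "filterlim (\<lambda>n. x ^ n) at_top sequentially"
  unfolding filterlim_at_top
proof
  fix Z
  obtain n where "Z < x ^ n" using real_arch_pow[OF assms] by blast
  then show "\<forall>\<^sub>F n in sequentially. Z \<le> x ^ n"
    using assms by (intro eventually_sequentiallyI[of n]) (meson less_imp_le less_le_trans power_increasing)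
qed

section \<open>Tail of the local time at time 1 and the normalizing function\<close>

locale renormalized_stable_ldp = renormalized_stable M X \<beta> \<psi> f \<gamma>
  for M :: "'w measure" and X :: "real \<Rightarrow> 'w \<Rightarrow> 'a::euclidean_space" and \<beta> \<psi> f \<gamma> +
  fixes a :: real
  assumes a_pos: "0 < a"
    and ldp: "((\<lambda>t. ln (\<P>(\<omega> in M. t\<^sup>2 \<le> \<gamma> t \<omega>)) / t) \<longlongrightarrow> - a) at_top"
begin

text \<open>The power \<open>\<rho>\<close> in the threshold makes the logarithm of the tail
  asymptotically linear, with slope \<open>- a\<close>.\<close>

definition tail :: "real \<Rightarrow> real" where
  "tail t = \<P>(\<omega> in M. t powr \<rho> \<le> \<gamma> 1 \<omega>)"

lemma tail_tendsto: "((\<lambda>t. ln (tail t) / t) \<longlongrightarrow> - a) at_top"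
proof (rule Lim_transform_eventually[OF ldp])
  show "\<forall>\<^sub>F t in at_top. ln (\<P>(\<omega> in M. t\<^sup>2 \<le> \<gamma> t \<omega>)) / t = ln (tail t) / t"
    using eventually_gt_at_top[of "0::real"]
  proof eventually_elim
    fix t :: real assume t: "0 < t"
    have "t\<^sup>2 = t powr \<rho> * t powr (2 - \<rho>)"
      using t by (simp add: powr_add[symmetric] powr_numeral)
    then show "ln (\<P>(\<omega> in M. t\<^sup>2 \<le> \<gamma> t \<omega>)) / t = ln (tail t) / t"
      using prob_scaling[OF t, of "t powr \<rho>"] by (simp add: tail_def)
  qed
qed

lemma tail_upper:
  assumes "a' < a"
  shows "\<forall>\<^sub>F t in at_top. tail t \<le> exp (- (a' * t))"
proof -
  have "\<forall>\<^sub>F t in at_top. ln (tail t) / t < - a'"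
    using assms by (intro order_tendstoD(2)[OF tail_tendsto]) simp
  then show ?thesis
    using eventually_gt_at_top[of "0::real"]
  proof eventually_elim
    fix t :: real assume t: "ln (tail t) / t < - a'" "0 < t"
    show "tail t \<le> exp (- (a' * t))"
    \<comment> \<open>Since \<open>ln 0 = 0\<close>, the logarithmic bound carries no information
      about a vanishing tail, but the claim is then trivial.\<close>
    proof (cases "tail t = 0")
      case False
      then have pos: "0 < tail t" by (simp add: tail_def less_le)
      have "ln (tail t) < - (a' * t)" using t by (simp add: divide_less_eq)
      then have "exp (ln (tail t)) \<le> exp (- (a' * t))" by simp
      then show ?thesis using pos by simp
    qed simp
  qed
qed

lemma tail_lower:
  assumes "a < a'"
  shows "\<forall>\<^sub>F t in at_top. exp (- (a' * t)) \<le> tail t"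
proof -
  have "\<forall>\<^sub>F t in at_top. - a' < ln (tail t) / t" "\<forall>\<^sub>F t in at_top. ln (tail t) / t < 0"
    using assms a_pos by (auto intro!: order_tendstoD[OF tail_tendsto])
  then show ?thesis
    using eventually_gt_at_top[of "0::real"]
  proof eventually_elim
    fix t :: real assume t: "- a' < ln (tail t) / t" "ln (tail t) / t < 0" "0 < t"
    \<comment> \<open>A zero tail would have logarithm \<open>ln 0 = 0\<close>, contradicting the
      negative quotient.\<close>
    have "tail t \<noteq> 0" using t(2) by auto
    then have pos: "0 < tail t" by (simp add: tail_def less_le)
    have "- (a' * t) < ln (tail t)" using t by (simp add: less_divide_eq)
    then have "exp (- (a' * t)) \<le> exp (ln (tail t))" by simp
    then show "exp (- (a' * t)) \<le> tail t" using pos by simp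
  qed
qed

definition rate :: "real \<Rightarrow> real" where
  "rate t = t powr (2 - \<rho>) * ln (ln t) powr \<rho>"

lemma filterlim_ln_ln: "filterlim (\<lambda>t::real. ln (ln t)) at_top at_top"
  by (intro filterlim_compose[OF ln_at_top ln_at_top])

lemma filterlim_ln_ln_powr: "filterlim (\<lambda>t::real. ln (ln t) powr \<rho>) at_top at_top"
  using \<rho>_bounds(1) by (intro filterlim_compose[OF _ filterlim_ln_ln] real_powr_at_top)

lemma ln_ln_mult_le:
  fixes \<theta> t :: real
  assumes "1 < \<theta>" "\<theta> \<le> t" "exp 1 < t"
  shows "ln (ln (\<theta> * t)) \<le> ln 2 + ln (ln t)"
proof -
  have t: "0 < t" "1 < t" "0 < ln t" using assms by (auto intro: less_trans[of 0] simp: less_trans[of 1 \<theta> t])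
  have "ln (\<theta> * t) \<le> ln (t * t)" using assms t by (subst ln_le_cancel_iff) auto
  also have "\<dots> = 2 * ln t" using t by (simp add: ln_mult)
  finally have le: "ln (\<theta> * t) \<le> 2 * ln t" .
  have "0 < ln (\<theta> * t)" using assms t by (intro ln_gt_zero) (simp add: less_1_mult)
  then have "ln (ln (\<theta> * t)) \<le> ln (2 * ln t)" using le t by (subst ln_le_cancel_iff) auto
  also have "\<dots> = ln 2 + ln (ln t)" using t by (simp add: ln_mult)
  finally show ?thesis .
qed

text \<open>The iterated logarithms at \<open>t\<close> and \<open>\<theta> * t\<close> differ by at
  most \<open>ln 2\<close>, so their ratio tends to 1 and only the power factor
  \<open>\<theta> powr (2 - \<rho>)\<close> survives.\<close>

lemma rate_mult_le:
  assumes \<theta>: "1 < \<theta>" and c: "\<theta> powr (2 - \<rho>) < c"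
  shows "\<forall>\<^sub>F t in at_top. rate (\<theta> * t) \<le> c * rate t"
proof -
  have "((\<lambda>t::real. ln 2 / ln (ln t)) \<longlongrightarrow> 0) at_top"
    by (rule real_tendsto_divide_at_top[OF tendsto_const filterlim_ln_ln])
  then have "((\<lambda>t. \<theta> powr (2 - \<rho>) * (1 + ln 2 / ln (ln t)) powr \<rho>) \<longlongrightarrow> \<theta> powr (2 - \<rho>) * (1 + 0) powr \<rho>) at_top"
    by (intro tendsto_mult tendsto_const tendsto_powr tendsto_add) auto
  then have "\<forall>\<^sub>F t in at_top. \<theta> powr (2 - \<rho>) * (1 + ln 2 / ln (ln t)) powr \<rho> < c"
    using c by (intro order_tendstoD) auto
  then show ?thesis
    using eventually_gt_at_top[of "exp 1"] eventually_ge_at_top[of \<theta>]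
      filterlim_at_top_dense[THEN iffD1, OF filterlim_ln_ln, rule_format, of 0]
  proof eventually_elim
    fix t :: real
    assume t: "\<theta> powr (2 - \<rho>) * (1 + ln 2 / ln (ln t)) powr \<rho> < c" "exp 1 < t" "\<theta> \<le> t" "0 < ln (ln t)"
    have t0: "0 < t" using \<theta> t(3) by linarith
    have "1 * t \<le> \<theta> * t" using \<theta> t0 by (intro mult_right_mono) auto
    then have "t \<le> \<theta> * t" by simp
    then have "ln t \<le> ln (\<theta> * t)" using t0 \<theta> by (subst ln_le_cancel_iff) auto
    moreover have "0 < ln t" using t(2) by (smt (verit) ln_exp ln_less_cancel_iff exp_gt_zero)
    ultimately have "ln (ln t) \<le> ln (ln (\<theta> * t))" by (subst ln_le_cancel_iff) auto
    then have "0 \<le> ln (ln (\<theta> * t))" using t(4) by linarith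
    then have "ln (ln (\<theta> * t)) powr \<rho> \<le> (ln 2 + ln (ln t)) powr \<rho>"
      using ln_ln_mult_le[OF \<theta> t(3,2)] \<rho>_bounds by (intro powr_mono2) auto
    also have "ln 2 + ln (ln t) = (1 + ln 2 / ln (ln t)) * ln (ln t)"
      using t(4) by (simp add: field_simps)
    also have "((1 + ln 2 / ln (ln t)) * ln (ln t)) powr \<rho> = (1 + ln 2 / ln (ln t)) powr \<rho> * ln (ln t) powr \<rho>"
      using t(4) by (intro powr_mult) 
    finally have "rate (\<theta> * t) \<le> (\<theta> * t) powr (2 - \<rho>) * ((1 + ln 2 / ln (ln t)) powr \<rho> * ln (ln t) powr \<rho>)"
      unfolding rate_def by (intro mult_left_mono) auto
    also have "\<dots> = (\<theta> powr (2 - \<rho>) * (1 + ln 2 / ln (ln t)) powr \<rho>) * rate t"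
      using \<theta> t0 by (simp add: rate_def powr_mult mult_ac)
    also have "\<dots> \<le> c * rate t"
      using t(1) by (intro mult_right_mono) (auto simp: rate_def)
    finally show "rate (\<theta> * t) \<le> c * rate t" .
  qed
qed

lemma rate_mono: "exp 1 < s \<Longrightarrow> s \<le> t \<Longrightarrow> rate s \<le> rate t"
proof -
  assume s: "exp 1 < s" "s \<le> t"
  have s0: "0 < s" "1 < ln s" using s(1) by (auto intro: less_trans[OF exp_gt_zero]) (metis exp_gt_zero ln_exp ln_less_cancel_iff less_trans)
  have "1 < s" using s(1) by (rule less_trans[rotated]) simp
  have "ln s \<le> ln t" using s s0 by (subst ln_le_cancel_iff) auto
  then have "ln (ln s) \<le> ln (ln t)" using \<open>1 < s\<close> s(2) by (subst ln_le_cancel_iff) auto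
  moreover have "0 < ln (ln s)" using s0(2) by (rule ln_gt_zero)
  ultimately show "rate s \<le> rate t"
    unfolding rate_def using s s0 \<rho>_bounds by (intro mult_mono powr_mono2) auto
qed

text \<open>Translates the critical level into the critical exponent: at level \<open>l\<close>
  along a geometric sequence the probabilities behave like n^(-q) with \<open>q\<close> near
  \<open>a * l powr (1 / \<rho>)\<close>, and 1 separates summable from divergent.\<close>

lemma powr_\<rho>_bounds:
  assumes "0 < l"
  shows "a powr (- \<rho>) < l \<longleftrightarrow> 1 < a * l powr (1 / \<rho>)" "l < a powr (- \<rho>) \<longleftrightarrow> a * l powr (1 / \<rho>) < 1"
proof -
  have "(a powr (- \<rho>)) powr (1 / \<rho>) = a powr (- 1)"
    using \<rho>_bounds by (simp only: powr_powr) simp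
  then have inv: "(a powr (- \<rho>)) powr (1 / \<rho>) = 1 / a"
    using a_pos by (simp add: powr_minus_divide)
  have "a powr (- \<rho>) < l \<longleftrightarrow> (a powr (- \<rho>)) powr (1 / \<rho>) < l powr (1 / \<rho>)"
    using assms \<rho>_bounds by (intro powr_less_iff_base[symmetric]) auto
  then show "a powr (- \<rho>) < l \<longleftrightarrow> 1 < a * l powr (1 / \<rho>)"
    unfolding inv using a_pos by (simp add: divide_less_eq mult.commute)
  have "l < a powr (- \<rho>) \<longleftrightarrow> l powr (1 / \<rho>) < (a powr (- \<rho>)) powr (1 / \<rho>)"
    using assms \<rho>_bounds by (intro powr_less_iff_base[symmetric]) auto
  then show "l < a powr (- \<rho>) \<longleftrightarrow> a * l powr (1 / \<rho>) < 1"
    unfolding inv using a_pos by (simp add: less_divide_eq mult.commute)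
qed

lemma prob_ge_eq_tail:
  assumes "0 < l" "0 < ln (ln t)"
  shows "\<P>(\<omega> in M. l * ln (ln t) powr \<rho> \<le> \<gamma> 1 \<omega>) = tail (l powr (1 / \<rho>) * ln (ln t))"
  using assms \<rho>_bounds by (simp add: tail_def powr_mult powr_powr)

section \<open>Upper bound\<close>

lemma exceed_probability:
  assumes l: "a powr (- \<rho>) < l"
  shows "\<exists>q>1. \<forall>\<^sub>F T in at_top. prob (exceed T (l * rate T)) \<le> 2 * ln T powr (- q)"
proof -
  \<comment> \<open>The gap \<open>l - l'\<close> absorbs the additive loss \<open>K\<close> of the
    maximal inequality, because the iterated logarithm is unbounded.\<close>
  obtain l' where l': "a powr (- \<rho>) < l'" "l' < l" using dense[OF l] by blast
  have l'0: "0 < l'" using l'(1) by (rule le_less_trans[OF powr_ge_zero])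
  define s where "s = l' powr (1 / \<rho>)"
  have s: "0 < s" "1 < a * s" using l'0 l'(1) powr_\<rho>_bounds(1)[OF l'0] by (auto simp: s_def)
  then have "1 / s < a" by (simp add: divide_less_eq)
  \<comment> \<open>Below \<open>a\<close>, so that the upper tail estimate holds, yet above
    \<open>1 / s\<close>, so that \<open>q = a' * s\<close> exceeds 1.\<close>
  then obtain a' where a': "1 / s < a'" "a' < a" using dense by blast
  define q where "q = a' * s"
  have q: "1 < q" using a'(1) s(1) by (simp add: q_def divide_less_eq)
  obtain K where K: "0 \<le> K" "\<And>T y. 0 < T \<Longrightarrow> prob (exceed T y) \<le> 2 * \<P>(\<omega> in M. y - K * T powr (2 - \<rho>) \<le> \<gamma> T \<omega>)"
    using maximal_inequality by blast
  have "filterlim (\<lambda>T. s * ln (ln T)) at_top at_top"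
    using s(1) by (intro filterlim_tendsto_pos_mult_at_top[OF tendsto_const _ filterlim_ln_ln])
  from eventually_compose_filterlim[OF tail_upper[OF a'(2)] this]
  have "\<forall>\<^sub>F T in at_top. tail (s * ln (ln T)) \<le> exp (- (a' * (s * ln (ln T))))" .
  moreover have "\<forall>\<^sub>F T in at_top. K / (l - l') \<le> ln (ln T) powr \<rho>"
    using filterlim_ln_ln_powr by (simp add: filterlim_at_top)
  moreover have "\<forall>\<^sub>F T::real in at_top. 0 < ln (ln T)"
    using filterlim_ln_ln by (simp add: filterlim_at_top_dense)
  ultimately have "\<forall>\<^sub>F T in at_top. prob (exceed T (l * rate T)) \<le> 2 * ln T powr (- q)"
    using eventually_gt_at_top[of "1::real"]
  proof eventually_elim
    fix T :: real
    assume T: "tail (s * ln (ln T)) \<le> exp (- (a' * (s * ln (ln T))))" "K / (l - l') \<le> ln (ln T) powr \<rho>" "0 < ln (ln T)" "1 < T"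
    have lnT: "0 < ln T" using T(4) by (rule ln_gt_zero)
    have "prob (exceed T (l * rate T)) \<le> 2 * \<P>(\<omega> in M. l * rate T - K * T powr (2 - \<rho>) \<le> \<gamma> T \<omega>)"
      using T(4) by (intro K(2)) simp
    also have "\<P>(\<omega> in M. l * rate T - K * T powr (2 - \<rho>) \<le> \<gamma> T \<omega>) = \<P>(\<omega> in M. l * ln (ln T) powr \<rho> - K \<le> \<gamma> 1 \<omega>)"
    proof -
      have "l * rate T - K * T powr (2 - \<rho>) = (l * ln (ln T) powr \<rho> - K) * T powr (2 - \<rho>)"
        by (simp add: rate_def algebra_simps)
      then show ?thesis using prob_scaling[of T "l * ln (ln T) powr \<rho> - K"] T(4) by simp
    qed
    also have "\<dots> \<le> \<P>(\<omega> in M. l' * ln (ln T) powr \<rho> \<le> \<gamma> 1 \<omega>)"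
    proof (intro finite_measure_mono)
      have "K \<le> (l - l') * ln (ln T) powr \<rho>" using T(2) l'(2) by (simp add: divide_le_eq mult.commute)
      then show "{\<omega> \<in> space M. l * ln (ln T) powr \<rho> - K \<le> \<gamma> 1 \<omega>} \<subseteq> {\<omega> \<in> space M. l' * ln (ln T) powr \<rho> \<le> \<gamma> 1 \<omega>}"
        by (auto simp: left_diff_distrib)
    qed simp
    also have "\<dots> = tail (s * ln (ln T))"
      unfolding s_def using l'0 T(3) by (rule prob_ge_eq_tail)
    also have "\<dots> \<le> exp (- (a' * (s * ln (ln T))))" by (rule T(1))
    also have "\<dots> = ln T powr (- q)" using lnT by (simp add: powr_def q_def)
    finally show "prob (exceed T (l * rate T)) \<le> 2 * ln T powr (- q)" by simp
  qed
  with q show ?thesis by blast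
qed

theorem eventually_le_rate:
  assumes c: "a powr (- \<rho>) < c"
  shows "AE \<omega> in M. \<forall>\<^sub>F t in at_top. \<gamma> t \<omega> \<le> c * rate t"
proof -
  obtain l where l: "a powr (- \<rho>) < l" "l < c" using dense[OF c] by blast
  have l0: "0 < l" using l(1) by (rule le_less_trans[OF powr_ge_zero])
  \<comment> \<open>Makes \<open>\<theta> powr (2 - \<rho>)\<close> the midpoint of 1 and
    \<open>c / l\<close>: one geometric step costs less than the room between \<open>l\<close> and
    \<open>c\<close>.\<close>
  define \<theta> where "\<theta> = ((1 + c / l) / 2) powr (1 / (2 - \<rho>))"
  have cl: "1 < c / l" using l(2) l0 by simp
  have \<theta>_powr: "\<theta> powr (2 - \<rho>) = (1 + c / l) / 2"
    using cl \<rho>_bounds by (simp add: \<theta>_def powr_powr)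
  have \<theta>: "1 < \<theta>"
    unfolding \<theta>_def using cl \<rho>_bounds by (intro gr_one_powr) auto
  have lt: "\<theta> powr (2 - \<rho>) < c / l" 
  proof -
    have "(1 + w) / 2 < w" if "1 < w" for w :: real using that by simp
    from this[OF cl] show ?thesis unfolding \<theta>_powr .
  qed
  obtain q where q: "1 < q" "\<forall>\<^sub>F T in at_top. prob (exceed T (l * rate T)) \<le> 2 * ln T powr (- q)"
    using exceed_probability[OF l(1)] by blast
  let ?E = "\<lambda>n. exceed (\<theta> ^ n) (l * rate (\<theta> ^ n))"
  have \<theta>n: "0 < \<theta> ^ n" for n using \<theta> by simp
  have geo: "filterlim (\<lambda>n. \<theta> ^ n) at_top sequentially"
    using \<theta> by (rule filterlim_power_at_top)
  \<comment> \<open>Along powers of \<theta> the logarithm is linear in \<open>n\<close>, so the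
    bound becomes a convergent series of powers of \<open>n\<close>.\<close>
  have "summable (\<lambda>n. prob (?E n))"
  proof (rule summable_comparison_test_ev)
    show "\<forall>\<^sub>F n in sequentially. norm (prob (?E n)) \<le> 2 * ln \<theta> powr (- q) * real n powr (- q)"
      using eventually_compose_filterlim[OF q(2) geo]
    proof eventually_elim
      fix n assume "prob (?E n) \<le> 2 * ln (\<theta> ^ n) powr (- q)"
      also have "ln (\<theta> ^ n) = ln \<theta> * real n" using \<theta> by (simp add: ln_realpow)
      also have "(ln \<theta> * real n) powr (- q) = ln \<theta> powr (- q) * real n powr (- q)"
        using \<theta> by (intro powr_mult) 
      finally show "norm (prob (?E n)) \<le> 2 * ln \<theta> powr (- q) * real n powr (- q)" by simp
    qed
    show "summable (\<lambda>n. 2 * ln \<theta> powr (- q) * real n powr (- q))"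
      using q(1) by (intro summable_mult) (simp add: summable_real_powr_iff)
  qed
  then have bc: "AE \<omega> in M. \<forall>\<^sub>F n in sequentially. \<omega> \<in> space M - ?E n"
    by (intro borel_cantelli_AE1) (auto simp: exceed_measurable \<theta>n less_top[symmetric])
  have ev: "\<forall>\<^sub>F t in at_top. rate (\<theta> * t) \<le> c / l * rate t"
    using \<theta> lt by (rule rate_mult_le)
  show ?thesis
    using bc not_exceed
  proof eventually_elim
    fix \<omega> assume "\<forall>\<^sub>F n in sequentially. \<omega> \<in> space M - ?E n"
      and ne: "\<forall>T>0. \<forall>y. \<omega> \<notin> exceed T y \<longrightarrow> (\<forall>t\<in>{0..T}. \<gamma> t \<omega> \<le> y)"
    then obtain N where "\<forall>n\<ge>N. \<omega> \<in> space M - ?E n" unfolding eventually_sequentially by blast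
    then have N: "\<And>n. N \<le> n \<Longrightarrow> \<omega> \<notin> ?E n" by blast
    show "\<forall>\<^sub>F t in at_top. \<gamma> t \<omega> \<le> c * rate t"
      using ev eventually_gt_at_top[of "\<theta> ^ N"] eventually_gt_at_top[of "exp 1"]
    proof eventually_elim
      fix t assume t: "rate (\<theta> * t) \<le> c / l * rate t" "\<theta> ^ N < t" "exp 1 < t"
      have t1: "1 < t" using t(3) by (rule less_trans[rotated]) simp
      \<comment> \<open>The step containing \<open>t\<close>:
        \<open>\<theta> ^ (n - 1) < t \<le> \<theta> ^ n\<close>. As \<open>t\<close> exceeds
        \<open>\<theta> ^ N\<close>, the index is beyond \<open>N\<close> and in particular
        positive.\<close>
      define n where "n = (LEAST n. t \<le> \<theta> ^ n)"
      have "\<exists>n. t \<le> \<theta> ^ n" using real_arch_pow[OF \<theta>, of t] by (auto intro: less_imp_le)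
      then have n: "t \<le> \<theta> ^ n" unfolding n_def by (rule LeastI_ex)
      have "\<not> n \<le> N"
      proof
        assume "n \<le> N"
        then have "\<theta> ^ n \<le> \<theta> ^ N" using \<theta> by (intro power_increasing) auto
        then show False using n t(2) by linarith
      qed
      then obtain n' where n': "n = Suc n'" by (cases n) auto
      have "\<not> t \<le> \<theta> ^ n'" using not_less_Least[of n' "\<lambda>n. t \<le> \<theta> ^ n"] n' by (simp add: n_def)
      then have up: "\<theta> ^ n \<le> \<theta> * t" using \<theta> by (simp add: n')
      have "\<gamma> t \<omega> \<le> l * rate (\<theta> ^ n)"
        using ne[rule_format, OF \<theta>n N, of n t] n t1 \<open>\<not> n \<le> N\<close> by auto
      also have "\<dots> \<le> l * rate (\<theta> * t)"
        using l0 up n t(3) by (intro mult_left_mono rate_mono) auto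
      also have "\<dots> \<le> l * (c / l * rate t)"
        using l0 t(1) by (intro mult_left_mono) auto
      finally show "\<gamma> t \<omega> \<le> c * rate t" using l0 by simp
    qed
  qed
qed

section \<open>Lower bound\<close>

theorem frequently_ge_rate:
  assumes c: "0 < c" "c < a powr (- \<rho>)"
  shows "AE \<omega> in M. \<exists>\<^sub>F t in at_top. c * rate t \<le> \<gamma> t \<omega>"
proof -
  obtain l where l: "c < l" "l < a powr (- \<rho>)" using dense[OF c(2)] by blast
  have l0: "0 < l" using l(1) c(1) by linarith
  \<comment> \<open>\<eta> will be the fraction of [0, T (Suc n)] covered by the last interval. Its
    local time scales with \<open>\<eta> powr (2 - \<rho>)\<close>, set to the midpoint of
    \<open>c / l\<close> and 1 so that the level stays above \<open>c\<close>.\<close>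
  define \<eta> where "\<eta> = ((1 + c / l) / 2) powr (1 / (2 - \<rho>))"
  have cl: "0 < c / l" "c / l < 1" using l(1) l0 c(1) by auto
  have \<eta>_powr: "\<eta> powr (2 - \<rho>) = (1 + c / l) / 2"
    using cl \<rho>_bounds by (simp add: \<eta>_def powr_powr)
  have \<eta>: "0 < \<eta>" "\<eta> < 1"
  proof -
    show "0 < \<eta>" unfolding \<eta>_def using cl by simp
    have "\<eta> < 1 powr (1 / (2 - \<rho>))"
      unfolding \<eta>_def using cl \<rho>_bounds by (intro powr_less_mono2) auto
    then show "\<eta> < 1" by simp
  qed
  \<comment> \<open>The level reached by the last interval relative to the whole. The surplus
    \<open>\<mu> - c\<close> has to pay for the past and for the cross term.\<close>
  define \<mu> where "\<mu> = l * \<eta> powr (2 - \<rho>)"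
  have \<mu>: "c < \<mu>" unfolding \<mu>_def \<eta>_powr using l(1) l0 by (simp add: field_simps)
  \<comment> \<open>Solves \<open>\<theta> - 1 = \<eta> * \<theta>\<close>, so that the last
    interval is exactly the fraction \<eta>.\<close>
  define \<theta> where "\<theta> = 1 / (1 - \<eta>)"
  have \<theta>: "1 < \<theta>" using \<eta> by (simp add: \<theta>_def)
  define T where "T n = \<theta> ^ n" for n
  let ?ll = "\<lambda>n. ln (ln (T (Suc n)))"
  have T: "0 < T n" "T n \<le> T (Suc n)" for n
    using \<theta> by (auto simp: T_def)
  have Tdiff: "T (Suc n) - T n = \<eta> * T (Suc n)" for n
    using \<eta> by (simp add: T_def \<theta>_def field_simps)
  have geo: "filterlim (\<lambda>n. T (Suc n)) at_top sequentially"
    unfolding T_def using filterlim_compose[OF filterlim_power_at_top[OF \<theta>] filterlim_Suc] .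
  obtain K where K: "0 \<le> K" "\<And>t T. 0 \<le> t \<Longrightarrow> t \<le> T \<Longrightarrow>
     AE \<omega> in M. \<gamma> t \<omega> + renorm (T - t) (shift t \<omega>) - K * T powr (2 - \<rho>) \<le> \<gamma> T \<omega>"
    using superadditive by blast
  let ?inc = "\<lambda>n \<omega>. renorm (T (Suc n) - T n) (shift (T n) \<omega>)"
  let ?sup = "\<lambda>\<omega>. \<forall>n. \<gamma> (T n) \<omega> + ?inc n \<omega> - K * T (Suc n) powr (2 - \<rho>) \<le> \<gamma> (T (Suc n)) \<omega>"
  \<comment> \<open>The iterated logarithm is taken at the endpoint \<open>T (Suc n)\<close>, as in
    \<open>rate\<close>, while the power uses the length of the interval.\<close>
  define B where "B n = {\<omega> \<in> space M. l * ?ll n powr \<rho> * (T (Suc n) - T n) powr (2 - \<rho>) \<le> ?inc n \<omega>}" for n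
  have Bm: "B n \<in> sets (incr {T n..T (Suc n)})" for n
    unfolding B_def using T[of n] by (intro renorm_shift_event) auto
  \<comment> \<open>By stationarity and scaling \<open>prob (B n)\<close> is the tail at a multiple
    of the iterated logarithm. As \<open>l\<close> is below the critical level, some
    \<open>a' > a\<close> still has exponent \<open>q = a' * s < 1\<close>, and the lower tail bound
    forces divergence.\<close>
  have Bp: "\<not> summable (\<lambda>n. prob (B n))"
  proof
    assume sum: "summable (\<lambda>n. prob (B n))"
    define s where "s = l powr (1 / \<rho>)"
    have s: "0 < s" "a * s < 1" using l0 l(2) powr_\<rho>_bounds(2)[OF l0] by (auto simp: s_def)
    then have "a < 1 / s" by (simp add: less_divide_eq)
    then obtain a' where a': "a < a'" "a' < 1 / s" using dense by blast
    define q where "q = a' * s"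
    have q: "q < 1" using a'(2) s(1) by (simp add: q_def less_divide_eq)
    have "filterlim (\<lambda>T. s * ln (ln T)) at_top at_top"
      using s(1) by (intro filterlim_tendsto_pos_mult_at_top[OF tendsto_const _ filterlim_ln_ln])
    from eventually_compose_filterlim[OF tail_lower[OF a'(1)] this]
    have "\<forall>\<^sub>F T in at_top. exp (- (a' * (s * ln (ln T)))) \<le> tail (s * ln (ln T))" .
    moreover have "\<forall>\<^sub>F T::real in at_top. 0 < ln (ln T)"
      using filterlim_ln_ln by (simp add: filterlim_at_top_dense)
    ultimately have "\<forall>\<^sub>F T in at_top. 0 < ln (ln T) \<and> exp (- (a' * (s * ln (ln T)))) \<le> tail (s * ln (ln T))"
      by eventually_elim simp
    from eventually_compose_filterlim[OF this geo]
    have "\<forall>\<^sub>F n in sequentially. norm (real (Suc n) powr (- q) * ln \<theta> powr (- q)) \<le> prob (B n)"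
    proof eventually_elim
      fix n
      assume n: "0 < ?ll n \<and> exp (- (a' * (s * ?ll n))) \<le> tail (s * ?ll n)"
      have lnT: "ln (T (Suc n)) = real (Suc n) * ln \<theta>" using \<theta> by (simp add: T_def ln_realpow del: power_Suc of_nat_Suc)
      have pos: "0 < T (Suc n) - T n" using \<eta> T(1)[of "Suc n"] by (simp add: Tdiff)
      have "real (Suc n) powr (- q) * ln \<theta> powr (- q) = ln (T (Suc n)) powr (- q)"
        unfolding lnT using \<theta> by (intro powr_mult[symmetric]) 
      also have "\<dots> = exp (- (a' * (s * ?ll n)))"
        unfolding powr_def using \<theta> by (simp add: lnT q_def del: of_nat_Suc)
      also have "\<dots> \<le> tail (s * ?ll n)" using n by simp
      also have "\<dots> = \<P>(\<omega> in M. l * ?ll n powr \<rho> \<le> \<gamma> 1 \<omega>)"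
        unfolding s_def using l0 n by (intro prob_ge_eq_tail[symmetric]) auto
      also have "\<dots> = \<P>(\<omega> in M. l * ?ll n powr \<rho> * (T (Suc n) - T n) powr (2 - \<rho>) \<le> \<gamma> (T (Suc n) - T n) \<omega>)"
        by (rule prob_scaling[OF pos, symmetric])
      also have "\<dots> = prob (B n)"
        unfolding B_def using T(1)[of n] pos by (intro prob_renorm_shift[symmetric]) auto
      finally show "norm (real (Suc n) powr (- q) * ln \<theta> powr (- q)) \<le> prob (B n)" by simp
    qed
    then have "summable (\<lambda>n. real (Suc n) powr (- q) * ln \<theta> powr (- q))"
      using sum by (rule summable_comparison_test_ev)
    then have "summable (\<lambda>n. real (Suc n) powr (- q))"
      using \<theta> by (simp add: mult.commute[of _ "ln \<theta> powr (- q)"] summable_cmult_iff)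
    then have "summable (\<lambda>n. real n powr (- q))"
      by (subst (asm) summable_Suc_iff[of "\<lambda>n. real n powr (- q)"])
    then show False using q by (simp add: summable_real_powr_iff)
  qed
  \<comment> \<open>\<open>W\<close> does not involve \<delta>, so probability at least
    \<open>1 - \<delta>\<close> for every \<delta> gives probability 1.\<close>
  define W where "W = {\<omega> \<in> space M. \<forall>m. \<exists>n\<ge>m. c * rate (T (Suc n)) \<le> \<gamma> (T (Suc n)) \<omega>}"
  have [measurable]: "\<gamma> (T n) \<in> borel_measurable M" for n
    using T(1)[of n] by (intro measurable_\<gamma>) simp
  have Wm: "W \<in> sets M" unfolding W_def by measurable
  have "1 - \<delta> \<le> prob W" if \<delta>: "0 < \<delta>" "\<delta> \<le> 1" for \<delta>
  proof -
    obtain k where k: "0 \<le> k" "1 - \<delta> \<le> \<P>(\<omega> in M. - k \<le> \<gamma> 1 \<omega>)"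
      using lower_tail_tight[of "\<gamma> 1" \<delta>] \<delta> by auto
    \<comment> \<open>By scaling, a single constant \<open>k\<close>, depending on \<delta>, bounds
      the past from below at every \<open>n\<close> with probability at least
      \<open>1 - \<delta>\<close>.\<close>
    define A where "A n = {\<omega> \<in> space M. - k * T n powr (2 - \<rho>) \<le> renorm (T n) (shift 0 \<omega>)}" for n
    have Am: "A n \<in> sets (incr {0..T n})" for n
      unfolding A_def using renorm_shift_event(1)[of 0 "T n"] T(1)[of n] by simp
    have Ap: "1 - \<delta> \<le> prob (A n)" for n
      unfolding A_def using T(1)[of n] k(2) prob_scaling[of "T n" "- k"]
      by (subst prob_renorm_shift) auto
    let ?R = "\<lambda>m. \<Union>n\<in>{m..}. A n \<inter> B n"
    have ABm: "A n \<inter> B n \<in> sets M" for n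
      using Am[of n] Bm[of n] sets_incr_algebra_subset[of "{0..T n}"] sets_incr_algebra_subset[of "{T n..T (Suc n)}"] T(1)[of n]
      by auto
    have R: "1 - \<delta> \<le> prob (?R m)" for m
      using T(1) T(2) \<delta> by (intro borel_cantelli_past_future[of T, OF _ _ Am Ap Bm Bp]) (auto intro: less_imp_le)
    have "(\<lambda>m. prob (?R m)) \<longlonglongrightarrow> prob (\<Inter>m. ?R m)"
    proof (rule finite_Lim_measure_decseq)
      show "decseq ?R" unfolding decseq_def by (intro allI impI UN_mono) auto
    qed (use ABm in blast)
    then have "1 - \<delta> \<le> prob (\<Inter>m. ?R m)"
      by (rule LIMSEQ_le_const) (use R in blast)
    also have "\<dots> \<le> prob W"
    proof (rule finite_measure_mono_AE[OF _ Wm])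
      \<comment> \<open>The past costs at most \<open>k\<close> and the cross term \<open>K\<close>,
        both in units of \<open>T (Suc n) powr (2 - \<rho>)\<close>; the surplus
        \<open>\<mu> - c\<close> gains the unbounded iterated logarithm in the same units.\<close>
      have "\<forall>\<^sub>F t::real in at_top. (k + K) / (\<mu> - c) \<le> ln (ln t) powr \<rho>"
        using filterlim_ln_ln_powr by (simp add: filterlim_at_top)
      from eventually_compose_filterlim[OF this geo]
      obtain N where N: "\<And>n. N \<le> n \<Longrightarrow> (k + K) / (\<mu> - c) \<le> ?ll n powr \<rho>"
        by (auto simp: eventually_sequentially)
      have "AE \<omega> in M. ?sup \<omega>"
        unfolding AE_all_countable using T by (intro allI K(2)) (auto intro: less_imp_le)
      moreover have "AE \<omega> in M. \<forall>n. renorm (T n) (shift 0 \<omega>) = \<gamma> (T n) \<omega>"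
        unfolding AE_all_countable using T by (intro allI renorm_shift_0) (auto intro: less_imp_le)
      ultimately show "AE \<omega> in M. \<omega> \<in> (\<Inter>m. ?R m) \<longrightarrow> \<omega> \<in> W"
      proof eventually_elim
        fix \<omega> assume sup: "?sup \<omega>"
          and eq: "\<forall>n. renorm (T n) (shift 0 \<omega>) = \<gamma> (T n) \<omega>"
        show "\<omega> \<in> (\<Inter>m. ?R m) \<longrightarrow> \<omega> \<in> W"
        proof
          assume in_R: "\<omega> \<in> (\<Inter>m. ?R m)"
          have "\<exists>n\<ge>m. c * rate (T (Suc n)) \<le> \<gamma> (T (Suc n)) \<omega>" for m
          proof -
            have "\<omega> \<in> ?R (max m N)" using in_R by blast
            then obtain n where n: "max m N \<le> n" "\<omega> \<in> A n" "\<omega> \<in> B n" by auto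
            let ?t = "T (Suc n) powr (2 - \<rho>)" and ?x = "?ll n powr \<rho>"
            have 1: "- k * T n powr (2 - \<rho>) \<le> \<gamma> (T n) \<omega>"
              using n(2) eq by (simp add: A_def)
            have "T n powr (2 - \<rho>) \<le> ?t"
              using T(1)[of n] T(2)[of n] \<rho>_bounds by (intro powr_mono2) auto
            then have 2: "k * T n powr (2 - \<rho>) \<le> k * ?t" using k(1) by (rule mult_left_mono)
            have "(T (Suc n) - T n) powr (2 - \<rho>) = \<eta> powr (2 - \<rho>) * ?t"
              unfolding Tdiff using \<eta> T(1)[of "Suc n"] by (intro powr_mult) 
            then have 3: "\<mu> * (?x * ?t) \<le> ?inc n \<omega>"
              using n(3) by (simp add: B_def \<mu>_def mult_ac)
            have "k + K \<le> (\<mu> - c) * ?x"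
              using N[of n] n(1) \<mu> by (simp add: divide_le_eq mult.commute)
            then have "(k + K) * ?t \<le> (\<mu> - c) * ?x * ?t" by (rule mult_right_mono) simp
            then have "c * (?x * ?t) + k * ?t + K * ?t \<le> \<mu> * (?x * ?t)"
              by (simp add: algebra_simps)
            moreover have "\<gamma> (T n) \<omega> + ?inc n \<omega> - K * ?t \<le> \<gamma> (T (Suc n)) \<omega>"
              using sup by blast
            ultimately have "c * (?x * ?t) \<le> \<gamma> (T (Suc n)) \<omega>"
              using 1 2 3 by linarith
            then show ?thesis using n(1) by (auto simp: rate_def mult.commute)
          qed
          moreover have "\<omega> \<in> space M" using in_R by (auto simp: A_def)
          ultimately show "\<omega> \<in> W" by (simp add: W_def)
        qed
      qed
    qed
    finally show ?thesis .
  qed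
  note W_ge = this
  have "1 \<le> prob W"
  proof (rule field_le_epsilon)
    fix \<delta> :: real assume \<delta>: "0 < \<delta>"
    show "1 \<le> prob W + \<delta>"
    proof (cases "\<delta> \<le> 1")
      case True
      then show ?thesis using W_ge[OF \<delta>] by linarith
    next
      case False
      then show ?thesis using measure_nonneg[of M W] by linarith
    qed
  qed
  then have "prob W = 1" using prob_le_1[of W] by linarith
  then have "AE \<omega> in M. \<omega> \<in> W" using Wm by (simp add: prob_eq_1)
  then show ?thesis
  proof eventually_elim
    fix \<omega> assume \<omega>: "\<omega> \<in> W"
    show "\<exists>\<^sub>F t in at_top. c * rate t \<le> \<gamma> t \<omega>"
      unfolding frequently_def
    proof
      assume "\<forall>\<^sub>F t in at_top. \<not> c * rate t \<le> \<gamma> t \<omega>"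
      from eventually_compose_filterlim[OF this geo]
      show False using \<omega> by (auto simp: eventually_sequentially W_def)
    qed
  qed
qed

text \<open>Both bounds are used at countably many levels converging to the limit, so that a single
  null set suffices.\<close>

theorem limsup_eq:
  "AE \<omega> in M. Limsup at_top (\<lambda>t. ereal (\<gamma> t \<omega> / rate t)) = ereal (a powr (- \<rho>))"
proof -
  let ?A = "a powr (- \<rho>)"
  have A: "0 < ?A" using a_pos by simp
  have pos: "\<forall>\<^sub>F t in at_top. 0 < rate t"
  proof -
    have "\<forall>\<^sub>F T::real in at_top. 0 < ln (ln T)"
      using filterlim_ln_ln by (simp add: filterlim_at_top_dense)
    then show ?thesis
      using eventually_gt_at_top[of "0::real"] by eventually_elim (simp add: rate_def)
  qed
  have "AE \<omega> in M. \<forall>j. \<forall>\<^sub>F t in at_top. \<gamma> t \<omega> \<le> (?A + 1 / real (Suc j)) * rate t"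
    unfolding AE_all_countable by (intro allI eventually_le_rate) simp
  \<comment> \<open>Starting from \<open>Suc (Suc j)\<close> keeps every level strictly positive, as
    the lower bound demands.\<close>
  moreover have "AE \<omega> in M. \<forall>j. \<exists>\<^sub>F t in at_top. ?A * (1 - 1 / real (Suc (Suc j))) * rate t \<le> \<gamma> t \<omega>"
    unfolding AE_all_countable using A by (intro allI frequently_ge_rate) auto
  ultimately show ?thesis
  proof eventually_elim
    fix \<omega> assume up: "\<forall>j. \<forall>\<^sub>F t in at_top. \<gamma> t \<omega> \<le> (?A + 1 / real (Suc j)) * rate t"
      and lo: "\<forall>j. \<exists>\<^sub>F t in at_top. ?A * (1 - 1 / real (Suc (Suc j))) * rate t \<le> \<gamma> t \<omega>"
    let ?L = "Limsup at_top (\<lambda>t. ereal (\<gamma> t \<omega> / rate t))"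
    have upper: "?L \<le> ereal (?A + 1 / real (Suc j))" for j
    proof (rule Limsup_bounded)
      show "\<forall>\<^sub>F t in at_top. ereal (\<gamma> t \<omega> / rate t) \<le> ereal (?A + 1 / real (Suc j))"
        using pos up[rule_format, of j] by eventually_elim (simp add: divide_le_eq)
    qed
    have lower: "ereal (?A * (1 - 1 / real (Suc (Suc j)))) \<le> ?L" for j
    proof (rule ccontr)
      assume "\<not> ?thesis"
      then have "?L < ereal (?A * (1 - 1 / real (Suc (Suc j))))" by simp
      then have "\<forall>\<^sub>F t in at_top. ereal (\<gamma> t \<omega> / rate t) < ereal (?A * (1 - 1 / real (Suc (Suc j))))"
        by (rule Limsup_lessD)
      then have "\<forall>\<^sub>F t in at_top. \<not> ?A * (1 - 1 / real (Suc (Suc j))) * rate t \<le> \<gamma> t \<omega>"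
        using pos by eventually_elim (simp add: divide_less_eq)
      with lo[rule_format, of j] show False by (simp add: frequently_def)
    qed
    have "(\<lambda>j. ereal (?A + 1 / real (Suc j))) \<longlonglongrightarrow> ereal (?A + 0)"
      by (intro tendsto_intros LIMSEQ_Suc[OF lim_1_over_n])
    then have "?L \<le> ereal (?A + 0)"
      by (rule LIMSEQ_le_const) (use upper in blast)
    moreover have "(\<lambda>j. ereal (?A * (1 - 1 / real (Suc (Suc j))))) \<longlonglongrightarrow> ereal (?A * (1 - 0))"
      by (intro tendsto_intros LIMSEQ_Suc[OF LIMSEQ_Suc[OF lim_1_over_n]])
    then have "ereal (?A * (1 - 0)) \<le> ?L"
      by (rule LIMSEQ_le_const2) (use lower in blast)
    ultimately show "?L = ereal ?A" by simp
  qed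
qed

end

theorem theorem3:
  fixes M :: "'w measure"
    and X :: "real \<Rightarrow> 'w \<Rightarrow> 'a::euclidean_space"
    and \<beta> :: real and \<psi> :: "'a \<Rightarrow> real"
    and f :: "'a \<Rightarrow> real" and \<gamma> :: "real \<Rightarrow> 'w \<Rightarrow> real" and a :: real
  assumes "symmetric_stable_process M X \<beta> \<psi>"
    and "2 * real DIM('a) / 3 < \<beta>" and "\<beta> \<le> real DIM('a)"
    and "mollifier f"
    and "renormalized_self_intersection_local_time M X f \<gamma>"
    and "0 < a"
    and "\<And>h::real. 0 < h \<Longrightarrow>
           ((\<lambda>t. ln (measure M {\<omega> \<in> space M. h * t\<^sup>2 \<le> \<gamma> t \<omega>}) / t)
              \<longlongrightarrow> - (h powr (\<beta> / real DIM('a))) * a) at_top"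
  shows "AE \<omega> in M.
           Limsup at_top
             (\<lambda>t. ereal (\<gamma> t \<omega> /
                (t powr (2 - real DIM('a) / \<beta>) * (ln (ln t)) powr (real DIM('a) / \<beta>))))
           = ereal (a powr (- (real DIM('a) / \<beta>)))"
proof -
  interpret symmetric_stable_process M X \<beta> \<psi> by fact
  \<comment> \<open>From \<open>\<beta> > 2d/3\<close> follows \<open>2\<beta> > d\<close>. The
    large deviation limit is taken at \<open>h = 1\<close>, where the factor \<open>h powr _\<close>
    equals 1.\<close>
  interpret renormalized_stable_ldp M X \<beta> \<psi> f \<gamma> a
    using assms(2,4,5,6) assms(7)[of 1] DIM_positive[where 'a='a] by unfold_locales auto
  show ?thesis
    using limsup_eq by (simp add: rate_def \<rho>_def)
qed

end
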